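(* Let $G/H$ be a homogeneous sphere on which the compact connected Lie group $G$ acts effectively, let $\langle\cdot,\cdot\rangle_{\mathrm{bi}}$ be an $\mathrm{Ad}(G)$-invariant inner product on the Lie algebra $\mathfrak{g}$ of $G$, and let $\mathfrak{g}=\mathfrak{h}+\mathfrak{m}$ be the $\langle\cdot,\cdot\rangle_{\mathrm{bi}}$-orthogonal reductive decomposition, where $\mathfrak{h}$ is the Lie algebra of $H$. Assume that $G/H$ admits non-Riemannian $G$-invariant Randers metrics, i.e. that the fixed point set $\mathfrak{m}_0=\{v\in\mathfrak{m}:\mathrm{Ad}(h)v=v\text{ for all }h\in H\}$ of the $\mathrm{Ad}(H)$-action on $\mathfrak{m}$ is not zero. Then: (1) if $G/H=SU(n+1)/SU(n)$ with $n\ge 2$, or $G/H=U(n+1)/U(n)$ with $n\ge 1$, or $G/H=Sp(n+1)U(1)/Sp(n)U(1)$ with $n\geq 1$, then the set of Randers equigeodesic vectors for $G/H$ which are contained in $\mathfrak{m}$ is $\mathfrak{m}_0\setminus\{0\}$; (2) if $G/H=Sp(n+1)/Sp(n)$ with $n\ge 1$, then $G/H$ has no Randers equigeodesics and no Randers equigeodesic vectors.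
   Context: The homogeneous spheres in the statement are the standard ones. $SU(n+1)$ and $U(n+1)$ act on the unit sphere $S^{2n+1}\subset\mathbb{C}^{n+1}$, $Sp(n+1)$ acts on the unit sphere $S^{4n+3}\subset\mathbb{H}^{n+1}$ by left matrix multiplication, and $Sp(n+1)U(1)=(Sp(n+1)\times U(1))/\{\pm(I,1)\}$ acts on $S^{4n+3}\subset\mathbb{H}^{n+1}$ by $(A,z)\cdot x=Axz^{-1}$, where $U(1)\subset\mathbb{C}\subset\mathbb{H}$. In each case $H$ is the stabilizer of the last standard basis vector. In the last case, with $\mathfrak{g}=sp(n+1)\oplus\mathbb{R}$, where $sp(n+1)=\{X\in\mathbb{H}^{(n+1)\times(n+1)}: X+\overline{X}^t=0\}$, the isotropy subalgebra is $\mathfrak{h}=\{(\mathrm{diag}(C,a\mathbf{i}),a): C\in sp(n),\ a\in\mathbb{R}\}$. Put $o=eH\in G/H$ and identify $T_o(G/H)$ with $\mathfrak{m}$. $G$-invariant Finsler metrics on $G/H$ correspond one-to-one to $\mathrm{Ad}(H)$-invariant Minkowski norms on $\mathfrak{m}$. A $G$-invariant Randers metric on $G/H$ is the one determined by a Minkowski norm $F(y)=\alpha(y,y)^{1/2}+\alpha(y,u)$ on $\mathfrak{m}$, where $\alpha$ is an $\mathrm{Ad}(H)$-invariant inner product on $\mathfrak{m}$ and $u\in\mathfrak{m}_0$ is a nonzero vector with $\alpha(u,u)<1$. A (nonconstant) geodesic of a $G$-invariant metric on $G/H$ is homogeneous if it is an orbit $t\mapsto\exp(tX)\cdot p$ of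 a one-parameter subgroup of $G$. A smooth curve on $G/H$ is a Randers equigeodesic if it is a homogeneous geodesic for every $G$-invariant Randers metric on $G/H$. A vector $X\in\mathfrak{g}$ is a Randers equigeodesic vector for $G/H$ if $X\notin\mathfrak{h}$ and the curve $c(t)=\exp(tX)\cdot o$ is a Randers equigeodesic, i.e. is a geodesic of every $G$-invariant Randers metric on $G/H$. *)

theory Defs
  imports "HOL-Analysis.Analysis"
begin

section \<open>Quaternions\<close>

datatype quat = Quat (qRe: real) (qI: real) (qJ: real) (qK: real)

lemma quat_eq_iff:
  "x = y \<longleftrightarrow> qRe x = qRe y \<and> qI x = qI y \<and> qJ x = qJ y \<and> qK x = qK y"
  by (cases x; cases y) auto

instantiation quat :: ring_1
begin

definition "0 = Quat 0 0 0 0"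
definition "1 = Quat 1 0 0 0"
definition "x + y = Quat (qRe x + qRe y) (qI x + qI y) (qJ x + qJ y) (qK x + qK y)"
definition "- x = Quat (- qRe x) (- qI x) (- qJ x) (- qK x)"
definition "x - y = Quat (qRe x - qRe y) (qI x - qI y) (qJ x - qJ y) (qK x - qK y)"
definition "x * y = Quat
  (qRe x * qRe y - qI x * qI y - qJ x * qJ y - qK x * qK y)
  (qRe x * qI y + qI x * qRe y + qJ x * qK y - qK x * qJ y)
  (qRe x * qJ y - qI x * qK y + qJ x * qRe y + qK x * qI y)
  (qRe x * qK y + qI x * qJ y - qJ x * qI y + qK x * qRe y)"

instance
  by standard
    (simp_all add: quat_eq_iff zero_quat_def one_quat_def plus_quat_def uminus_quat_def
      minus_quat_def times_quat_def algebra_simps)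

end

instantiation quat :: real_algebra_1
begin

definition "r *\<^sub>R x = Quat (r * qRe x) (r * qI x) (r * qJ x) (r * qK x)"

instance
  by standard
    (simp_all add: quat_eq_iff plus_quat_def times_quat_def scaleR_quat_def algebra_simps)

end

lemma quat_sel_simps [simp]:
  "qRe 0 = 0" "qI 0 = 0" "qJ 0 = 0" "qK 0 = 0"
  "qRe 1 = 1" "qI 1 = 0" "qJ 1 = 0" "qK 1 = 0"
  "qRe (x + y) = qRe x + qRe y" "qI (x + y) = qI x + qI y"
  "qJ (x + y) = qJ x + qJ y" "qK (x + y) = qK x + qK y"
  "qRe (- x) = - qRe x" "qI (- x) = - qI x" "qJ (- x) = - qJ x" "qK (- x) = - qK x"
  "qRe (x - y) = qRe x - qRe y" "qI (x - y) = qI x - qI y"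
  "qJ (x - y) = qJ x - qJ y" "qK (x - y) = qK x - qK y"
  "qRe (r *\<^sub>R x) = r * qRe x" "qI (r *\<^sub>R x) = r * qI x"
  "qJ (r *\<^sub>R x) = r * qJ x" "qK (r *\<^sub>R x) = r * qK x"
  by (simp_all add: zero_quat_def one_quat_def plus_quat_def uminus_quat_def minus_quat_def
      scaleR_quat_def)

instantiation quat :: real_inner
begin

definition "inner x y = qRe x * qRe y + qI x * qI y + qJ x * qJ y + qK x * qK y"

definition "norm (x :: quat) = sqrt (inner x x)"

definition sgn_quat_def: "sgn (x :: quat) = x /\<^sub>R norm x"

definition dist_quat_def: "dist (x :: quat) y = norm (x - y)"

definition uniformity_quat_def [code del]:
  "(uniformity :: (quat \<times> quat) filter) = (INF e\<in>{0 <..}. principal {(x, y). dist x y < e})"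

definition open_quat_def [code del]:
  "open (U :: quat set) \<longleftrightarrow> (\<forall>x\<in>U. eventually (\<lambda>(x', y). x' = x \<longrightarrow> y \<in> U) uniformity)"

instance
proof
  fix x y z :: quat and r :: real and U :: "quat set"
  show "inner x y = inner y x"
    by (simp add: inner_quat_def mult.commute)
  show "inner (x + y) z = inner x z + inner y z"
    by (simp add: inner_quat_def algebra_simps)
  show "inner (r *\<^sub>R x) y = r * inner x y"
    by (simp add: inner_quat_def algebra_simps)
  show "0 \<le> inner x x"
    by (simp add: inner_quat_def)
  show "inner x x = 0 \<longleftrightarrow> x = 0"
    by (simp add: inner_quat_def quat_eq_iff add_nonneg_eq_0_iff)
  show "norm x = sqrt (inner x x)"
    by (rule norm_quat_def)
qed (rule sgn_quat_def dist_quat_def uniformity_quat_def open_quat_def)+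

end

instantiation quat :: euclidean_space
begin

definition "Basis = {Quat 1 0 0 0, Quat 0 1 0 0, Quat 0 0 1 0, Quat 0 0 0 1}"

instance
proof
  fix x u v :: quat
  show "Basis \<noteq> ({} :: quat set)" "finite (Basis :: quat set)"
    by (simp_all add: Basis_quat_def)
  show "inner u v = (if u = v then 1 else 0)" if "u \<in> Basis" "v \<in> Basis"
    using that unfolding Basis_quat_def inner_quat_def by (elim insertE emptyE) simp_all
  show "(\<forall>u\<in>Basis. inner x u = 0) \<longleftrightarrow> x = 0"
    by (simp add: Basis_quat_def inner_quat_def quat_eq_iff [of x 0])
qed

end

definition qcnj :: "quat \<Rightarrow> quat" where
  "qcnj x = Quat (qRe x) (- qI x) (- qJ x) (- qK x)"

definition quat_of_complex :: "complex \<Rightarrow> quat" where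
  "quat_of_complex z = Quat (Re z) (Im z) 0 0"


section \<open>Linear Lie groups\<close>

text \<open>
  A compact group acting effectively and linearly on a Euclidean space \<open>V\<close> is identified with
  its image, a set of elements of \<open>V \<Rightarrow>\<^sub>L V\<close>; its Lie algebra then consists of elements of
  \<open>V \<Rightarrow>\<^sub>L V\<close> too, with the commutator as bracket.
\<close>

definition lin_exp :: "('v::real_normed_vector \<Rightarrow>\<^sub>L 'v) \<Rightarrow> ('v \<Rightarrow>\<^sub>L 'v)" where
  "lin_exp X = (\<Sum>k. (1 / fact k) *\<^sub>R (((o\<^sub>L) X ^^ k) id_blinfun))"

definition lie_algebra :: "('v::real_normed_vector \<Rightarrow>\<^sub>L 'v) set \<Rightarrow> ('v \<Rightarrow>\<^sub>L 'v) set" where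
  "lie_algebra G = {X. \<forall>t::real. lin_exp (t *\<^sub>R X) \<in> G}"

definition isotropy :: "('v::real_normed_vector \<Rightarrow>\<^sub>L 'v) set \<Rightarrow> 'v \<Rightarrow> ('v \<Rightarrow>\<^sub>L 'v) set" where
  "isotropy G p = {g \<in> G. blinfun_apply g p = p}"

definition Ad :: "('v::real_normed_vector \<Rightarrow>\<^sub>L 'v) \<Rightarrow> ('v \<Rightarrow>\<^sub>L 'v) \<Rightarrow> ('v \<Rightarrow>\<^sub>L 'v)" where
  "Ad g X = Blinfun (blinfun_apply g \<circ> blinfun_apply X \<circ> inv (blinfun_apply g))"

definition inner_product_on :: "'a::real_vector set \<Rightarrow> ('a \<Rightarrow> 'a \<Rightarrow> real) \<Rightarrow> bool" where
  "inner_product_on V B \<longleftrightarrow>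
     (\<forall>x\<in>V. \<forall>y\<in>V. B x y = B y x) \<and>
     (\<forall>x\<in>V. \<forall>y\<in>V. \<forall>z\<in>V. B (x + y) z = B x z + B y z) \<and>
     (\<forall>r. \<forall>x\<in>V. \<forall>y\<in>V. B (r *\<^sub>R x) y = r * B x y) \<and>
     (\<forall>x\<in>V. x \<noteq> 0 \<longrightarrow> B x x > 0)"

definition bi_invariant_inner_product ::
  "('v::real_normed_vector \<Rightarrow>\<^sub>L 'v) set \<Rightarrow> (('v \<Rightarrow>\<^sub>L 'v) \<Rightarrow> ('v \<Rightarrow>\<^sub>L 'v) \<Rightarrow> real) \<Rightarrow> bool" where
  "bi_invariant_inner_product G B \<longleftrightarrow>
     inner_product_on (lie_algebra G) B \<and>
     (\<forall>g\<in>G. \<forall>X\<in>lie_algebra G. \<forall>Y\<in>lie_algebra G. B (Ad g X) (Ad g Y) = B X Y)"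

text \<open>
  In the following \<open>G\<close> acts on the unit sphere, \<open>p\<close> is the base point, \<open>H = isotropy G p\<close>,
  and \<open>B\<close> is a bi-invariant inner product on the Lie algebra of \<open>G\<close>.
\<close>

definition reductive_compl ::
  "('v::real_normed_vector \<Rightarrow>\<^sub>L 'v) set \<Rightarrow> 'v \<Rightarrow> (('v \<Rightarrow>\<^sub>L 'v) \<Rightarrow> ('v \<Rightarrow>\<^sub>L 'v) \<Rightarrow> real) \<Rightarrow>
    ('v \<Rightarrow>\<^sub>L 'v) set" where
  "reductive_compl G p B =
     {X \<in> lie_algebra G. \<forall>Y\<in>lie_algebra (isotropy G p). B X Y = 0}"

definition fixed_compl ::
  "('v::real_normed_vector \<Rightarrow>\<^sub>L 'v) set \<Rightarrow> 'v \<Rightarrow> (('v \<Rightarrow>\<^sub>L 'v) \<Rightarrow> ('v \<Rightarrow>\<^sub>L 'v) \<Rightarrow> real) \<Rightarrow>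
    ('v \<Rightarrow>\<^sub>L 'v) set" where
  "fixed_compl G p B = {X \<in> reductive_compl G p B. \<forall>h\<in>isotropy G p. Ad h X = X}"


section \<open>The transitive groups on spheres\<close>

definition unitary_mat :: "complex^'n^'n \<Rightarrow> bool" where
  "unitary_mat A \<longleftrightarrow> (\<chi> i j. cnj (A $ j $ i)) ** A = mat 1"

definition quat_unitary_mat :: "quat^'n^'n \<Rightarrow> bool" where
  "quat_unitary_mat A \<longleftrightarrow> (\<chi> i j. qcnj (A $ j $ i)) ** A = mat 1"

definition U_group :: "((complex^'n) \<Rightarrow>\<^sub>L (complex^'n)) set" where
  "U_group = {g. \<exists>A. unitary_mat A \<and> (\<forall>x. blinfun_apply g x = A *v x)}"

definition SU_group :: "((complex^'n) \<Rightarrow>\<^sub>L (complex^'n)) set" where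
  "SU_group = {g. \<exists>A. unitary_mat A \<and> det A = 1 \<and> (\<forall>x. blinfun_apply g x = A *v x)}"

definition Sp_group :: "((quat^'n) \<Rightarrow>\<^sub>L (quat^'n)) set" where
  "Sp_group = {g. \<exists>A. quat_unitary_mat A \<and> (\<forall>x. blinfun_apply g x = A *v x)}"

text \<open>
  The pairs \<open>(A, z)\<close> and \<open>(- A, - z)\<close> define the same map, and these are the only coincidences,
  so this set is \<open>(Sp \<times> U(1)) / {\<plusminus>(I, 1)}\<close>.
\<close>

definition SpU1_group :: "((quat^'n) \<Rightarrow>\<^sub>L (quat^'n)) set" where
  "SpU1_group = {g. \<exists>A z. quat_unitary_mat A \<and> cmod z = 1 \<and>
     (\<forall>x. blinfun_apply g x = (\<chi> i. (A *v x) $ i * quat_of_complex (inverse z)))}"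


section \<open>Geodesics of Finsler metrics on the unit sphere\<close>

text \<open>\<open>Ck_on k f S\<close>: \<open>f\<close> is of class \<open>C\<^sup>k\<close> on the open set \<open>S\<close>.\<close>

primrec Ck_on ::
  "nat \<Rightarrow> ('a::real_normed_vector \<Rightarrow> 'b::real_normed_vector) \<Rightarrow> 'a set \<Rightarrow> bool" where
  "Ck_on 0 f S \<longleftrightarrow> continuous_on S f"
| "Ck_on (Suc k) f S \<longleftrightarrow>
     f differentiable_on S \<and> (\<forall>v. Ck_on k (\<lambda>x. frechet_derivative f (at x) v) S)"

definition smooth_on :: "'a set \<Rightarrow> ('a::real_normed_vector \<Rightarrow> 'b::real_normed_vector) \<Rightarrow> bool" where
  "smooth_on S f \<longleftrightarrow> (\<forall>k. Ck_on k f S)"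

text \<open>
  A metric is represented by a function \<open>F\<close> with \<open>F x v\<close> the length of the vector \<open>v\<close> tangent to
  the unit sphere at \<open>x\<close>; its values at other pairs \<open>(x, v)\<close> are irrelevant.
\<close>

definition finsler_length ::
  "('v::real_normed_vector \<Rightarrow> 'v \<Rightarrow> real) \<Rightarrow> real \<Rightarrow> real \<Rightarrow> (real \<Rightarrow> 'v) \<Rightarrow> real" where
  "finsler_length F a b c = integral {a..b} (\<lambda>t. F (c t) (vector_derivative c (at t)))"

text \<open>
  A smooth variation, within the unit sphere, of \<open>c\<close> restricted to \<open>[a, b]\<close> with fixed end
  points. The parameter of the variation is the first component; smoothness up to the boundary
  of \<open>[a, b]\<close> means smoothness on a neighbourhood.
\<close>

definition proper_variation ::
  "(real \<Rightarrow> 'v::real_normed_vector) \<Rightarrow> real \<Rightarrow> real \<Rightarrow> (real \<times> real \<Rightarrow> 'v) \<Rightarrow> bool" where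
  "proper_variation c a b \<gamma> \<longleftrightarrow>
     (\<exists>\<epsilon>>0. smooth_on ({-\<epsilon><..<\<epsilon>} \<times> {a-\<epsilon><..<b+\<epsilon>}) \<gamma> \<and>
       (\<forall>s\<in>{-\<epsilon><..<\<epsilon>}. \<forall>t\<in>{a..b}. \<gamma> (s, t) \<in> sphere 0 1) \<and>
       (\<forall>t\<in>{a-\<epsilon><..<b+\<epsilon>}. \<gamma> (0, t) = c t) \<and>
       (\<forall>s\<in>{-\<epsilon><..<\<epsilon>}. \<gamma> (s, a) = c a \<and> \<gamma> (s, b) = c b))"

text \<open>
  Geodesics are nonconstant, have constant speed, and are critical points of the length
  functional on every compact interval.
\<close>

definition finsler_geodesic ::
  "('v::real_normed_vector \<Rightarrow> 'v \<Rightarrow> real) \<Rightarrow> (real \<Rightarrow> 'v) \<Rightarrow> bool" where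
  "finsler_geodesic F c \<longleftrightarrow>
     smooth_on UNIV c \<and> (\<forall>t. c t \<in> sphere 0 1) \<and>
     (\<exists>l>0. \<forall>t. F (c t) (vector_derivative c (at t)) = l) \<and>
     (\<forall>a b \<gamma>. a < b \<and> proper_variation c a b \<gamma> \<longrightarrow>
       ((\<lambda>s. finsler_length F a b (\<lambda>t. \<gamma> (s, t))) has_real_derivative 0) (at 0))"


section \<open>Invariant Randers metrics and equigeodesics\<close>

text \<open>
  The first conjunct is \<open>G\<close>-invariance; as the elements of \<open>G\<close> are linear maps they are their own
  differentials. The Minkowski norm \<open>\<alpha>(Y,Y)\<^sup>1\<^sup>/\<^sup>2 + \<alpha>(Y,u)\<close> on the reductive complement is carried
  to the tangent space at \<open>p\<close> by \<open>Y \<mapsto> Y p\<close>, the derivative at \<open>t = 0\<close> of \<open>exp(tY) p\<close>.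
\<close>

definition invariant_randers_metric ::
  "('v::real_inner \<Rightarrow>\<^sub>L 'v) set \<Rightarrow> 'v \<Rightarrow> (('v \<Rightarrow>\<^sub>L 'v) \<Rightarrow> ('v \<Rightarrow>\<^sub>L 'v) \<Rightarrow> real) \<Rightarrow>
    ('v \<Rightarrow> 'v \<Rightarrow> real) \<Rightarrow> bool" where
  "invariant_randers_metric G p B F \<longleftrightarrow>
     (\<forall>g\<in>G. \<forall>x\<in>sphere 0 1. \<forall>v. inner x v = 0 \<longrightarrow>
        F (blinfun_apply g x) (blinfun_apply g v) = F x v) \<and>
     (\<exists>\<alpha> u. inner_product_on (reductive_compl G p B) \<alpha> \<and>
        (\<forall>h\<in>isotropy G p. \<forall>X\<in>reductive_compl G p B. \<forall>Y\<in>reductive_compl G p B.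
           \<alpha> (Ad h X) (Ad h Y) = \<alpha> X Y) \<and>
        u \<in> fixed_compl G p B \<and> u \<noteq> 0 \<and> \<alpha> u u < 1 \<and>
        (\<forall>Y\<in>reductive_compl G p B. F p (blinfun_apply Y p) = sqrt (\<alpha> Y Y) + \<alpha> Y u))"

definition homogeneous_geodesic ::
  "('v::real_normed_vector \<Rightarrow>\<^sub>L 'v) set \<Rightarrow> ('v \<Rightarrow> 'v \<Rightarrow> real) \<Rightarrow> (real \<Rightarrow> 'v) \<Rightarrow> bool" where
  "homogeneous_geodesic G F c \<longleftrightarrow> finsler_geodesic F c \<and>
     (\<exists>X\<in>lie_algebra G. \<exists>q\<in>sphere 0 1. \<forall>t. c t = blinfun_apply (lin_exp (t *\<^sub>R X)) q)"

definition randers_equigeodesic ::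
  "('v::real_inner \<Rightarrow>\<^sub>L 'v) set \<Rightarrow> 'v \<Rightarrow> (('v \<Rightarrow>\<^sub>L 'v) \<Rightarrow> ('v \<Rightarrow>\<^sub>L 'v) \<Rightarrow> real) \<Rightarrow>
    (real \<Rightarrow> 'v) \<Rightarrow> bool" where
  "randers_equigeodesic G p B c \<longleftrightarrow>
     smooth_on UNIV c \<and> (\<forall>t. c t \<in> sphere 0 1) \<and>
     (\<forall>F. invariant_randers_metric G p B F \<longrightarrow> homogeneous_geodesic G F c)"

definition randers_equigeodesic_vector ::
  "('v::real_inner \<Rightarrow>\<^sub>L 'v) set \<Rightarrow> 'v \<Rightarrow> (('v \<Rightarrow>\<^sub>L 'v) \<Rightarrow> ('v \<Rightarrow>\<^sub>L 'v) \<Rightarrow> real) \<Rightarrow>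
    ('v \<Rightarrow>\<^sub>L 'v) \<Rightarrow> bool" where
  "randers_equigeodesic_vector G p B X \<longleftrightarrow>
     X \<in> lie_algebra G \<and> X \<notin> lie_algebra (isotropy G p) \<and>
     randers_equigeodesic G p B (\<lambda>t. blinfun_apply (lin_exp (t *\<^sub>R X)) p)"

end

theory Submission
  imports Defs
begin

text \<open>
  Let \<open>G\<close> be one of the groups, \<open>H\<close> the isotropy group of \<open>p\<close>, and \<open>\<gg> = \<hh> + \<mm>\<close>. Everything rests
  on two facts about the action, which are the hypotheses of the locale \<open>sphere_action\<close>: it is
  transitive on the unit sphere, and \<open>Y \<mapsto> Y p\<close> maps \<open>\<gg>\<close> onto the tangent space at \<open>p\<close>. Then
  \<open>\<mm>\<close> is identified with this tangent space, and a fixed vector \<open>u \<in> \<mm>\<^sub>0\<close> becomes an \<open>H\<close>-fixed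
  tangent vector \<open>\<xi>\<close> through \<open>B(Z, u) = \<langle>Z p, \<xi>\<rangle>\<close>.

  Necessary condition. Take for \<open>\<alpha>\<close> a multiple of \<open>B\<close>, and compare the metrics with linear terms
  \<open>\<alpha>(\<sqdot>, u)\<close> and \<open>\<alpha>(\<sqdot>, -u)\<close>. The variations \<open>exp (s \<phi>(t) Y) c(t)\<close> of an orbit \<open>c(t) = exp(tX) q\<close>
  move the curve through the symmetries of the metric, so the first variation expresses that the
  momentum of \<open>Y\<close> is conserved (Noether). In the difference of the two metrics the square roots
  cancel, and what remains at \<open>q = g p\<close> is \<open>\<langle>Y X q - X Y q, g \<xi>\<rangle> = 0\<close> for all \<open>Y \<in> \<gg>\<close>
  (\<open>momentum_conservation\<close>). In all cases \<open>\<xi>\<close> is a multiple of \<open>I p\<close> for a complex structure \<open>I\<close>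
  that commutes with \<open>G\<close>: right multiplication by an imaginary unit. Skewness of \<open>X\<close>, \<open>Y\<close>, \<open>I\<close>
  turns the condition into \<open>I X q \<bottom> Y q\<close> for all \<open>Y\<close>, that is \<open>X q \<in> \<real> I q\<close>
  (\<open>velocity_of_critical_orbit\<close>).

  Part (1). Here the \<open>H\<close>-fixed tangent vectors at \<open>p\<close> are exactly the multiples of \<open>I p\<close> for a
  single \<open>I\<close>. So an equigeodesic vector \<open>X \<in> \<mm>\<close> has \<open>X p \<in> \<real> I p\<close>, and therefore lies in
  \<open>\<mm>\<^sub>0\<close>. Conversely a nonzero \<open>X \<in> \<mm>\<^sub>0\<close> generates a Hopf circle \<open>c' = r I c\<close>. By invariance
  \<open>I x\<close> is orthogonal to its complement with respect to the Riemannian part of any invariant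
  Randers metric, whence the metric agrees near the velocities of \<open>c\<close> to first order with a multiple of
  \<open>\<eta>(v) = \<langle>v, I x\<rangle>\<close>; and the integral of \<open>\<eta>\<close> has vanishing first variation because \<open>d\<eta>\<close> is
  proportional to \<open>\<langle>I \<sqdot>, \<sqdot>\<rangle>\<close>, which pairs \<open>I c\<close> with the tangent space to zero
  (\<open>first_variation_zero\<close>, \<open>randers_orbit_geodesic\<close>).

  Part (2). For \<open>Sp(n+1)\<close> all right multiplications by imaginary quaternions commute with the
  group. The centraliser of \<open>H\<close> rotates the fixed vectors, so two of them have linearly independent
  imaginary directions, and the velocity of an equigeodesic would lie in \<open>\<real> I q \<inter> \<real> I' q = 0\<close>
  (\<open>no_equigeodesic_of_independent_structures\<close>).
\<close>

section \<open>The exponential\<close>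

type_synonym 'a op = "'a \<Rightarrow>\<^sub>L 'a"

text \<open>
  A copy of the operators on one space. The type of bounded linear maps depends on a source and a
  target, so only such a copy can be an instance of the algebra classes over which the exponential
  series is developed.
\<close>

typedef (overloaded) 'a endo = "UNIV :: ('a::real_normed_vector \<Rightarrow>\<^sub>L 'a) set"
  morphisms of_endo to_endo by simp

setup_lifting type_definition_endo

instantiation endo :: (real_normed_vector) real_vector
begin
lift_definition zero_endo :: "'a endo" is 0 .
lift_definition plus_endo :: "'a endo \<Rightarrow> 'a endo \<Rightarrow> 'a endo" is "(+)" .
lift_definition minus_endo :: "'a endo \<Rightarrow> 'a endo \<Rightarrow> 'a endo" is "(-)" .
lift_definition uminus_endo :: "'a endo \<Rightarrow> 'a endo" is uminus .
lift_definition scaleR_endo :: "real \<Rightarrow> 'a endo \<Rightarrow> 'a endo" is scaleR .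
instance
  by standard (transfer, simp add: algebra_simps)+
end

instantiation endo :: (real_normed_vector) real_normed_vector
begin
lift_definition norm_endo :: "'a endo \<Rightarrow> real" is norm .
definition "sgn_endo x = x /\<^sub>R norm (x :: 'a endo)"
definition "dist_endo x y = norm (x - y :: 'a endo)"
definition uniformity_endo :: "('a endo \<times> 'a endo) filter"
  where [code del]: "uniformity_endo = (INF e\<in>{0 <..}. principal {(x, y). dist x y < e})"
definition open_endo :: "'a endo set \<Rightarrow> bool"
  where [code del]: "open_endo S = (\<forall>x\<in>S. eventually (\<lambda>(x', y). x' = x \<longrightarrow> y \<in> S) uniformity)"
instance
proof
  fix a b :: "'a endo" and r :: real
  show "norm a = 0 \<longleftrightarrow> a = 0" "norm (a + b) \<le> norm a + norm b" "norm (r *\<^sub>R a) = \<bar>r\<bar> * norm a"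
    by (transfer, simp add: norm_triangle_ineq)+
qed (rule sgn_endo_def dist_endo_def uniformity_endo_def open_endo_def)+
end

instantiation endo :: (euclidean_space) real_normed_algebra_1
begin
lift_definition one_endo :: "'a endo" is id_blinfun .
lift_definition times_endo :: "'a endo \<Rightarrow> 'a endo \<Rightarrow> 'a endo" is blinfun_compose .
instance
proof
  fix a b c :: "'a endo" and r :: real
  show "(a + b) * c = a * c + b * c" "a * (b + c) = a * b + a * c"
    "(r *\<^sub>R a) * b = r *\<^sub>R (a * b)" "a * (r *\<^sub>R b) = r *\<^sub>R (a * b)"
    by (transfer, rule blinfun_eqI,
        simp add: blinfun.add_left blinfun.add_right blinfun.scaleR_left blinfun.scaleR_right)+
  show "(a * b) * c = a * (b * c)" "1 * a = a" "a * 1 = a"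
    by (transfer, rule blinfun_eqI, simp)+
  show "(0 :: 'a endo) \<noteq> 1"
    by (metis norm_blinfun_id norm_endo.rep_eq norm_zero one_endo.rep_eq zero_neq_one)
  show "norm (a * b) \<le> norm a * norm b" by transfer (rule norm_blinfun_compose)
  show "norm (1 :: 'a endo) = 1" by transfer simp
qed
end

lemma bounded_linear_of_endo: "bounded_linear of_endo"
  by (rule bounded_linear_intro[where K = 1]) (transfer, simp)+

lemma bounded_linear_to_endo: "bounded_linear to_endo"
proof (rule bounded_linear_intro[where K = 1])
  fix x y :: "'a::real_normed_vector \<Rightarrow>\<^sub>L 'a" and r :: real
  show "to_endo (x + y) = to_endo x + to_endo y"
    by (simp add: plus_endo_def to_endo_inverse)
  show "to_endo (r *\<^sub>R x) = r *\<^sub>R to_endo x"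
    by (simp add: scaleR_endo_def to_endo_inverse)
  show "norm (to_endo x) \<le> norm x * 1"
    by (simp add: norm_endo.rep_eq to_endo_inverse)
qed

instance endo :: (euclidean_space) banach
proof
  fix X :: "nat \<Rightarrow> 'a endo"
  assume "Cauchy X"
  then have "Cauchy (\<lambda>n. of_endo (X n))"
    by (rule bounded_linear.Cauchy[OF bounded_linear_of_endo])
  then obtain L where "(\<lambda>n. of_endo (X n)) \<longlonglongrightarrow> L"
    using Cauchy_convergent_iff convergent_def by blast
  then have "(\<lambda>n. to_endo (of_endo (X n))) \<longlonglongrightarrow> to_endo L"
    by (rule bounded_linear.tendsto[OF bounded_linear_to_endo])
  then show "convergent X"
    by (auto simp: of_endo_inverse convergent_def)
qed

lemma of_endo_power: "of_endo (x ^ k) = ((o\<^sub>L) (of_endo x) ^^ k) id_blinfun"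
  by (induction k) (simp_all add: one_endo.rep_eq times_endo.rep_eq)

lemma lin_exp_eq_exp: "lin_exp X = of_endo (exp (to_endo X))"
  for X :: "'a::euclidean_space \<Rightarrow>\<^sub>L 'a"
proof -
  have "of_endo (exp (to_endo X)) = (\<Sum>k. of_endo (to_endo X ^ k /\<^sub>R fact k))"
    unfolding exp_def
    by (rule bounded_linear.suminf[OF bounded_linear_of_endo summable_exp_generic])
  also have "\<dots> = lin_exp X"
    unfolding lin_exp_def
    by (simp add: scaleR_endo.rep_eq of_endo_power to_endo_inverse divide_inverse)
  finally show ?thesis ..
qed

abbreviation one_param :: "('a::euclidean_space \<Rightarrow>\<^sub>L 'a) \<Rightarrow> real \<Rightarrow> 'a op" where
  "one_param X t \<equiv> lin_exp (t *\<^sub>R X)"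

lemma to_endo_zero: "to_endo 0 = 0"
  by (metis zero_endo_def)

lemma lin_exp_zero [simp]: "lin_exp 0 = (id_blinfun :: 'a::euclidean_space \<Rightarrow>\<^sub>L 'a)"
  by (simp add: lin_exp_eq_exp one_endo.rep_eq to_endo_zero)

lemma one_param_eq: "one_param X t = of_endo (exp (t *\<^sub>R to_endo X))"
  by (simp add: lin_exp_eq_exp linear_simps(5)[OF bounded_linear_to_endo])

lemma one_param_add: "one_param X (s + t) = one_param X s o\<^sub>L one_param X t"
proof -
  have "exp ((s + t) *\<^sub>R to_endo X) = exp (s *\<^sub>R to_endo X) * exp (t *\<^sub>R to_endo X)"
    unfolding scaleR_add_left by (rule exp_add_commuting) simp
  then show ?thesis
    by (simp only: one_param_eq times_endo.rep_eq)
qed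

lemma one_param_minus_compose [simp]:
  fixes X :: "'a::euclidean_space \<Rightarrow>\<^sub>L 'a"
  shows "lin_exp (- (t *\<^sub>R X)) o\<^sub>L one_param X t = id_blinfun"
    "one_param X t o\<^sub>L lin_exp (- (t *\<^sub>R X)) = id_blinfun"
  using one_param_add[of "-t" t X] one_param_add[of t "-t" X] by simp_all

lemma one_param_minus_apply [simp]:
  fixes X :: "'a::euclidean_space \<Rightarrow>\<^sub>L 'a"
  shows "lin_exp (- (t *\<^sub>R X)) (one_param X t x) = x"
    "one_param X t (lin_exp (- (t *\<^sub>R X)) x) = x"
  by (metis blinfun_apply_blinfun_compose one_param_minus_compose(1) id_blinfun.rep_eq id_apply)
     (metis blinfun_apply_blinfun_compose one_param_minus_compose(2) id_blinfun.rep_eq id_apply)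

lemma one_param_has_vector_derivative:
  "((\<lambda>t. one_param X t) has_vector_derivative X o\<^sub>L one_param X t) (at t within S)"
proof -
  have "((\<lambda>t. of_endo (exp (t *\<^sub>R to_endo X))) has_vector_derivative
      of_endo (to_endo X * exp (t *\<^sub>R to_endo X))) (at t)"
    by (rule bounded_linear.has_vector_derivative[OF bounded_linear_of_endo
          exp_scaleR_has_vector_derivative_left])
  then show ?thesis
    by (simp add: one_param_eq times_endo.rep_eq to_endo_inverse has_vector_derivative_at_within)
qed

lemma one_param_apply_has_vector_derivative:
  "((\<lambda>t. one_param X t x) has_vector_derivative X (one_param X t x)) (at t within S)"
  using bounded_linear.has_vector_derivative[OF blinfun.bounded_linear_left[of x]
      one_param_has_vector_derivative[of X t S]] by simp

text \<open>
  An operator that intertwines \<open>X\<close> and \<open>X'\<close> intertwines their powers, hence the exponential series.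
  With \<open>X' = X\<close> it serves for commuting operators, with \<open>X' = Ad g X\<close> for conjugation.
\<close>

lemma lin_exp_commute:
  fixes X C :: "'a::euclidean_space \<Rightarrow>\<^sub>L 'a"
  assumes "C o\<^sub>L X = X' o\<^sub>L C"
  shows "C o\<^sub>L lin_exp X = lin_exp X' o\<^sub>L C"
proof -
  let ?c = "to_endo C" and ?x = "to_endo X" and ?y = "to_endo X'"
  have eq: "?c * ?x = ?y * ?c"
    using assms by (simp add: times_endo_def to_endo_inverse)
  have pow: "?c * ?x ^ n = ?y ^ n * ?c" for n
  proof (induction n)
    case (Suc n)
    have "?c * ?x ^ Suc n = (?c * ?x) * ?x ^ n" by (simp add: mult.assoc)
    also have "\<dots> = ?y * (?c * ?x ^ n)" by (simp add: eq mult.assoc)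
    also have "\<dots> = ?y ^ Suc n * ?c" by (simp add: Suc mult.assoc)
    finally show ?case .
  qed simp
  have "?c * exp ?x = (\<Sum>n. ?c * (?x ^ n /\<^sub>R fact n))"
    unfolding exp_def by (rule suminf_mult[OF summable_exp_generic, symmetric])
  also have "\<dots> = (\<Sum>n. (?y ^ n /\<^sub>R fact n) * ?c)"
    by (simp add: pow)
  also have "\<dots> = exp ?y * ?c"
    unfolding exp_def by (rule suminf_mult2[OF summable_exp_generic, symmetric])
  finally have "of_endo (?c * exp ?x) = of_endo (exp ?y * ?c)" by simp
  then show ?thesis
    by (simp add: times_endo.rep_eq to_endo_inverse lin_exp_eq_exp)
qed

lemma one_param_commute:
  fixes X C :: "'a::euclidean_space \<Rightarrow>\<^sub>L 'a"
  assumes "C o\<^sub>L X = X' o\<^sub>L C"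
  shows "C o\<^sub>L one_param X t = one_param X' t o\<^sub>L C"
proof (rule lin_exp_commute)
  show "C o\<^sub>L t *\<^sub>R X = t *\<^sub>R X' o\<^sub>L C"
    using assms
    by (simp add: bounded_bilinear.scaleR_left[OF bounded_bilinear_blinfun_compose]
        bounded_bilinear.scaleR_right[OF bounded_bilinear_blinfun_compose])
qed

lemma one_param_commute_self: "X o\<^sub>L one_param X t = one_param X t o\<^sub>L X"
  by (rule one_param_commute) simp

section \<open>Lie algebras of closed groups of isometries\<close>

text \<open>
  The derivative of \<open>|exp(tX) x|\<^sup>2\<close> is \<open>2 \<langle>X y, y\<rangle>\<close> with \<open>y = exp(tX) x\<close>.
\<close>

lemma one_param_isometry_iff_skew:
  fixes X :: "'a::euclidean_space \<Rightarrow>\<^sub>L 'a"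
  shows "(\<forall>t x. norm (one_param X t x) = norm x) \<longleftrightarrow> (\<forall>x. inner (X x) x = 0)"
proof -
  have der: "((\<lambda>t. inner (one_param X t x) (one_param X t x)) has_vector_derivative
      2 * inner (X (one_param X t x)) (one_param X t x)) (at t)" for x t
    using bounded_bilinear.has_vector_derivative[OF bounded_bilinear_inner
        one_param_apply_has_vector_derivative[of X x t UNIV]
        one_param_apply_has_vector_derivative[of X x t UNIV]]
    by (simp add: inner_commute)
  show ?thesis
  proof (intro iffI allI)
    fix x
    assume iso: "\<forall>t x. norm (one_param X t x) = norm x"
    have "((\<lambda>t. inner (one_param X t x) (one_param X t x)) has_vector_derivative 0) (at 0)"
      by (simp add: iso dot_square_norm)
    from vector_derivative_unique_at[OF this der[of x 0]] show "inner (X x) x = 0" by simp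
  next
    fix t x
    assume sk: "\<forall>x. inner (X x) x = 0"
    have "((\<lambda>t. inner (one_param X t x) (one_param X t x)) has_vector_derivative 0) (at t)" for t
      using der[of x t] by (simp add: sk)
    then obtain c where "\<And>t. inner (one_param X t x) (one_param X t x) = c"
      using has_vector_derivative_zero_constant[of UNIV "\<lambda>t. inner (one_param X t x) (one_param X t x)"]
      by auto
    from this[of t] this[of 0] show "norm (one_param X t x) = norm x"
      by (simp add: norm_eq)
  qed
qed

lemma skew_inner:
  fixes X :: "'a::euclidean_space \<Rightarrow>\<^sub>L 'a"
  assumes "\<And>x. inner (X x) x = 0"
  shows "inner (X x) y = - inner x (X y)"
  using assms[of "x + y"] assms[of x] assms[of y]
  by (simp add: blinfun.add_right inner_add_left inner_add_right inner_commute)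

lemma norm_power_diff_contractions:
  fixes a b :: "'b::real_normed_algebra_1"
  assumes "norm a \<le> 1" "norm b \<le> 1"
  shows "norm (a ^ n - b ^ n) \<le> n * norm (a - b)"
proof (induction n)
  case (Suc n)
  have "a ^ Suc n - b ^ Suc n = a * (a ^ n - b ^ n) + (a - b) * b ^ n"
    by (simp add: algebra_simps)
  also have "norm \<dots> \<le> norm a * norm (a ^ n - b ^ n) + norm (a - b) * norm (b ^ n)"
    by (intro norm_triangle_le add_mono norm_mult_ineq)
  also have "\<dots> \<le> 1 * (n * norm (a - b)) + norm (a - b) * 1"
    using assms Suc norm_power_ineq[of b n] power_le_one[of "norm b" n]
    by (intro add_mono mult_mono) auto
  finally show ?case by (simp add: algebra_simps)
qed simp

locale isometry_group =
  fixes G :: "('a::euclidean_space \<Rightarrow>\<^sub>L 'a) set"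
  assumes id_mem: "id_blinfun \<in> G"
    and compose_mem: "g \<in> G \<Longrightarrow> h \<in> G \<Longrightarrow> g o\<^sub>L h \<in> G"
    and isometry: "g \<in> G \<Longrightarrow> norm (g x) = norm x"
    and inverse_ex: "g \<in> G \<Longrightarrow> \<exists>h\<in>G. g o\<^sub>L h = id_blinfun"
    and closed_group: "closed G"
begin

definition ginv :: "'a op \<Rightarrow> 'a op" where
  "ginv g = (SOME h. h \<in> G \<and> g o\<^sub>L h = id_blinfun)"

lemma ginv_mem [intro]: "g \<in> G \<Longrightarrow> ginv g \<in> G"
  and ginv_right: "g \<in> G \<Longrightarrow> g (ginv g x) = x"
proof -
  assume "g \<in> G"
  then have "ginv g \<in> G \<and> g o\<^sub>L ginv g = id_blinfun"
    unfolding ginv_def using someI_ex[of "\<lambda>h. h \<in> G \<and> g o\<^sub>L h = id_blinfun"] inverse_ex by blast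
  then show "ginv g \<in> G" "g (ginv g x) = x"
    by (auto dest: arg_cong[where f = "\<lambda>f. blinfun_apply f x"])
qed

lemma inner_isometry: "g \<in> G \<Longrightarrow> inner (g x) (g y) = inner x y"
  using isometry[of g "x + y"] isometry[of g x] isometry[of g y]
  by (simp add: blinfun.add_right norm_eq inner_add_left inner_add_right inner_commute)

lemma group_inj: "g \<in> G \<Longrightarrow> g x = g y \<Longrightarrow> x = y"
  using isometry[of g "x - y"] by (simp add: blinfun.diff_right)

lemma ginv_left: "g \<in> G \<Longrightarrow> ginv g (g x) = x"
  by (rule group_inj[of g]) (auto simp: ginv_right)

lemma inner_ginv: "g \<in> G \<Longrightarrow> inner (g x) y = inner x (ginv g y)"
  using inner_isometry[of g x "ginv g y"] by (simp add: ginv_right)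

lemma Ad_eq: "g \<in> G \<Longrightarrow> Ad g X = g o\<^sub>L X o\<^sub>L ginv g"
proof -
  assume g: "g \<in> G"
  have "inv (blinfun_apply g) = ginv g"
    by (rule inv_equality) (simp_all add: g ginv_left ginv_right)
  then have "blinfun_apply g \<circ> blinfun_apply X \<circ> inv (blinfun_apply g)
      = blinfun_apply (g o\<^sub>L X o\<^sub>L ginv g)" by auto
  then show ?thesis unfolding Ad_def by (simp only: blinfun_apply_inverse)
qed

lemma Ad_apply: "g \<in> G \<Longrightarrow> Ad g X v = g (X (ginv g v))"
  by (simp add: Ad_eq)

lemma Ad_ginv:
  assumes g: "g \<in> G"
  shows "Ad g (Ad (ginv g) X) = X" "Ad (ginv g) (Ad g X) = X"
proof -
  have gg: "ginv (ginv g) v = g v" for v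
    using ginv_right[OF ginv_mem[OF g], of v] g by (metis ginv_right)
  show "Ad g (Ad (ginv g) X) = X"
    by (rule blinfun_eqI) (simp add: g ginv_mem Ad_apply gg ginv_left ginv_right)
  show "Ad (ginv g) (Ad g X) = X"
    by (rule blinfun_eqI) (simp add: g ginv_mem Ad_apply gg ginv_left ginv_right)
qed

lemma one_param_Ad: "g \<in> G \<Longrightarrow> one_param (Ad g X) t = g o\<^sub>L one_param X t o\<^sub>L ginv g"
proof -
  assume g: "g \<in> G"
  have "g o\<^sub>L X = Ad g X o\<^sub>L g"
    by (rule blinfun_eqI) (simp add: g Ad_apply ginv_left)
  from one_param_commute[OF this, of t]
  have "one_param (Ad g X) t (g x) = g (one_param X t x)" for x
    by (metis blinfun_apply_blinfun_compose)
  from this[of "ginv g _"] show ?thesis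
    by (intro blinfun_eqI) (simp add: g ginv_right)
qed

lemma Ad_lie: "g \<in> G \<Longrightarrow> X \<in> lie_algebra G \<Longrightarrow> Ad g X \<in> lie_algebra G"
  by (auto simp: lie_algebra_def one_param_Ad intro!: compose_mem)

lemma lie_skew: "X \<in> lie_algebra G \<Longrightarrow> inner (X x) x = 0"
  using one_param_isometry_iff_skew[of X] isometry by (auto simp: lie_algebra_def)

lemma lie_inner: "X \<in> lie_algebra G \<Longrightarrow> inner (X x) y = - inner x (X y)"
  by (rule skew_inner) (rule lie_skew)

lemma zero_lie: "0 \<in> lie_algebra G"
  by (simp add: lie_algebra_def id_mem)

lemma scaleR_lie: "X \<in> lie_algebra G \<Longrightarrow> r *\<^sub>R X \<in> lie_algebra G"
  by (simp add: lie_algebra_def)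

text \<open>
  Trotter's product formula: the elements \<open>(exp (X/n) exp (Y/n))\<^sup>n\<close> of the closed group converge
  to \<open>exp (X + Y)\<close>. Indeed \<open>exp (hX) exp (hY)\<close> and \<open>exp (h(X + Y))\<close> agree to first order at
  \<open>h = 0\<close>, and the \<open>n\<close>-th powers of two contractions differ by at most \<open>n\<close> times their
  difference.
\<close>

lemma lin_exp_add_mem:
  assumes X: "X \<in> lie_algebra G" and Y: "Y \<in> lie_algebra G"
  shows "lin_exp (X + Y) \<in> G"
proof -
  let ?x = "to_endo X" and ?y = "to_endo Y"
  \<comment> \<open>the two sides of the formula as functions of \<open>h = 1/n\<close>\<close>
  define a where "a h = exp (h *\<^sub>R ?x) * exp (h *\<^sub>R ?y)" for h :: real
  define b where "b h = exp (h *\<^sub>R (?x + ?y))" for h :: real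
  have xy: "?x + ?y = to_endo (X + Y)"
    by (simp add: linear_simps(1)[OF bounded_linear_to_endo])
  have a_mem: "of_endo (a h) \<in> G" for h
    using X Y compose_mem unfolding a_def times_endo.rep_eq one_param_eq[symmetric]
    by (auto simp: lie_algebra_def)
  have b_eq: "of_endo (b h) = one_param (X + Y) h" for h
    unfolding b_def xy one_param_eq[symmetric] ..
  have a1: "norm (a h) \<le> 1" for h
    unfolding norm_endo.rep_eq by (rule norm_blinfun_bound) (simp_all add: isometry[OF a_mem])
  have "norm (one_param (X + Y) h x) = norm x" for h x
    using one_param_isometry_iff_skew[of "X + Y"] lie_skew[OF X] lie_skew[OF Y]
    by (simp add: blinfun.add_left inner_add_left)
  then have b1: "norm (b h) \<le> 1" for h
    unfolding norm_endo.rep_eq b_eq by (intro norm_blinfun_bound) simp_all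
  have "((\<lambda>h. a h - b h) has_vector_derivative 0) (at 0)"
  proof -
    have "((\<lambda>h. a h - b h) has_vector_derivative
        (exp (0 *\<^sub>R ?x) * (?y * exp (0 *\<^sub>R ?y)) + (?x * exp (0 *\<^sub>R ?x)) * exp (0 *\<^sub>R ?y))
          - (?x + ?y) * exp (0 *\<^sub>R (?x + ?y))) (at 0)"
      unfolding a_def b_def
      by (intro has_vector_derivative_diff has_vector_derivative_mult
          exp_scaleR_has_vector_derivative_left)
    then show ?thesis by simp
  qed
  then have "((\<lambda>h. norm (a h - b h) / norm h) \<longlongrightarrow> 0) (at 0)"
    by (simp add: has_vector_derivative_def has_derivative_at a_def b_def)
  moreover have "filterlim (\<lambda>n. 1 / real (Suc n)) (at 0) sequentially"
    using LIMSEQ_inverse_real_of_nat by (simp add: filterlim_at inverse_eq_divide)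
  ultimately have lim: "(\<lambda>n. norm (a (1 / real (Suc n)) - b (1 / real (Suc n))) / norm (1 / real (Suc n)))
      \<longlonglongrightarrow> 0"
    by (rule filterlim_compose)
  have "b h ^ m = b (real m * h)" for h m
  proof (induction m)
    case (Suc m)
    have "b (real (Suc m) * h) = exp (h *\<^sub>R (?x + ?y) + (real m * h) *\<^sub>R (?x + ?y))"
      by (simp add: b_def algebra_simps)
    also have "\<dots> = b h * b (real m * h)"
      unfolding b_def by (rule exp_add_commuting) simp
    finally show ?case using Suc by simp
  qed (simp add: b_def)
  then have bn: "b (1 / real (Suc n)) ^ Suc n = exp (?x + ?y)" for n
    by (simp add: b_def del: of_nat_Suc power_Suc)
  have "(\<lambda>n. a (1 / real (Suc n)) ^ Suc n) \<longlonglongrightarrow> exp (?x + ?y)"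
  proof (rule Lim_null_comparison[THEN LIM_zero_cancel, OF always_eventually lim, rule_format])
    fix n
    show "norm (a (1 / real (Suc n)) ^ Suc n - exp (?x + ?y))
      \<le> norm (a (1 / real (Suc n)) - b (1 / real (Suc n))) / norm (1 / real (Suc n))"
      using norm_power_diff_contractions[OF a1 b1, of "1 / real (Suc n)" "Suc n" "1 / real (Suc n)"] bn[of n]
      by (simp add: divide_simps mult.commute del: of_nat_Suc)
  qed
  then have "(\<lambda>n. of_endo (a (1 / real (Suc n)) ^ Suc n)) \<longlonglongrightarrow> of_endo (exp (?x + ?y))"
    by (rule bounded_linear.tendsto[OF bounded_linear_of_endo])
  moreover have "of_endo (a h ^ m) \<in> G" for h m
    by (induction m) (simp_all add: one_endo.rep_eq times_endo.rep_eq id_mem compose_mem a_mem)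
  ultimately have "of_endo (exp (?x + ?y)) \<in> G"
    by (rule closed_sequentially[OF closed_group, rotated])
  then show ?thesis by (simp add: lin_exp_eq_exp xy)
qed

lemma add_lie: "X \<in> lie_algebra G \<Longrightarrow> Y \<in> lie_algebra G \<Longrightarrow> X + Y \<in> lie_algebra G"
proof -
  assume X: "X \<in> lie_algebra G" and Y: "Y \<in> lie_algebra G"
  have "one_param (X + Y) t \<in> G" for t
    unfolding scaleR_add_right by (rule lin_exp_add_mem[OF scaleR_lie[OF X] scaleR_lie[OF Y]])
  then show "X + Y \<in> lie_algebra G" by (simp add: lie_algebra_def)
qed

lemma subspace_lie: "subspace (lie_algebra G)"
  by (simp add: subspace_def zero_lie add_lie scaleR_lie)

lemma isotropy_isometry_group: "isometry_group (isotropy G q)"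
proof
  show "closed (isotropy G q)"
  proof -
    have "isotropy G q = G \<inter> (\<lambda>g. blinfun_apply g q) -` {q}" by (auto simp: isotropy_def)
    moreover have "closed ((\<lambda>g. blinfun_apply g q) -` {q})"
      by (intro continuous_closed_vimage) (auto intro!: continuous_intros)
    ultimately show ?thesis using closed_Int[OF closed_group] by metis
  qed
  show "\<exists>h\<in>isotropy G q. g o\<^sub>L h = id_blinfun" if "g \<in> isotropy G q" for g
    using that by (intro bexI[of _ "ginv g"])
      (auto simp: isotropy_def intro!: blinfun_eqI simp: ginv_right, metis ginv_left)
qed (auto simp: isotropy_def id_mem compose_mem isometry)

end

text \<open>
  The operator space of a Euclidean space is spanned by the finitely many matrix units, so that
  every subspace of it is finite dimensional.
\<close>

lemma finite_spanning_subset: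
  fixes S :: "('a::euclidean_space \<Rightarrow>\<^sub>L 'a) set"
  assumes "subspace S"
  obtains T where "finite T" "T \<subseteq> S" "span T = S"
proof -
  let ?E = "\<lambda>i j :: 'a. blinfun_scaleR_left j o\<^sub>L blinfun_inner_left i"
  let ?U = "(\<lambda>(i, j). ?E i j) ` (Basis \<times> Basis)"
  have "f \<in> span ?U" for f :: "'a op"
  proof -
    have "f = (\<Sum>i\<in>Basis. \<Sum>j\<in>Basis. inner (f i) j *\<^sub>R ?E i j)"
    proof (rule blinfun_euclidean_eqI)
      fix k :: 'a assume k: "k \<in> Basis"
      have "(\<Sum>i\<in>Basis. \<Sum>j\<in>Basis. inner (f i) j *\<^sub>R ?E i j) k
         = (\<Sum>i\<in>Basis. inner k i *\<^sub>R (\<Sum>j\<in>Basis. inner (f i) j *\<^sub>R j))"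
        by (simp add: blinfun.sum_left blinfun.scaleR_left blinfun_inner_left.rep_eq scaleR_sum_right
             mult.commute inner_commute)
      also have "\<dots> = (\<Sum>i\<in>Basis. (if i = k then f i else 0))"
        by (rule sum.cong) (auto simp: euclidean_representation inner_Basis k)
      finally show "f k = (\<Sum>i\<in>Basis. \<Sum>j\<in>Basis. inner (f i) j *\<^sub>R ?E i j) k"
        using k by simp
    qed
    moreover have "(\<Sum>i\<in>Basis. \<Sum>j\<in>Basis. inner (f i) j *\<^sub>R ?E i j) \<in> span ?U"
      by (intro span_sum span_scale span_base) auto
    ultimately show ?thesis by simp
  qed
  then have top: "S \<subseteq> span ?U" by blast
  obtain T where T: "T \<subseteq> S" "independent T" "S \<subseteq> span T"
    using maximal_independent_subset[of S] by blast
  have "finite T"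
    using independent_span_bound[of ?U T] T top by auto
  moreover have "span T = S"
    using T assms by (metis span_eq_iff span_mono subset_antisym)
  ultimately show thesis using that T by blast
qed

lemma inner_product_on_right:
  assumes "inner_product_on V B" "x \<in> V" "y \<in> V" "subspace V"
  shows "B x y = B y x"
    and "z \<in> V \<Longrightarrow> B x (y + z) = B x y + B x z"
    and "z \<in> V \<Longrightarrow> B x (y - z) = B x y - B x z"
    and "z \<in> V \<Longrightarrow> B (x - y) z = B x z - B y z"
    and "B x (r *\<^sub>R y) = r * B x y"
    and "B 0 x = 0" "B x 0 = 0"
proof -
  have sym: "B a b = B b a" if "a \<in> V" "b \<in> V" for a b
    using assms(1) that by (auto simp: inner_product_on_def)
  have add: "B (a + b) c = B a c + B b c" if "a \<in> V" "b \<in> V" "c \<in> V" for a b c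
    using assms(1) that by (auto simp: inner_product_on_def)
  have sc: "B (s *\<^sub>R a) b = s * B a b" if "a \<in> V" "b \<in> V" for a b s
    using assms(1) that by (auto simp: inner_product_on_def)
  show "B x y = B y x" using sym assms by blast
  show "B 0 x = 0" using sc[of x x 0] assms by simp
  then show "B x 0 = 0" using sym[of x 0] assms by (simp add: subspace_0)
  show "B x (r *\<^sub>R y) = r * B x y"
    using sym sc assms by (metis subspace_scale)
  assume z: "z \<in> V"
  show "B x (y + z) = B x y + B x z"
    using sym add assms z by (metis subspace_add)
  have diff: "B (a - b) c = B a c - B b c" if "a \<in> V" "b \<in> V" "c \<in> V" for a b c
    using add[of a "(-1) *\<^sub>R b" c] sc[of b c "-1"] that subspace_scale[OF assms(4) that(2), of "-1"] by simp
  show "B (x - y) z = B x z - B y z" using diff assms z by blast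
  show "B x (y - z) = B x y - B x z"
    using sym diff assms z by (metis subspace_diff)
qed

text \<open>
  Gram-Schmidt: with a new spanning vector \<open>a\<close>, the projection of \<open>x\<close> acquires the component along
  \<open>a'\<close>, the part of \<open>a\<close> orthogonal to the previous span. If \<open>a' = 0\<close>, then the coefficient \<open>r\<close> is
  \<open>0\<close> by the convention for division.
\<close>

lemma orthogonal_projection_exists:
  assumes B: "inner_product_on V B" and V: "subspace V" and T: "finite T" "T \<subseteq> V" and x: "x \<in> V"
  shows "\<exists>y\<in>span T. \<forall>z\<in>span T. B (x - y) z = 0"
  using T x
proof (induction T arbitrary: x rule: finite_induct)
  case empty
  then show ?case using inner_product_on_right(7)[OF B empty(2) empty(2) V] by auto
next
  case (insert a T)
  have TV: "span T \<subseteq> V" using insert.prems V by (simp add: span_minimal)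
  obtain a0 where a0: "a0 \<in> span T" "\<forall>z\<in>span T. B (a - a0) z = 0"
    using insert by blast
  obtain x0 where x0: "x0 \<in> span T" "\<forall>z\<in>span T. B (x - x0) z = 0"
    using insert by blast
  define a' where "a' = a - a0"
  have a'V: "a' \<in> V" using a0 TV insert.prems V by (auto simp: a'_def intro: subspace_diff)
  define r where "r = B (x - x0) a' / B a' a'"
  have x'V: "x - x0 \<in> V" using x0 TV insert.prems V by (auto intro: subspace_diff)
  have ra: "r *\<^sub>R a' \<in> V" by (rule subspace_scale[OF V a'V])
  have rB: "B (r *\<^sub>R a') z = r * B a' z" if "z \<in> V" for z
    using B a'V that by (auto simp: inner_product_on_def)
  have orth: "B (x - x0 - r *\<^sub>R a') a' = 0"
  proof (cases "a' = 0")
    case True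
    then show ?thesis
      using inner_product_on_right(7)[OF B x'V x'V V] by simp
  next
    case False
    then have "B a' a' \<noteq> 0" using B a'V by (force simp: inner_product_on_def)
    then show ?thesis
      using inner_product_on_right(4)[OF B x'V ra V a'V] rB[OF a'V]
      by (simp add: r_def)
  qed
  let ?y = "x0 + r *\<^sub>R a'"
  have "a' \<in> span (insert a T)"
    unfolding a'_def using a0(1) by (meson insertI1 span_base span_diff span_mono subset_insertI subsetD)
  then have "?y \<in> span (insert a T)"
    using x0(1) by (meson span_add span_scale span_mono subset_insertI subsetD)
  moreover have "B (x - ?y) z = 0" if z: "z \<in> span (insert a T)" for z
  proof -
    obtain s where s: "z - s *\<^sub>R a \<in> span T" using z by (auto simp: span_insert)
    define w where "w = z - s *\<^sub>R a + s *\<^sub>R a0"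
    have w: "w \<in> span T" unfolding w_def by (intro span_add span_scale s a0(1))
    have zeq: "z = w + s *\<^sub>R a'" by (simp add: w_def a'_def algebra_simps)
    have wV: "w \<in> V" using w TV by blast
    have e: "x - ?y = x - x0 - r *\<^sub>R a'" by simp
    have eV: "x - x0 - r *\<^sub>R a' \<in> V" by (rule subspace_diff[OF V x'V ra])
    have "B (x - x0 - r *\<^sub>R a') w = 0"
      using inner_product_on_right(4)[OF B x'V ra V wV] rB[OF wV] x0(2) a0(2) w by (simp add: a'_def)
    moreover have "B (x - x0 - r *\<^sub>R a') (s *\<^sub>R a') = 0"
      using inner_product_on_right(5)[OF B eV a'V V] orth by simp
    ultimately show ?thesis
      unfolding e zeq using inner_product_on_right(2)[OF B eV wV V subspace_scale[OF V a'V]] by simp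
  qed
  ultimately show ?case by blast
qed

section \<open>Transitive actions on the sphere and the reductive complement\<close>

locale sphere_action = isometry_group G for G :: "('a::euclidean_space \<Rightarrow>\<^sub>L 'a) set" +
  fixes p :: 'a
  assumes norm_p: "norm p = 1"
    and transitive: "norm x = 1 \<Longrightarrow> \<exists>g\<in>G. g p = x"
    and inf_transitive: "inner p y = 0 \<Longrightarrow> \<exists>Y\<in>lie_algebra G. Y p = y"
begin

sublocale H: isometry_group "isotropy G p"
  by (rule isotropy_isometry_group)

lemma inner_pp: "inner p p = 1"
  using norm_p by (simp add: norm_eq_1)

lemma isotropyD: "h \<in> isotropy G p \<Longrightarrow> h \<in> G" "h \<in> isotropy G p \<Longrightarrow> h p = p"
  by (auto simp: isotropy_def)

lemma ginv_isotropy: "h \<in> isotropy G p \<Longrightarrow> ginv h \<in> isotropy G p"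
  by (auto simp: isotropy_def) (metis ginv_left)

lemma orth_isotropy: "h \<in> isotropy G p \<Longrightarrow> inner p (h v) = inner p v"
  using inner_isometry[of h p v] isotropyD by simp

lemma orth_lie: "X \<in> lie_algebra G \<Longrightarrow> inner p (X p) = 0"
  using lie_skew[of X p] by (simp add: inner_commute)

lemma lie_isotropy_iff: "X \<in> lie_algebra (isotropy G p) \<longleftrightarrow> X \<in> lie_algebra G \<and> X p = 0"
proof
  assume X: "X \<in> lie_algebra (isotropy G p)"
  then have "one_param X t p = p" for t by (simp add: lie_algebra_def isotropy_def)
  then have "((\<lambda>t. one_param X t p) has_vector_derivative 0) (at 0)" by simp
  from vector_derivative_unique_at[OF this one_param_apply_has_vector_derivative[of X p 0]]
  show "X \<in> lie_algebra G \<and> X p = 0" using X by (simp add: lie_algebra_def isotropy_def)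
next
  assume X: "X \<in> lie_algebra G \<and> X p = 0"
  have "X (one_param X t p) = 0" for t
    using arg_cong[OF one_param_commute_self[of X t], of "\<lambda>f. blinfun_apply f p"] X by simp
  then have "((\<lambda>t. one_param X t p) has_vector_derivative 0) (at t)" for t
    using one_param_apply_has_vector_derivative[of X p t UNIV] by simp
  then obtain c where "\<And>t. one_param X t p = c"
    using has_vector_derivative_zero_constant[of UNIV "\<lambda>t. one_param X t p"] by auto
  from this this[of 0] have "one_param X t p = p" for t by simp
  then show "X \<in> lie_algebra (isotropy G p)" using X by (simp add: lie_algebra_def isotropy_def)
qed

text \<open>
  The Riesz vector of an \<open>H\<close>-invariant functional is itself fixed by \<open>H\<close>, because \<open>H\<close> acts by
  isometries of the tangent space.
\<close>

lemma invariant_functional: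
  assumes f: "linear f" and inv: "\<And>h v. h \<in> isotropy G p \<Longrightarrow> inner p v = 0 \<Longrightarrow> f (h v) = f v"
  shows "\<exists>\<xi>. inner p \<xi> = 0 \<and> (\<forall>h\<in>isotropy G p. h \<xi> = \<xi>) \<and> (\<forall>v. inner p v = 0 \<longrightarrow> f v = inner v \<xi>)"
proof -
  let ?r = "\<Sum>b\<in>Basis. f b *\<^sub>R b"
  have rep: "f v = inner v ?r" for v
  proof -
    have "f v = f (\<Sum>b\<in>Basis. inner v b *\<^sub>R b)" by (simp add: euclidean_representation)
    also have "\<dots> = inner v ?r"
      by (simp add: linear_sum[OF f] linear_scale[OF f] inner_sum_right mult.commute)
    finally show ?thesis .
  qed
  define \<xi> where "\<xi> = ?r - inner p ?r *\<^sub>R p"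
  have p\<xi>: "inner p \<xi> = 0" by (simp add: \<xi>_def inner_diff_right inner_pp)
  have f\<xi>: "f v = inner v \<xi>" if "inner p v = 0" for v
  proof -
    have "inner v \<xi> = inner v ?r - inner p ?r * inner v p"
      unfolding \<xi>_def by (simp only: inner_diff_right inner_scaleR_right)
    also have "\<dots> = f v" using that rep[of v] by (simp add: inner_commute)
    finally show ?thesis ..
  qed
  have "h \<xi> = \<xi>" if h: "h \<in> isotropy G p" for h
  proof -
    let ?d = "h \<xi> - \<xi>"
    have d: "inner p ?d = 0" using p\<xi> by (simp add: inner_diff_right orth_isotropy h)
    have h': "ginv h \<in> isotropy G p" "ginv h \<in> G" using h ginv_isotropy isotropyD by auto
    have "inner ?d (h \<xi>) = inner (ginv h ?d) \<xi>"
      using inner_ginv[of h \<xi> ?d] isotropyD(1)[OF h] by (simp add: inner_commute)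
    also have "\<dots> = f (ginv h ?d)" using f\<xi> d orth_isotropy[OF h'(1)] by simp
    also have "\<dots> = inner ?d \<xi>" using inv[OF h'(1) d] f\<xi>[OF d] by simp
    finally have "inner ?d ?d = 0" by (simp add: inner_diff_right)
    then show ?thesis by simp
  qed
  with p\<xi> f\<xi> show ?thesis by blast
qed

text \<open>
  The following two notions describe an invariant Randers metric, and the inner product \<open>\<alpha>\<close>, in
  terms of tangent vectors instead of elements of \<open>\<mm>\<close>. The form \<open>Q\<close> is
  bilinear on the whole ambient space so that the calculus of bilinear maps applies to it, but
  definiteness and invariance concern the tangent space only.
\<close>

definition invariant_function :: "('a \<Rightarrow> 'a \<Rightarrow> real) \<Rightarrow> bool" where
  "invariant_function F \<longleftrightarrow>
     (\<forall>g\<in>G. \<forall>x v. norm x = 1 \<longrightarrow> inner x v = 0 \<longrightarrow> F (g x) (g v) = F x v)"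

definition invariant_form :: "('a \<Rightarrow> 'a \<Rightarrow> real) \<Rightarrow> bool" where
  "invariant_form Q \<longleftrightarrow> bilinear Q \<and> (\<forall>v w. Q v w = Q w v) \<and>
     (\<forall>v. inner p v = 0 \<longrightarrow> v \<noteq> 0 \<longrightarrow> Q v v > 0) \<and>
     (\<forall>h\<in>isotropy G p. \<forall>v w. inner p v = 0 \<longrightarrow> inner p w = 0 \<longrightarrow> Q (h v) (h w) = Q v w)"

lemma invariant_functionD:
  assumes "invariant_function F" "g \<in> G" "inner p v = 0"
  shows "F (g p) (g v) = F p v"
  using assms norm_p by (auto simp: invariant_function_def)

text \<open>
  Transport \<open>f\<close> to \<open>x\<close> with any \<open>g\<close> such that \<open>g p = x\<close>: two choices differ by an element of
  \<open>H\<close>, so invariance makes the result independent of the choice.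
\<close>

lemma invariant_extension:
  assumes f: "\<And>h v. h \<in> isotropy G p \<Longrightarrow> inner p v = 0 \<Longrightarrow> f (h v) = f v"
  obtains F where "invariant_function F" "\<And>v. inner p v = 0 \<Longrightarrow> F p v = f v"
proof -
  define sec where "sec x = (SOME g. g \<in> G \<and> g p = x)" for x
  have sec: "sec x \<in> G" "sec x p = x" if "norm x = 1" for x
  proof -
    have "\<exists>g. g \<in> G \<and> g p = x" using transitive[OF that] by blast
    from someI_ex[OF this] show "sec x \<in> G" "sec x p = x" by (auto simp: sec_def)
  qed
  define F where "F x v = f (ginv (sec x) v)" for x v
  have key: "F (g p) (g v) = f v" if g: "g \<in> G" and v: "inner p v = 0" for g v
  proof -
    have n: "norm (g p) = 1" using isometry[OF g] norm_p by simp
    let ?k = "ginv (sec (g p)) o\<^sub>L g"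
    have "?k \<in> isotropy G p"
      using g sec[OF n] ginv_left[of "sec (g p)" p] by (auto simp: isotropy_def intro!: compose_mem)
    from f[OF this v] show ?thesis by (simp add: F_def)
  qed
  have "invariant_function F"
    unfolding invariant_function_def
  proof (intro ballI allI impI)
    fix g and x v :: 'a assume g: "g \<in> G" and x: "norm x = 1" and v: "inner x v = 0"
    obtain k where k: "k \<in> G" "k p = x" using transitive[OF x] by blast
    let ?w = "ginv k v"
    have w: "inner p ?w = 0" "k ?w = v"
      using inner_ginv[OF k(1), of p v] k v by (simp_all add: ginv_right)
    have "F (g x) (g v) = F ((g o\<^sub>L k) p) ((g o\<^sub>L k) ?w)" by (simp add: k w)
    also have "\<dots> = F (k p) (k ?w)" using key[OF compose_mem[OF g k(1)] w(1)] key[OF k(1) w(1)] by simp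
    finally show "F (g x) (g v) = F x v" by (simp add: k w)
  qed
  moreover have "F p v = f v" if "inner p v = 0" for v
    using key[OF id_mem that] by simp
  ultimately show thesis using that by blast
qed

end

locale reductive_sphere = sphere_action G p for G :: "('a::euclidean_space \<Rightarrow>\<^sub>L 'a) set" and p +
  fixes B :: "'a op \<Rightarrow> 'a op \<Rightarrow> real"
  assumes bi_invariant: "bi_invariant_inner_product G B"
begin

abbreviation "\<gg> \<equiv> lie_algebra G"
abbreviation "\<hh> \<equiv> lie_algebra (isotropy G p)"
abbreviation "\<mm> \<equiv> reductive_compl G p B"
abbreviation "\<mm>\<^sub>0 \<equiv> fixed_compl G p B"

lemma B_inner: "inner_product_on \<gg> B"
  using bi_invariant by (simp add: bi_invariant_inner_product_def)

lemmas B_rules = inner_product_on_right[OF B_inner _ _ subspace_lie]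

lemma B_add: "X \<in> \<gg> \<Longrightarrow> Y \<in> \<gg> \<Longrightarrow> Z \<in> \<gg> \<Longrightarrow> B (X + Y) Z = B X Z + B Y Z"
  and B_scale: "X \<in> \<gg> \<Longrightarrow> Y \<in> \<gg> \<Longrightarrow> B (r *\<^sub>R X) Y = r * B X Y"
  and B_pos: "X \<in> \<gg> \<Longrightarrow> X \<noteq> 0 \<Longrightarrow> B X X > 0"
  using B_inner by (auto simp: inner_product_on_def)

lemma B_Ad: "g \<in> G \<Longrightarrow> X \<in> \<gg> \<Longrightarrow> Y \<in> \<gg> \<Longrightarrow> B (Ad g X) (Ad g Y) = B X Y"
  using bi_invariant by (auto simp: bi_invariant_inner_product_def)

lemma \<mm>_lie: "X \<in> \<mm> \<Longrightarrow> X \<in> \<gg>"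
  by (simp add: reductive_compl_def)

lemma \<mm>_subspace: "subspace \<mm>"
  using subspace_lie
  by (auto simp: subspace_def reductive_compl_def lie_isotropy_iff B_add B_scale B_rules)

lemma \<mm>_inj:
  assumes X: "X \<in> \<mm>" and Y: "Y \<in> \<mm>" and eq: "X p = Y p"
  shows "X = Y"
proof (rule ccontr)
  assume ne: "X \<noteq> Y"
  have d: "X - Y \<in> \<mm>" by (rule subspace_diff[OF \<mm>_subspace X Y])
  then have "X - Y \<in> \<hh>" using eq by (simp add: lie_isotropy_iff \<mm>_lie blinfun.diff_left)
  then have "B (X - Y) (X - Y) = 0" using d by (simp add: reductive_compl_def)
  with B_pos[OF \<mm>_lie[OF d]] ne show False by simp
qed

text \<open>
  Subtract from \<open>Z\<close> its orthogonal projection to \<open>\<hh>\<close>, which does not change the value at \<open>p\<close>.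
\<close>

lemma \<mm>_decomposition:
  assumes Z: "Z \<in> \<gg>"
  obtains Y where "Y \<in> \<mm>" "Z - Y \<in> \<hh>" "Y p = Z p"
proof -
  obtain T where T: "finite T" "T \<subseteq> \<hh>" "span T = \<hh>"
    using finite_spanning_subset[OF H.subspace_lie] by blast
  have "T \<subseteq> \<gg>" using T(2) by (auto simp: lie_isotropy_iff)
  from orthogonal_projection_exists[OF B_inner subspace_lie T(1) this Z]
  obtain W where W: "W \<in> \<hh>" "\<forall>V\<in>\<hh>. B (Z - W) V = 0" unfolding T(3) by blast
  have "Z - W \<in> \<mm>"
    using W Z subspace_diff[OF subspace_lie Z, of W] by (auto simp: reductive_compl_def lie_isotropy_iff)
  moreover have "Z - (Z - W) \<in> \<hh>" using W by simp
  moreover have "(Z - W) p = Z p" using W by (simp add: lie_isotropy_iff blinfun.diff_left)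
  ultimately show thesis using that by blast
qed

lemma \<mm>_surj:
  assumes "inner p v = 0"
  shows "\<exists>Y\<in>\<mm>. Y p = v"
proof -
  obtain Z where Z: "Z \<in> \<gg>" "Z p = v" using inf_transitive[OF assms] by blast
  obtain Y where "Y \<in> \<mm>" "Z - Y \<in> \<hh>" "Y p = Z p" by (rule \<mm>_decomposition[OF Z(1)])
  then show ?thesis using Z(2) by auto
qed

lemma Ad_\<mm>:
  assumes h: "h \<in> isotropy G p" and X: "X \<in> \<mm>"
  shows "Ad h X \<in> \<mm>"
  unfolding reductive_compl_def
proof (intro CollectI conjI ballI)
  have hG: "h \<in> G" "ginv h \<in> G" using isotropyD[OF h] by auto
  show AX: "Ad h X \<in> \<gg>" by (rule Ad_lie[OF hG(1) \<mm>_lie[OF X]])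
  fix Y assume Y: "Y \<in> \<hh>"
  then have Y': "Ad (ginv h) Y \<in> \<hh>" by (rule H.Ad_lie[OF ginv_isotropy[OF h]])
  have "B (Ad h X) Y = B (Ad h X) (Ad h (Ad (ginv h) Y))" by (simp add: Ad_ginv hG)
  also have "\<dots> = B X (Ad (ginv h) Y)"
    by (rule B_Ad) (use hG X Y' in \<open>auto simp: \<mm>_lie lie_isotropy_iff\<close>)
  finally show "B (Ad h X) Y = 0" using X Y' by (simp add: reductive_compl_def)
qed

lemma Ad_isotropy_p: "h \<in> isotropy G p \<Longrightarrow> Ad h X p = h (X p)"
  using isotropyD[of h] ginv_isotropy[of h] isotropyD(2)[of "ginv h"] by (simp add: Ad_apply)

text \<open>
  The inverse of \<open>Y \<mapsto> Y p\<close> on \<open>\<mm>\<close>. It is extended by \<open>0\<close> to the normal direction so that forms on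
  \<open>\<mm>\<close> pull back to forms on the ambient space.
\<close>

definition lift :: "'a \<Rightarrow> 'a op" where
  "lift v = (THE Y. Y \<in> \<mm> \<and> Y p = v - inner p v *\<^sub>R p)"

lemma lift_\<mm>: "lift v \<in> \<mm>"
  and lift_p: "lift v p = v - inner p v *\<^sub>R p"
proof -
  have "inner p (v - inner p v *\<^sub>R p) = 0" by (simp add: inner_diff_right inner_pp)
  then have "\<exists>!Y. Y \<in> \<mm> \<and> Y p = v - inner p v *\<^sub>R p"
    using \<mm>_surj \<mm>_inj by metis
  from theI'[OF this] show "lift v \<in> \<mm>" "lift v p = v - inner p v *\<^sub>R p"
    by (auto simp: lift_def)
qed

lemma lift_eqI: "X \<in> \<mm> \<Longrightarrow> X p = v \<Longrightarrow> lift v = X"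
  using \<mm>_inj[OF lift_\<mm>] lift_p orth_lie \<mm>_lie by fastforce

lemma lift_linear: "linear lift"
proof
  show "lift (v + w) = lift v + lift w" for v w
    by (rule \<mm>_inj) (auto simp: lift_\<mm> lift_p subspace_add[OF \<mm>_subspace] blinfun.add_left
        inner_add_right algebra_simps)
  show "lift (r *\<^sub>R v) = r *\<^sub>R lift v" for r v
    by (rule \<mm>_inj) (auto simp: lift_\<mm> lift_p subspace_scale[OF \<mm>_subspace] blinfun.scaleR_left
        algebra_simps)
qed

lemma lift_isotropy:
  assumes "h \<in> isotropy G p" "inner p v = 0"
  shows "lift (h v) = Ad h (lift v)"
  by (rule lift_eqI) (use assms in \<open>simp_all add: Ad_\<mm> lift_\<mm> Ad_isotropy_p lift_p\<close>)

lemma fixed_complD: "u \<in> \<mm>\<^sub>0 \<Longrightarrow> u \<in> \<mm>" "u \<in> \<mm>\<^sub>0 \<Longrightarrow> h \<in> isotropy G p \<Longrightarrow> Ad h u = u"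
  by (auto simp: fixed_compl_def)

lemma fixed_compl_iff:
  "X \<in> \<mm>\<^sub>0 \<longleftrightarrow> X \<in> \<mm> \<and> (\<forall>h\<in>isotropy G p. h (X p) = X p)"
  using \<mm>_inj[OF Ad_\<mm>] Ad_isotropy_p by (auto simp: fixed_compl_def) (metis)+

lemma bilinear_lift:
  assumes "inner_product_on \<mm> \<alpha>"
  shows "bilinear (\<lambda>v w. \<alpha> (lift v) (lift w))"
proof -
  have add: "\<alpha> (x + y) z = \<alpha> x z + \<alpha> y z" if "x \<in> \<mm>" "y \<in> \<mm>" "z \<in> \<mm>" for x y z
    using assms that by (auto simp: inner_product_on_def)
  have sc: "\<alpha> (r *\<^sub>R x) y = r * \<alpha> x y" if "x \<in> \<mm>" "y \<in> \<mm>" for x y r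
    using assms that by (auto simp: inner_product_on_def)
  show ?thesis
    unfolding bilinear_def
    by (auto intro!: linearI simp: linear_add[OF lift_linear] linear_scale[OF lift_linear]
        add sc lift_\<mm> inner_product_on_right(2,5)[OF assms _ _ \<mm>_subspace])
qed

lemma invariant_form_lift:
  assumes \<alpha>: "inner_product_on \<mm> \<alpha>"
    and inv: "\<And>h X Y. h \<in> isotropy G p \<Longrightarrow> X \<in> \<mm> \<Longrightarrow> Y \<in> \<mm> \<Longrightarrow> \<alpha> (Ad h X) (Ad h Y) = \<alpha> X Y"
  shows "invariant_form (\<lambda>v w. \<alpha> (lift v) (lift w))"
  unfolding invariant_form_def
proof (intro conjI allI ballI impI)
  show "bilinear (\<lambda>v w. \<alpha> (lift v) (lift w))" by (rule bilinear_lift[OF \<alpha>])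
  show "\<alpha> (lift v) (lift w) = \<alpha> (lift w) (lift v)" for v w
    by (rule inner_product_on_right(1)[OF \<alpha> lift_\<mm> lift_\<mm> \<mm>_subspace])
  show "0 < \<alpha> (lift v) (lift v)" if "inner p v = 0" "v \<noteq> 0" for v
  proof -
    have "lift v \<noteq> 0" using lift_p[of v] that by auto
    then show ?thesis using \<alpha> lift_\<mm> by (auto simp: inner_product_on_def)
  qed
qed (simp add: lift_isotropy inv lift_\<mm>)

text \<open>
  The vector \<open>w\<close> is \<open>u p\<close>, for the vector \<open>u \<in> \<mm>\<^sub>0\<close> that defines the metric.
\<close>

lemma invariant_randers_metricD:
  assumes "invariant_randers_metric G p B F"
  obtains Q w where "invariant_function F" "invariant_form Q"
    "inner p w = 0" "Q w w < 1"
    "\<And>h. h \<in> isotropy G p \<Longrightarrow> h w = w"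
    "\<And>v. inner p v = 0 \<Longrightarrow> F p v = sqrt (Q v v) + Q v w"
proof -
  from assms obtain \<alpha> u where inv: "invariant_function F"
    and \<alpha>: "inner_product_on \<mm> \<alpha>"
    and \<alpha>inv: "\<And>h X Y. h \<in> isotropy G p \<Longrightarrow> X \<in> \<mm> \<Longrightarrow> Y \<in> \<mm> \<Longrightarrow> \<alpha> (Ad h X) (Ad h Y) = \<alpha> X Y"
    and u: "u \<in> \<mm>\<^sub>0" "\<alpha> u u < 1"
    and F: "\<And>Y. Y \<in> \<mm> \<Longrightarrow> F p (Y p) = sqrt (\<alpha> Y Y) + \<alpha> Y u"
    unfolding invariant_randers_metric_def invariant_function_def by (auto simp: dist_norm)
  have lu: "lift (u p) = u" by (rule lift_eqI) (use u fixed_complD in auto)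
  show thesis
  proof (rule that[OF inv invariant_form_lift[OF \<alpha> \<alpha>inv]])
    show "inner p (u p) = 0" using u(1) fixed_complD(1) \<mm>_lie orth_lie by blast
    show "\<alpha> (lift (u p)) (lift (u p)) < 1" using u lu by simp
    show "h (u p) = u p" if "h \<in> isotropy G p" for h using u(1) that by (auto simp: fixed_compl_iff)
    show "F p v = sqrt (\<alpha> (lift v) (lift v)) + \<alpha> (lift v) (lift (u p))" if "inner p v = 0" for v
      using F[OF lift_\<mm>[of v]] that by (simp add: lift_p lu)
  qed
qed

text \<open>
  As \<open>B(\<sqdot>, u)\<close> vanishes on \<open>\<hh>\<close>, it depends on \<open>Z p\<close> only; \<open>\<xi>\<close> represents it with respect to the
  Euclidean inner product.
\<close>

definition covector :: "'a op \<Rightarrow> 'a \<Rightarrow> bool" where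
  "covector u \<xi> \<longleftrightarrow> inner p \<xi> = 0 \<and> (\<forall>h\<in>isotropy G p. h \<xi> = \<xi>) \<and>
     (\<forall>Z\<in>\<gg>. B Z u = inner (blinfun_apply Z p) \<xi>)"

lemma fixed_compl_covector:
  assumes u: "u \<in> \<mm>\<^sub>0"
  shows "\<exists>\<xi>. covector u \<xi>"
proof -
  have um: "u \<in> \<mm>" "u \<in> \<gg>" using u fixed_complD \<mm>_lie by auto
  have lin: "linear (\<lambda>v. B (lift v) u)"
    by (rule linearI) (simp_all add: linear_add[OF lift_linear] linear_scale[OF lift_linear]
        B_add B_scale um \<mm>_lie lift_\<mm>)
  have inv: "B (lift (h v)) u = B (lift v) u" if "h \<in> isotropy G p" "inner p v = 0" for h v
    using B_Ad[OF isotropyD(1)[OF that(1)] \<mm>_lie[OF lift_\<mm>[of v]] um(2)] that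
    by (simp add: lift_isotropy fixed_complD(2)[OF u])
  obtain \<xi> where \<xi>: "inner p \<xi> = 0" "\<forall>h\<in>isotropy G p. h \<xi> = \<xi>"
    "\<And>v. inner p v = 0 \<Longrightarrow> B (lift v) u = inner v \<xi>"
    using invariant_functional[OF lin inv] by blast
  have "B Z u = inner (Z p) \<xi>" if Z: "Z \<in> \<gg>" for Z :: "'a op"
  proof -
    obtain Y where Y: "Y \<in> \<mm>" "Z - Y \<in> \<hh>" "Y p = Z p" by (rule \<mm>_decomposition[OF Z])
    have "B (Z - Y) u = 0"
      using um Y(2) B_rules(1)[of u "Z - Y"] by (auto simp: reductive_compl_def lie_isotropy_iff)
    then have "B Z u = B Y u" using B_rules(4)[OF Z \<mm>_lie[OF Y(1)] um(2)] by simp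
    also have "Y = lift (Z p)" using lift_eqI[OF Y(1)] Y(3) by simp
    also have "B (lift (Z p)) u = inner (Z p) \<xi>" by (rule \<xi>(3)[OF orth_lie[OF Z]])
    finally show ?thesis .
  qed
  with \<xi>(1,2) show ?thesis unfolding covector_def by blast
qed

text \<open>
  A multiple of \<open>B\<close> small enough to give \<open>u\<close> a norm below \<open>1\<close> serves as Riemannian part of both
  metrics, and \<open>u\<close> and \<open>- u\<close> as their fixed vectors. Their half difference is the linear form
  \<open>\<langle>\<sqdot>, c \<xi>\<rangle>\<close>, for which the first variation is easy to evaluate.
\<close>

lemma opposite_randers_metrics:
  assumes u: "u \<in> \<mm>\<^sub>0" "u \<noteq> 0" "covector u \<xi>"
  obtains F F' Q c where "invariant_randers_metric G p B F" "invariant_randers_metric G p B F'"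
    "invariant_function F" "invariant_function F'" "bilinear Q"
    "\<And>v. inner p v = 0 \<Longrightarrow> F p v = sqrt (Q v v) + inner v (c *\<^sub>R \<xi>)"
    "\<And>v. inner p v = 0 \<Longrightarrow> F' p v = sqrt (Q v v) - inner v (c *\<^sub>R \<xi>)"
    "c > 0"
proof -
  have um: "u \<in> \<mm>" "u \<in> \<gg>" using u fixed_complD \<mm>_lie by auto
  define c where "c = 1 / (2 * B u u)"
  have c: "c > 0" "c * B u u < 1" using B_pos[OF um(2) u(2)] by (auto simp: c_def)
  define \<alpha> where "\<alpha> X Y = c * B X Y" for X Y
  have \<alpha>: "inner_product_on \<mm> \<alpha>"
    using B_inner c(1) \<mm>_lie unfolding inner_product_on_def \<alpha>_def by (auto simp: algebra_simps)
  have \<alpha>inv: "\<alpha> (Ad h X) (Ad h Y) = \<alpha> X Y" if "h \<in> isotropy G p" "X \<in> \<mm>" "Y \<in> \<mm>" for h X Y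
    using B_Ad that isotropyD \<mm>_lie by (auto simp: \<alpha>_def)
  define Q where "Q v w = \<alpha> (lift v) (lift w)" for v w
  have Q: "invariant_form Q" unfolding Q_def by (rule invariant_form_lift[OF \<alpha> \<alpha>inv])
  then have Qh: "Q (h v) (h v) = Q v v" if "h \<in> isotropy G p" "inner p v = 0" for h v
    using that by (auto simp: invariant_form_def)
  have \<xi>: "inner p \<xi> = 0" "\<And>h. h \<in> isotropy G p \<Longrightarrow> h \<xi> = \<xi>"
    "\<And>Z. Z \<in> \<gg> \<Longrightarrow> B Z u = inner (blinfun_apply Z p) \<xi>"
    using u(3) by (auto simp: covector_def)
  have lin: "inner (h v) \<xi> = inner v \<xi>" if "h \<in> isotropy G p" for h v
    using inner_isometry[OF isotropyD(1)[OF that], of v \<xi>] \<xi>(2)[OF that] by simp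
  have metric: "invariant_randers_metric G p B E"
    if E: "invariant_function E" and \<epsilon>: "\<epsilon> = 1 \<or> \<epsilon> = -1"
      and Ep: "\<And>v. inner p v = 0 \<Longrightarrow> E p v = sqrt (Q v v) + \<epsilon> * inner v (c *\<^sub>R \<xi>)" for E \<epsilon>
    unfolding invariant_randers_metric_def
  proof (intro conjI exI[of _ \<alpha>] exI[of _ "\<epsilon> *\<^sub>R u"] ballI allI impI \<alpha> \<alpha>inv)
    show "E (g x) (g v) = E x v" if "g \<in> G" "x \<in> sphere 0 1" "inner x v = 0" for g x v
      using E that by (auto simp: invariant_function_def)
    have "h (\<epsilon> *\<^sub>R u p) = \<epsilon> *\<^sub>R u p" if "h \<in> isotropy G p" for h
      using that u(1) by (auto simp: fixed_compl_iff blinfun.scaleR_right)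
    then show "\<epsilon> *\<^sub>R u \<in> \<mm>\<^sub>0"
      using um(1) by (auto simp: fixed_compl_iff subspace_scale[OF \<mm>_subspace] blinfun.scaleR_left)
    show "\<epsilon> *\<^sub>R u \<noteq> 0" using \<epsilon> u(2) by auto
    have B2: "B (\<epsilon> *\<^sub>R u) (\<epsilon> *\<^sub>R u) = B u u"
      using \<epsilon> B_scale[OF um(2) scaleR_lie[OF um(2)], of \<epsilon> \<epsilon>] B_rules(5)[OF um(2) um(2), of \<epsilon>] by auto
    then show "\<alpha> (\<epsilon> *\<^sub>R u) (\<epsilon> *\<^sub>R u) < 1" using c(2) by (simp add: \<alpha>_def)
    show "E p (Y p) = sqrt (\<alpha> Y Y) + \<alpha> Y (\<epsilon> *\<^sub>R u)" if Y: "Y \<in> \<mm>" for Y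
    proof -
      have Yg: "Y \<in> \<gg>" using Y by (rule \<mm>_lie)
      have "lift (Y p) = Y" by (rule lift_eqI[OF Y refl])
      then show ?thesis
        using Ep[OF orth_lie[OF Yg]] \<xi>(3)[OF Yg] B_rules(5)[OF Yg um(2), of \<epsilon>]
        by (simp add: Q_def \<alpha>_def)
    qed
  qed
  obtain F where F: "invariant_function F"
    "\<And>v. inner p v = 0 \<Longrightarrow> F p v = sqrt (Q v v) + inner v (c *\<^sub>R \<xi>)"
    by (rule invariant_extension[of "\<lambda>v. sqrt (Q v v) + inner v (c *\<^sub>R \<xi>)"]) (simp_all add: Qh lin)
  obtain F' where F': "invariant_function F'"
    "\<And>v. inner p v = 0 \<Longrightarrow> F' p v = sqrt (Q v v) - inner v (c *\<^sub>R \<xi>)"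
    by (rule invariant_extension[of "\<lambda>v. sqrt (Q v v) - inner v (c *\<^sub>R \<xi>)"]) (simp_all add: Qh lin)
  show thesis
  proof (rule that[of F F' Q c])
    show "invariant_randers_metric G p B F" by (rule metric[of F 1]) (use F in auto)
    show "invariant_randers_metric G p B F'" by (rule metric[of F' "-1"]) (use F' in auto)
    show "bilinear Q" using Q by (simp add: invariant_form_def)
  qed (use F F' c in auto)
qed

end

section \<open>Calculus of smooth maps\<close>

lemma Ck_on_cong:
  assumes S: "open S" and eq: "\<And>x. x \<in> S \<Longrightarrow> f x = g x"
  shows "Ck_on k f S \<longleftrightarrow> Ck_on k g S"
  using eq
proof (induction k arbitrary: f g)
  case 0
  then show ?case by (auto cong: continuous_on_cong)
next
  case (Suc k)
  have der: "(f has_derivative D) (at x) \<longleftrightarrow> (g has_derivative D) (at x)" if "x \<in> S" for D x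
    using that Suc.prems has_derivative_transform_within_open[OF _ S]
    by (metis (no_types, lifting))
  have "frechet_derivative f (at x) = frechet_derivative g (at x)" if "x \<in> S" for x
    unfolding frechet_derivative_def using der[OF that] by simp
  then have "Ck_on k (\<lambda>x. frechet_derivative f (at x) v) S \<longleftrightarrow> Ck_on k (\<lambda>x. frechet_derivative g (at x) v) S" for v
    by (intro Suc.IH) simp
  moreover have "f differentiable_on S \<longleftrightarrow> g differentiable_on S"
    unfolding differentiable_on_eq_differentiable_at[OF S] differentiable_def using der by blast
  ultimately show ?case by simp
qed

lemma Ck_on_SucI:
  assumes S: "open S" and der: "\<And>x. x \<in> S \<Longrightarrow> (f has_derivative f' x) (at x)"
    and C: "\<And>v. Ck_on k (\<lambda>x. f' x v) S"
  shows "Ck_on (Suc k) f S"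
proof -
  have "Ck_on k (\<lambda>x. frechet_derivative f (at x) v) S" for v
    using C[of v] Ck_on_cong[OF S, of "\<lambda>x. f' x v" "\<lambda>x. frechet_derivative f (at x) v" k]
      frechet_derivative_at[OF der] by simp
  moreover have "f differentiable_on S"
    unfolding differentiable_on_eq_differentiable_at[OF S] differentiable_def using der by blast
  ultimately show ?thesis by simp
qed

lemma Ck_on_SucD:
  assumes "open S" "Ck_on (Suc k) f S"
  shows "x \<in> S \<Longrightarrow> (f has_derivative frechet_derivative f (at x)) (at x)"
    and "Ck_on k (\<lambda>x. frechet_derivative f (at x) v) S"
  using assms by (auto simp: differentiable_on_eq_differentiable_at frechet_derivative_works)

lemma Ck_on_Suc_imp: "Ck_on (Suc k) f S \<Longrightarrow> Ck_on k f S"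
  by (induction k arbitrary: f) (auto intro: differentiable_imp_continuous_on)

lemma Ck_on_const: "open S \<Longrightarrow> Ck_on k (\<lambda>x. c) S"
proof (induction k arbitrary: c)
  case (Suc k)
  show ?case
    by (rule Ck_on_SucI[OF Suc.prems, where f' = "\<lambda>x v. 0"]) (simp_all add: Suc)
qed simp

lemma Ck_on_bounded_linear:
  assumes "open S" "bounded_linear L"
  shows "Ck_on k L S"
proof (cases k)
  case 0
  then show ?thesis using assms by (simp add: linear_continuous_on)
next
  case (Suc m)
  show ?thesis unfolding Suc
    by (rule Ck_on_SucI[OF assms(1), where f' = "\<lambda>x. L"])
      (simp_all add: assms bounded_linear_imp_has_derivative Ck_on_const)
qed

lemma Ck_on_add:
  assumes S: "open S"
  shows "Ck_on k f S \<Longrightarrow> Ck_on k g S \<Longrightarrow> Ck_on k (\<lambda>x. f x + g x) S"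
proof (induction k arbitrary: f g)
  case (Suc k)
  show ?case
    by (rule Ck_on_SucI[OF S, where f' = "\<lambda>x v. frechet_derivative f (at x) v + frechet_derivative g (at x) v"])
      (auto intro!: has_derivative_add Ck_on_SucD[OF S] Suc)
qed (auto intro: continuous_on_add)

lemma Ck_on_compose_bounded_linear:
  assumes S: "open S" and L: "bounded_linear L"
  shows "Ck_on k f S \<Longrightarrow> Ck_on k (\<lambda>x. L (f x)) S"
proof (induction k arbitrary: f)
  case 0
  then show ?case using bounded_linear.continuous_on[OF L] by auto
next
  case (Suc k)
  show ?case
    by (rule Ck_on_SucI[OF S, where f' = "\<lambda>x v. L (frechet_derivative f (at x) v)"])
      (auto intro!: bounded_linear.has_derivative[OF L] Ck_on_SucD[OF S] Suc)
qed

lemma Ck_on_bilinear: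
  assumes S: "open S" and h: "bounded_bilinear h"
  shows "Ck_on k f S \<Longrightarrow> Ck_on k g S \<Longrightarrow> Ck_on k (\<lambda>x. h (f x) (g x)) S"
proof (induction k arbitrary: f g)
  case 0
  then show ?case using bounded_bilinear.continuous_on[OF h] by auto
next
  case (Suc k)
  show ?case
  proof (rule Ck_on_SucI[OF S, where f' = "\<lambda>x v. h (f x) (frechet_derivative g (at x) v)
          + h (frechet_derivative f (at x) v) (g x)"])
    show "((\<lambda>x. h (f x) (g x)) has_derivative (\<lambda>v. h (f x) (frechet_derivative g (at x) v)
          + h (frechet_derivative f (at x) v) (g x))) (at x)" if "x \<in> S" for x
      by (rule bounded_bilinear.FDERIV[OF h Ck_on_SucD(1)[OF S Suc.prems(1) that]
            Ck_on_SucD(1)[OF S Suc.prems(2) that]])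
    show "Ck_on k (\<lambda>x. h (f x) (frechet_derivative g (at x) v)
          + h (frechet_derivative f (at x) v) (g x)) S" for v
      by (rule Ck_on_add[OF S Suc.IH[OF Ck_on_Suc_imp[OF Suc.prems(1)] Ck_on_SucD(2)[OF S Suc.prems(2)]]
            Suc.IH[OF Ck_on_SucD(2)[OF S Suc.prems(1)] Ck_on_Suc_imp[OF Suc.prems(2)]]])
  qed
qed

text \<open>
  Induction on \<open>k\<close> works because the derivative \<open>g' Y exp(g Y)\<close> is a product of a function of class
  \<open>C\<^sup>k\<close> and a linear image of \<open>exp(g Y)\<close> itself.
\<close>

lemma Ck_on_one_param:
  assumes S: "open S" and g: "\<And>k. Ck_on k g S"
  shows "Ck_on k (\<lambda>x. one_param Y (g x)) S"
proof (induction k)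
  case 0
  have "continuous_on UNIV (one_param Y)"
    by (intro continuous_at_imp_continuous_on ballI
        has_vector_derivative_continuous[OF one_param_has_vector_derivative])
  then have "continuous_on S (\<lambda>x. one_param Y (g x))"
    by (rule continuous_on_compose2) (use g[of 0] in auto)
  then show ?case by simp
next
  case (Suc k)
  have gk: "Ck_on (Suc k) g S" by (rule g)
  show ?case
  proof (rule Ck_on_SucI[OF S, where f' = "\<lambda>x v. frechet_derivative g (at x) v *\<^sub>R (Y o\<^sub>L one_param Y (g x))"])
    show "((\<lambda>x. one_param Y (g x)) has_derivative
        (\<lambda>v. frechet_derivative g (at x) v *\<^sub>R (Y o\<^sub>L one_param Y (g x)))) (at x)" if "x \<in> S" for x
      using has_derivative_compose[OF Ck_on_SucD(1)[OF S gk that]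
          one_param_has_vector_derivative[of Y "g x" UNIV, unfolded has_vector_derivative_def]] .
    show "Ck_on k (\<lambda>x. frechet_derivative g (at x) v *\<^sub>R (Y o\<^sub>L one_param Y (g x))) S" for v
      by (rule Ck_on_bilinear[OF S bounded_bilinear_scaleR Ck_on_SucD(2)[OF S gk]
            Ck_on_compose_bounded_linear[OF S
              bounded_bilinear.bounded_linear_right[OF bounded_bilinear_blinfun_compose] Suc]])
  qed
qed

lemma smooth_on_one_param: "smooth_on UNIV (\<lambda>t. one_param X t q)"
  unfolding smooth_on_def
  by (intro allI Ck_on_bilinear[OF open_UNIV bounded_bilinear_blinfun_apply] Ck_on_one_param
      Ck_on_const Ck_on_bounded_linear[OF open_UNIV bounded_linear_ident] open_UNIV)

section \<open>Conserved momenta\<close>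

text \<open>
  The fundamental lemma of the calculus of variations. The quadratic bumps \<open>(t - a)(b - t)\<close> on
  arbitrarily short intervals are enough to test the sign of \<open>f 0\<close>.
\<close>

lemma fundamental_lemma:
  fixes f :: "real \<Rightarrow> real"
  assumes f: "continuous_on UNIV f"
    and int: "\<And>a b. a < b \<Longrightarrow> integral {a..b} (\<lambda>t. (t - a) * (b - t) * f t) = 0"
  shows "f 0 = 0"
proof -
  have no: False if f: "continuous_on UNIV f" and pos: "f 0 > 0"
    and int: "\<And>a b. a < b \<Longrightarrow> integral {a..b} (\<lambda>t. (t - a) * (b - t) * f t) = 0" for f :: "real \<Rightarrow> real"
  proof -
    have "isCont f 0" using f by (simp add: continuous_on_eq_continuous_at)
    then obtain d where d: "d > 0" "\<And>x. norm (x - 0) < d \<Longrightarrow> norm (f x - f 0) < f 0"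
      using pos unfolding continuous_at_eps_delta by (metis dist_norm)
    let ?b = "d / 2" and ?m = "d / 4"
    let ?g = "\<lambda>t. (t - 0) * (?b - t) * f t"
    have fp: "f t > 0" if "t \<in> {0..?b}" for t
      using d(2)[of t] that d(1) by (auto simp: abs_if split: if_splits)
    have "continuous_on {0..?b} ?g"
      by (intro continuous_intros continuous_on_subset[OF f]) auto
    moreover have "?g t \<ge> 0" if "t \<in> {0..?b}" for t
      using fp[OF that] that by (intro mult_nonneg_nonneg) auto
    moreover have "integral {0..?b} ?g = 0" using int[of 0 ?b] d(1) by simp
    ultimately have "\<forall>t\<in>{0..?b}. ?g t = 0"
      using integral_eq_0_iff[of 0 ?b ?g] d(1) by simp
    then have "?g ?m = 0" by (rule bspec) (use d(1) in simp)
    moreover have "?g ?m > 0" using d(1) fp[of ?m] by (auto intro!: mult_pos_pos)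
    ultimately show False by linarith
  qed
  have "\<not> f 0 > 0" using no[OF f _ int] by blast
  moreover have "\<not> - f 0 > 0"
    using no[of "\<lambda>t. - f t"] f int by (auto intro: continuous_on_minus)
  ultimately show ?thesis by simp
qed

context sphere_action
begin

lemma one_param_mem: "X \<in> lie_algebra G \<Longrightarrow> one_param X t \<in> G"
  by (simp add: lie_algebra_def)

text \<open>
  The variation moves \<open>c(t)\<close> by the motions \<open>exp (s \<phi>(t) Y)\<close>, where the function \<open>\<phi>\<close> vanishes at the
  end points. It stays on the sphere without any correction.
\<close>

lemma proper_variation_of_lie:
  assumes X: "X \<in> lie_algebra G" and Y: "Y \<in> lie_algebra G" and q: "norm q = 1"
  shows "proper_variation (\<lambda>t. one_param X t q) a b
     (\<lambda>z. one_param Y (fst z * ((snd z - a) * (b - snd z))) (one_param X (snd z) q))"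
proof -
  have "smooth_on S (\<lambda>z. one_param Y (fst z * ((snd z - a) * (b - snd z))) (one_param X (snd z) q))"
    if S: "open S" for S :: "(real \<times> real) set"
  proof -
    have "Ck_on k (\<lambda>z. fst z * ((snd z + - a) * (b + - snd z))) S" for k
      by (intro Ck_on_bilinear[OF S bounded_bilinear_mult] Ck_on_add[OF S] Ck_on_const[OF S]
          Ck_on_bounded_linear[OF S] bounded_linear_fst bounded_linear_snd bounded_linear_minus)
    then have 1: "Ck_on k (\<lambda>z. fst z * ((snd z - a) * (b - snd z))) S" for k
      by simp
    have 2: "Ck_on k (\<lambda>z. snd z) S" for k
      by (rule Ck_on_bounded_linear[OF S bounded_linear_snd])
    show ?thesis
      unfolding smooth_on_def
      by (intro allI Ck_on_bilinear[OF S bounded_bilinear_blinfun_apply] Ck_on_one_param[OF S]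
          Ck_on_const[OF S] 1 2)
  qed
  moreover have "open ({-1<..<1::real} \<times> {a - 1<..<b + 1})"
    by (intro open_Times) auto
  ultimately show ?thesis
    unfolding proper_variation_def
  proof (intro exI[of _ 1] conjI ballI)
    fix s t
    have "norm (one_param Y (s * ((t - a) * (b - t))) (one_param X t q)) = 1"
      by (simp only: isometry[OF one_param_mem[OF Y]] isometry[OF one_param_mem[OF X]] q)
    then show "one_param Y (fst (s, t) * ((snd (s, t) - a) * (b - snd (s, t)))) (one_param X (snd (s, t)) q)
        \<in> sphere 0 1" by simp
  qed simp_all
qed

text \<open>
  Noether's theorem for the difference of two metrics with the same Riemannian part. By invariance
  the velocity of the variation \<open>exp (s \<phi> Y) c\<close> can be moved back to \<open>p\<close>, where it is
  \<open>X q + s \<phi>' W\<close> with \<open>W(t) = exp(-tX) Y exp(tX) q\<close>, up to the motion \<open>g\<^sub>0\<close>. The square roots cancel in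
  the difference of the lengths, which is therefore affine in \<open>s\<close> with slope proportional to
  \<open>\<integral> \<phi>' J\<close>, where \<open>J = \<langle>W, g\<^sub>0 \<xi>\<rangle>\<close> is the momentum of \<open>Y\<close>. Integration by parts and the fundamental lemma
  give \<open>J' = 0\<close> at \<open>t = 0\<close>.
\<close>

lemma momentum_conservation:
  assumes X: "X \<in> lie_algebra G" and Y: "Y \<in> lie_algebra G" and g0: "g0 \<in> G" and q: "q = g0 p"
    and F: "invariant_function F" and F': "invariant_function F'" and Q: "bilinear Q"
    and Fp: "\<And>v. inner p v = 0 \<Longrightarrow> F p v = sqrt (Q v v) + inner v \<xi>"
    and F'p: "\<And>v. inner p v = 0 \<Longrightarrow> F' p v = sqrt (Q v v) - inner v \<xi>"
    and geo: "finsler_geodesic F (\<lambda>t. one_param X t q)" "finsler_geodesic F' (\<lambda>t. one_param X t q)"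
  shows "inner (Y (X q) - X (Y q)) (g0 \<xi>) = 0"
proof -
  define R where "R t = one_param X t" for t
  define W where "W t = one_param (- X) t (Y (R t q))" for t
  define J where "J t = inner (W t) (g0 \<xi>)" for t
  define W' where "W' t = one_param (- X) t (Y (X (R t q))) + (- X) (one_param (- X) t (Y (R t q)))" for t
  define J' where "J' t = inner (W' t) (g0 \<xi>)" for t
  have mX: "- X \<in> lie_algebra G" using scaleR_lie[OF X, of "-1"] by simp
  have RG: "R t \<in> G" for t unfolding R_def by (rule one_param_mem[OF X])
  have RW: "R t (W t) = Y (R t q)" for t by (simp add: R_def W_def)
  have nq: "norm q = 1" using q isometry[OF g0] norm_p by simp
  have dR: "((\<lambda>t. R t q) has_vector_derivative X (R t q)) (at t)" for t
    unfolding R_def by (rule one_param_apply_has_vector_derivative)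
  have dW: "(W has_vector_derivative W' t) (at t)" for t
    using bounded_bilinear.has_vector_derivative[OF bounded_bilinear_blinfun_apply
        one_param_has_vector_derivative[of "- X" t UNIV]
        bounded_linear.has_vector_derivative[OF blinfun.bounded_linear_right[of Y] dR[of t]]]
    unfolding W_def[abs_def] W'_def by simp
  have dJ: "(J has_vector_derivative J' t) (at t)" for t
    using bounded_linear.has_vector_derivative[OF bounded_linear_inner_left dW[of t]]
    unfolding J_def[abs_def] J'_def .
  have contRA: "continuous_on UNIV (\<lambda>t. one_param Z t)" for Z :: "'a op"
    by (intro continuous_at_imp_continuous_on ballI
        has_vector_derivative_continuous[OF one_param_has_vector_derivative])
  have contJ': "continuous_on UNIV J'"
    unfolding J'_def[abs_def] W'_def R_def
    by (intro continuous_on_inner continuous_on_add bounded_linear.continuous_on[OF blinfun.bounded_linear_right]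
        bounded_bilinear.continuous_on[OF bounded_bilinear_blinfun_apply] contRA continuous_on_const)
  have contW: "continuous_on S W" for S
    by (intro continuous_at_imp_continuous_on ballI has_vector_derivative_continuous[OF dW])
  have contJ: "continuous_on S J" for S
    by (intro continuous_at_imp_continuous_on ballI has_vector_derivative_continuous[OF dJ])
  have "integral {a..b} (\<lambda>t. (t - a) * (b - t) * J' t) = 0" if ab: "a < b" for a b
  proof -
    define \<phi> where "\<phi> t = (t - a) * (b - t)" for t
    define \<phi>' where "\<phi>' t = a + b - 2 * t" for t
    have d\<phi>: "(\<phi> has_vector_derivative \<phi>' t) (at t)" for t
      unfolding \<phi>_def[abs_def] \<phi>'_def has_real_derivative_iff_has_vector_derivative[symmetric]
      by (auto intro!: derivative_eq_intros simp: algebra_simps)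
    have cont\<phi>: "continuous_on S \<phi>" "continuous_on S \<phi>'" for S
      unfolding \<phi>_def[abs_def] \<phi>'_def[abs_def] by (intro continuous_intros)+
    define \<gamma> where "\<gamma> z = one_param Y (fst z * \<phi> (snd z)) (R (snd z) q)" for z
    have \<gamma>: "proper_variation (\<lambda>t. one_param X t q) a b \<gamma>"
      using proper_variation_of_lie[OF X Y nq, of a b] unfolding \<gamma>_def[abs_def] R_def \<phi>_def .
    \<comment> \<open>the velocity of the variation, moved back to \<open>p\<close>\<close>
    define z where "z s t = ginv g0 (X q + (s * \<phi>' t) *\<^sub>R W t)" for s t
    have pz: "inner p (z s t) = 0" for s t
    proof -
      have "inner (R t q) (Y (R t q)) = 0" using lie_skew[OF Y] by (simp add: inner_commute)
      then have "inner q (W t) = 0" using inner_isometry[OF RG[of t], of q "W t"] by (simp add: RW)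
      moreover have "inner q (X q) = 0" using lie_skew[OF X, of q] by (simp add: inner_commute)
      ultimately show ?thesis
        using inner_ginv[OF g0, of p] by (simp add: z_def q[symmetric] blinfun.add_right blinfun.scaleR_right inner_add_right)
    qed
    have vel: "((\<lambda>t. \<gamma> (s, t)) has_vector_derivative
        one_param Y (s * \<phi> t) (R t (g0 (z s t)))) (at t)" for s t
    proof -
      let ?E = "one_param Y (s * \<phi> t)"
      have dE: "((\<lambda>t. one_param Y (s * \<phi> t)) has_vector_derivative (s * \<phi>' t) *\<^sub>R (Y o\<^sub>L ?E)) (at t)"
        using vector_diff_chain_at[OF
            bounded_linear.has_vector_derivative[OF bounded_linear_mult_right[of s] d\<phi>[of t]]
            one_param_has_vector_derivative[of Y "s * \<phi> t" UNIV]]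
        by (simp add: o_def)
      have YE: "Y (?E v) = ?E (Y v)" for v
        using arg_cong[OF one_param_commute_self[of Y "s * \<phi> t"], of "\<lambda>f. blinfun_apply f v"] by simp
      have XR: "X (R t v) = R t (X v)" for v
        using arg_cong[OF one_param_commute_self[of X t], of "\<lambda>f. blinfun_apply f v"]
        by (simp add: R_def)
      have "?E (R t (g0 (z s t))) = ?E (X (R t q)) + ((s * \<phi>' t) *\<^sub>R (Y o\<^sub>L ?E)) (R t q)"
        by (simp add: z_def ginv_right[OF g0] blinfun.add_right blinfun.scaleR_right blinfun.scaleR_left
            RW YE XR)
      then show ?thesis
        using bounded_bilinear.has_vector_derivative[OF bounded_bilinear_blinfun_apply dE dR[of t]]
        by (simp add: \<gamma>_def)
    qed
    have len: "E (\<gamma> (s, t)) (vector_derivative (\<lambda>t. \<gamma> (s, t)) (at t)) = E p (z s t)"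
      if E: "invariant_function E" for E s t
    proof -
      let ?g = "one_param Y (s * \<phi> t) o\<^sub>L (R t o\<^sub>L g0)"
      have "?g \<in> G" by (intro compose_mem one_param_mem[OF Y] RG g0)
      from invariant_functionD[OF E this pz[of s t]] show ?thesis
        unfolding vector_derivative_at[OF vel] by (simp add: \<gamma>_def q)
    qed
    have contz: "continuous_on S (z s)" for s S
      unfolding z_def[abs_def]
      by (intro bounded_linear.continuous_on[OF blinfun.bounded_linear_right] continuous_intros contW cont\<phi>)
    have Qb: "bounded_bilinear Q" using Q by (simp add: bilinear_conv_bounded_bilinear)
    have contF: "continuous_on S (\<lambda>t. sqrt (Q (z s t) (z s t)) + inner (z s t) \<xi>)"
      "continuous_on S (\<lambda>t. sqrt (Q (z s t) (z s t)) - inner (z s t) \<xi>)" for s S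
      by (intro continuous_intros bounded_bilinear.continuous_on[OF Qb] contz)+
    define K where "K = integral {a..b} (\<lambda>t. \<phi>' t * J t)"
    have diff: "finsler_length F a b (\<lambda>t. \<gamma> (s, t)) - finsler_length F' a b (\<lambda>t. \<gamma> (s, t))
       = 2 * (b - a) * inner (X q) (g0 \<xi>) + s * (2 * K)" for s
    proof -
      have "finsler_length F a b (\<lambda>t. \<gamma> (s, t)) - finsler_length F' a b (\<lambda>t. \<gamma> (s, t))
        = integral {a..b} (\<lambda>t. (sqrt (Q (z s t) (z s t)) + inner (z s t) \<xi>)
                - (sqrt (Q (z s t) (z s t)) - inner (z s t) \<xi>))"
        unfolding finsler_length_def len[OF F] len[OF F'] Fp[OF pz] F'p[OF pz]
        by (rule integral_diff[symmetric]) (intro integrable_continuous_real contF)+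
      also have "\<dots> = integral {a..b} (\<lambda>t. 2 * inner (X q) (g0 \<xi>) + (2 * s) * (\<phi>' t * J t))"
      proof (rule integral_cong)
        fix t
        have "inner (z s t) \<xi> = inner (X q + (s * \<phi>' t) *\<^sub>R W t) (g0 \<xi>)"
          unfolding z_def using inner_ginv[OF g0, of \<xi>] by (metis inner_commute)
        then show "(sqrt (Q (z s t) (z s t)) + inner (z s t) \<xi>)
                - (sqrt (Q (z s t) (z s t)) - inner (z s t) \<xi>)
            = 2 * inner (X q) (g0 \<xi>) + (2 * s) * (\<phi>' t * J t)"
          by (simp add: inner_add_left J_def)
      qed
      also have "\<dots> = integral {a..b} (\<lambda>t. 2 * inner (X q) (g0 \<xi>)) + integral {a..b} (\<lambda>t. (2 * s) * (\<phi>' t * J t))"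
        by (rule integral_add) (intro integrable_continuous_real continuous_intros cont\<phi> contJ)+
      also have "\<dots> = 2 * (b - a) * inner (X q) (g0 \<xi>) + s * (2 * K)"
        using ab by (simp add: K_def)
      finally show ?thesis .
    qed
    have "((\<lambda>s. finsler_length E a b (\<lambda>t. \<gamma> (s, t))) has_real_derivative 0) (at 0)"
      if "finsler_geodesic E (\<lambda>t. one_param X t q)" for E
      using that \<gamma> ab unfolding finsler_geodesic_def by blast
    from DERIV_diff[OF this[OF geo(1)] this[OF geo(2)]]
    have "((\<lambda>s. 2 * (b - a) * inner (X q) (g0 \<xi>) + s * (2 * K)) has_real_derivative 0) (at 0)"
      by (simp add: diff)
    moreover have "((\<lambda>s. 2 * (b - a) * inner (X q) (g0 \<xi>) + s * (2 * K)) has_real_derivative 2 * K) (at 0)"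
      by (auto intro!: derivative_eq_intros)
    ultimately have K: "K = 0" using DERIV_unique by fastforce
    have "((\<lambda>t. \<phi> t * J' t + \<phi>' t * J t) has_integral (\<phi> b * J b - \<phi> a * J a)) {a..b}"
      using ab by (intro fundamental_theorem_of_calculus has_vector_derivative_mult
          has_vector_derivative_at_within[OF dJ] has_vector_derivative_at_within[OF d\<phi>]) auto
    then have "integral {a..b} (\<lambda>t. \<phi> t * J' t + \<phi>' t * J t) = 0"
      by (simp add: \<phi>_def integral_unique)
    moreover have "integral {a..b} (\<lambda>t. \<phi> t * J' t + \<phi>' t * J t) = integral {a..b} (\<lambda>t. \<phi> t * J' t) + K"
      unfolding K_def
      by (rule integral_add)
        (intro integrable_continuous_real continuous_intros cont\<phi> contJ continuous_on_subset[OF contJ'] subset_UNIV)+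
    ultimately show ?thesis using K by (simp add: \<phi>_def)
  qed
  from fundamental_lemma[OF contJ' this] show ?thesis
    by (simp add: J'_def W'_def R_def blinfun.minus_left inner_add_left inner_diff_left)
qed

end

section \<open>Velocities of equigeodesics\<close>

context sphere_action
begin

definition equivariant_structure :: "'a op \<Rightarrow> bool" where
  "equivariant_structure I \<longleftrightarrow> (\<forall>g\<in>G. \<forall>x. I (g x) = g (I x)) \<and>
     (\<forall>x y. inner (I x) y = - inner x (I y)) \<and> (\<forall>x. I (I x) = - x)"

lemma commutant_lie:
  fixes C :: "'a op"
  assumes C: "\<And>g x. g \<in> G \<Longrightarrow> C (g x) = g (C x)" and X: "X \<in> lie_algebra G"
  shows "C (X x) = X (C x)"
proof -
  have "((\<lambda>t. C (one_param X t x)) has_vector_derivative C (X (one_param X 0 x))) (at 0)"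
    by (intro bounded_linear.has_vector_derivative[OF blinfun.bounded_linear_right]
        one_param_apply_has_vector_derivative)
  then have "((\<lambda>t. one_param X t (C x)) has_vector_derivative C (X x)) (at 0)"
    by (simp add: C[OF one_param_mem[OF X]])
  from vector_derivative_unique_at[OF this one_param_apply_has_vector_derivative[of X "C x" 0]]
  show ?thesis by simp
qed

lemma structure_lie_commute:
  "equivariant_structure I \<Longrightarrow> X \<in> lie_algebra G \<Longrightarrow> I (X x) = X (I x)"
  by (rule commutant_lie) (simp_all add: equivariant_structure_def)

lemma structure_orth: "equivariant_structure I \<Longrightarrow> inner x (I x) = 0"
  unfolding equivariant_structure_def
  by (metis (no_types, opaque_lifting) add.inverse_unique add_cancel_left_left inner_commute
      minus_equation_iff neg_equal_zero)

text \<open>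
  By skewness of \<open>X\<close>, \<open>Y\<close> and \<open>I\<close>, the pairing of \<open>Y X q - X Y q\<close> with \<open>I q\<close> equals
  \<open>2 \<langle>I X q, Y q\<rangle>\<close>. The vectors \<open>Y q\<close> fill the tangent space at \<open>q\<close>, so \<open>I X q\<close> is normal to the
  sphere.
\<close>

lemma velocity_of_critical_orbit:
  assumes I: "equivariant_structure I" and X: "X \<in> lie_algebra G" and g0: "g0 \<in> G" and q: "q = g0 p"
    and r: "r \<noteq> 0"
    and mom: "\<And>Y. Y \<in> lie_algebra G \<Longrightarrow> inner (Y (X q) - X (Y q)) (g0 (r *\<^sub>R I p)) = 0"
  shows "\<exists>s. X q = s *\<^sub>R I q"
proof -
  have skewI: "inner (I x) y = - inner x (I y)" and II: "I (I x) = - x" for x y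
    using I by (auto simp: equivariant_structure_def)
  have Iq: "g0 (r *\<^sub>R I p) = r *\<^sub>R I q"
    using I g0 by (simp add: equivariant_structure_def q blinfun.scaleR_right)
  have nq: "inner q q = 1" using isometry[OF g0] norm_p by (simp add: q norm_eq_1[symmetric])
  have orth: "inner (I (X q)) w = 0" if w: "inner q w = 0" for w
  proof -
    have "inner p (ginv g0 w) = 0" using inner_ginv[OF g0, of p w] w by (simp add: q)
    then obtain Y0 where Y0: "Y0 \<in> lie_algebra G" "Y0 p = ginv g0 w" using inf_transitive by blast
    define Y where "Y = Ad g0 Y0"
    have Y: "Y \<in> lie_algebra G" unfolding Y_def by (rule Ad_lie[OF g0 Y0(1)])
    have Yq: "Y q = w" by (simp add: Y_def Ad_apply g0 q ginv_left ginv_right Y0(2))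
    have "0 = inner (Y (X q) - X (Y q)) (I q)" using mom[OF Y] r by (simp add: Iq)
    also have "\<dots> = - inner (X q) (I w) + inner w (I (X q))"
      by (simp add: inner_diff_left lie_inner[OF Y] lie_inner[OF X] structure_lie_commute[OF I Y, symmetric]
          structure_lie_commute[OF I X, symmetric] Yq)
    also have "\<dots> = 2 * inner (I (X q)) w" by (simp add: skewI inner_commute)
    finally show ?thesis by simp
  qed
  define w where "w = I (X q) - inner q (I (X q)) *\<^sub>R q"
  have qw: "inner q w = 0" by (simp add: w_def inner_diff_right nq)
  have "inner w w = inner (I (X q)) w - inner q (I (X q)) * inner q w"
    by (simp add: w_def inner_diff_left)
  then have w0: "w = 0" using qw orth[OF qw] by simp
  define k where "k = inner q (I (X q))"
  have "I (X q) = k *\<^sub>R q" using w0 by (simp add: w_def k_def)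
  then have "I (I (X q)) = k *\<^sub>R I q" by (simp add: blinfun.scaleR_right)
  then have "X q = - k *\<^sub>R I q" by (metis II minus_minus scaleR_minus_left)
  then show ?thesis ..
qed

end

context reductive_sphere
begin

lemma equigeodesic_momentum:
  assumes c: "randers_equigeodesic G p B (\<lambda>t. one_param X t q)" and X: "X \<in> \<gg>" and Y: "Y \<in> \<gg>"
    and g0: "g0 \<in> G" "q = g0 p" and u: "u \<in> \<mm>\<^sub>0" "u \<noteq> 0" "covector u \<xi>"
  shows "inner (Y (X q) - X (Y q)) (g0 \<xi>) = 0"
proof -
  obtain F F' Q k where *: "invariant_randers_metric G p B F" "invariant_randers_metric G p B F'"
    "invariant_function F" "invariant_function F'" "bilinear Q"
    "\<And>v. inner p v = 0 \<Longrightarrow> F p v = sqrt (Q v v) + inner v (k *\<^sub>R \<xi>)"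
    "\<And>v. inner p v = 0 \<Longrightarrow> F' p v = sqrt (Q v v) - inner v (k *\<^sub>R \<xi>)"
    "k > 0"
    by (rule opposite_randers_metrics[OF u]) blast
  have geo: "finsler_geodesic F (\<lambda>t. one_param X t q)" "finsler_geodesic F' (\<lambda>t. one_param X t q)"
    using c *(1,2) by (auto simp: randers_equigeodesic_def homogeneous_geodesic_def)
  show ?thesis
    using momentum_conservation[OF X Y g0 *(3-7) geo] *(8) by (simp add: blinfun.scaleR_right)
qed

lemma covector_nonzero:
  assumes "u \<in> \<mm>\<^sub>0" "u \<noteq> 0" "covector u \<xi>"
  shows "\<xi> \<noteq> 0"
proof
  assume "\<xi> = 0"
  then have "B u u = 0" using assms fixed_complD(1) \<mm>_lie by (force simp: covector_def)
  then show False using B_pos[of u] assms fixed_complD(1) \<mm>_lie by force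
qed

lemma equigeodesic_velocity:
  assumes c: "randers_equigeodesic G p B (\<lambda>t. one_param X t q)" and X: "X \<in> \<gg>"
    and q: "norm q = 1" and I: "equivariant_structure I"
    and u: "u \<in> \<mm>\<^sub>0" "u \<noteq> 0" "covector u (r *\<^sub>R I p)"
  shows "\<exists>s. X q = s *\<^sub>R I q"
proof -
  obtain g0 where g0: "g0 \<in> G" "q = g0 p" using transitive[OF q] by blast
  have "r \<noteq> 0" using covector_nonzero[OF u] by auto
  from velocity_of_critical_orbit[OF I X g0 this equigeodesic_momentum[OF c X _ g0 u]]
  show ?thesis .
qed

text \<open>
  Elements of \<open>\<mm>\<close> are determined by their values at \<open>p\<close>, and \<open>X p\<close> is a multiple of \<open>I p\<close>, which is
  fixed by \<open>H\<close> since \<open>I\<close> commutes with the group.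
\<close>

lemma equigeodesic_vector_fixed:
  assumes I: "equivariant_structure I"
    and line: "\<And>v. inner p v = 0 \<Longrightarrow> \<forall>h\<in>isotropy G p. h v = v \<Longrightarrow> \<exists>r. v = r *\<^sub>R I p"
    and u: "u \<in> \<mm>\<^sub>0" "u \<noteq> 0"
    and X: "X \<in> \<mm>" "randers_equigeodesic_vector G p B X"
  shows "X \<in> \<mm>\<^sub>0"
proof -
  obtain \<xi> where \<xi>: "covector u \<xi>" using fixed_compl_covector[OF u(1)] by blast
  then obtain r where r: "\<xi> = r *\<^sub>R I p" using line[of \<xi>] by (auto simp: covector_def)
  obtain s where s: "X p = s *\<^sub>R I p"
    using equigeodesic_velocity[OF _ \<mm>_lie[OF X(1)] norm_p I u] \<xi> X(2)
    by (auto simp: r randers_equigeodesic_vector_def)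
  have "h (X p) = X p" if h: "h \<in> isotropy G p" for h
  proof -
    have "h (I p) = I (h p)" using I isotropyD(1)[OF h] by (simp add: equivariant_structure_def)
    then show ?thesis using isotropyD(2)[OF h] by (simp add: s blinfun.scaleR_right)
  qed
  then show ?thesis using X(1) by (simp add: fixed_compl_iff)
qed

text \<open>
  The velocity of an equigeodesic at \<open>q\<close> is a multiple of both \<open>I q\<close> and \<open>I' q\<close>, hence zero; but
  geodesics have positive speed.
\<close>

lemma no_equigeodesic_of_independent_structures:
  assumes I: "equivariant_structure I" "equivariant_structure I'"
    and u: "u \<in> \<mm>\<^sub>0" "u \<noteq> 0" "covector u (r *\<^sub>R I p)"
    and u': "u' \<in> \<mm>\<^sub>0" "u' \<noteq> 0" "covector u' (r' *\<^sub>R I' p)"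
    and indep: "\<And>q s s'. norm q = 1 \<Longrightarrow> s *\<^sub>R I q = s' *\<^sub>R I' q \<Longrightarrow> s = 0"
  shows "\<not> randers_equigeodesic G p B c"
proof
  assume c: "randers_equigeodesic G p B c"
  obtain F where F: "invariant_randers_metric G p B F"
    by (rule opposite_randers_metrics[OF u])
  then have "homogeneous_geodesic G F c" using c by (simp add: randers_equigeodesic_def)
  then obtain X q where X: "X \<in> \<gg>" and q: "norm q = 1" and cX: "c = (\<lambda>t. one_param X t q)"
    and geo: "finsler_geodesic F c"
    unfolding homogeneous_geodesic_def by (auto simp: fun_eq_iff)
  have c': "randers_equigeodesic G p B (\<lambda>t. one_param X t q)" using c by (simp add: cX)
  obtain s where s: "X q = s *\<^sub>R I q" using equigeodesic_velocity[OF c' X q I(1) u] by blast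
  obtain s' where s': "X q = s' *\<^sub>R I' q" using equigeodesic_velocity[OF c' X q I(2) u'] by blast
  have "s = 0" using indep[OF q, of s s'] s s' by simp
  then have "X q = 0" using s by simp
  then have "vector_derivative c (at 0) = 0"
    using vector_derivative_at[OF one_param_apply_has_vector_derivative[of X q 0 UNIV]] by (simp add: cX)
  moreover have "c 0 = q" by (simp add: cX)
  ultimately have "F q 0 > 0" using geo by (auto simp: finsler_geodesic_def) metis
  obtain g0 where g0: "g0 \<in> G" "q = g0 p" using transitive[OF q] by blast
  obtain Q w where "invariant_function F" "invariant_form Q"
    "\<And>v. inner p v = 0 \<Longrightarrow> F p v = sqrt (Q v v) + Q v w"
    by (rule invariant_randers_metricD[OF F]) blast
  then have "F (g0 p) (g0 0) = 0"
    using invariant_functionD[of F g0 0] g0(1) bilinear_lzero[of Q]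
    by (simp add: invariant_form_def)
  then show False using \<open>F q 0 > 0\<close> g0(2) by simp
qed

end

section \<open>Critical orbits\<close>

text \<open>
  The mean value inequality in the variation parameter \<open>s\<close>, uniformly in \<open>t\<close> by compactness.
\<close>

lemma Ck1_Lipschitz:
  fixes f :: "real \<times> real \<Rightarrow> 'a::real_normed_vector"
  assumes f: "Ck_on 1 f S" and S: "open S" and sub: "{-e..e} \<times> {a..b} \<subseteq> S"
  obtains M where "M \<ge> 0" "\<And>s t. s \<in> {-e..e} \<Longrightarrow> t \<in> {a..b} \<Longrightarrow> norm (f (s, t) - f (0, t)) \<le> M * \<bar>s\<bar>"
proof -
  let ?D = "\<lambda>z. frechet_derivative f (at z) (1, 0)"
  have f': "Ck_on (Suc 0) f S" using f by simp
  have "continuous_on ({-e..e} \<times> {a..b}) ?D"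
    using Ck_on_SucD(2)[OF S f', of "(1, 0)"] sub by (auto intro: continuous_on_subset)
  then have "bounded (?D ` ({-e..e} \<times> {a..b}))"
    by (intro compact_imp_bounded compact_continuous_image compact_Times) auto
  then obtain M where M: "M > 0" "\<And>z. z \<in> {-e..e} \<times> {a..b} \<Longrightarrow> norm (?D z) \<le> M"
    unfolding bounded_pos by blast
  have "norm (f (s, t) - f (0, t)) \<le> M * \<bar>s\<bar>" if s: "s \<in> {-e..e}" and t: "t \<in> {a..b}" for s t
  proof -
    have "norm (f (s, t) - f (0, t)) \<le> M * norm (s - 0)"
    proof (rule differentiable_bound[of "{-e..e}" "\<lambda>s. f (s, t)" "\<lambda>s h. frechet_derivative f (at (s, t)) (h, 0)"])
      fix s assume s: "s \<in> {-e..e}"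
      have "(f has_derivative frechet_derivative f (at (s, t))) (at (s, t))"
        by (rule Ck_on_SucD(1)[OF S f']) (use s t sub in auto)
      moreover have "((\<lambda>s. (s, t)) has_derivative (\<lambda>h. (h, 0))) (at s within {-e..e})"
        by (auto intro!: derivative_eq_intros)
      ultimately show der: "((\<lambda>s. f (s, t)) has_derivative (\<lambda>h. frechet_derivative f (at (s, t)) (h, 0)))
          (at s within {-e..e})"
        using has_derivative_compose by blast
      have "norm (frechet_derivative f (at (s, t)) (h, 0)) \<le> M * norm h" for h
      proof -
        have "frechet_derivative f (at (s, t)) (h, 0) = h *\<^sub>R ?D (s, t)"
          using linear_scale[OF has_derivative_linear[OF der], of h 1] by simp
        then have "norm (frechet_derivative f (at (s, t)) (h, 0)) = norm (?D (s, t)) * norm h"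
          by (simp only: norm_scaleR real_norm_def mult.commute)
        also have "\<dots> \<le> M * norm h"
          by (intro mult_right_mono M(2)) (use s t in auto)
        finally show ?thesis .
      qed
      then show "onorm (\<lambda>h. frechet_derivative f (at (s, t)) (h, 0)) \<le> M"
        by (rule onorm_le)
    qed (use s in auto)
    then show ?thesis by simp
  qed
  with M(1) that show thesis by (meson less_imp_le)
qed

lemma has_derivative_zero_of_square_bound:
  fixes L :: "real \<Rightarrow> real"
  assumes e: "e > 0" and L: "\<And>s. \<bar>s\<bar> \<le> e \<Longrightarrow> \<bar>L s - L0\<bar> \<le> P * s\<^sup>2"
  shows "(L has_real_derivative 0) (at 0)"
proof -
  have L0: "L 0 = L0" using L[of 0] e by simp
  have "(\<lambda>h. (L (0 + h) - L 0) / h) \<midarrow>0\<rightarrow> 0"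
  proof (rule Lim_null_comparison)
    show "((\<lambda>h. P * \<bar>h\<bar>) \<longlongrightarrow> 0) (at 0)" by (auto intro!: tendsto_eq_intros)
    show "eventually (\<lambda>h. norm ((L (0 + h) - L 0) / h) \<le> P * \<bar>h\<bar>) (at 0)"
      unfolding eventually_at
    proof (intro exI[of _ e] conjI e ballI impI)
      fix h :: real assume h: "h \<noteq> 0 \<and> dist h 0 < e"
      then have "\<bar>L h - L0\<bar> \<le> P * (\<bar>h\<bar> * \<bar>h\<bar>)" using L[of h] by (simp add: power2_eq_square)
      then show "norm ((L (0 + h) - L 0) / h) \<le> P * \<bar>h\<bar>"
        using h by (simp add: L0 divide_simps mult.assoc)
    qed
  qed
  then show ?thesis by (simp add: DERIV_def)
qed

text \<open>
  The bound on \<open>F\<close> says that near the velocities \<open>r I c\<close> it agrees to first order with a multiple of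
  \<open>\<eta>(v) = \<langle>v, I x\<rangle>\<close>, since the remainder is quadratic in the component of \<open>v\<close> orthogonal to \<open>I x\<close>.
  The integral of \<open>\<eta>\<close> along the variation is constant to first order because \<open>d\<eta>\<close>, a multiple of
  \<open>\<langle>I \<sqdot>, \<sqdot>\<rangle>\<close>, pairs the velocity with vectors orthogonal to \<open>c\<close> to zero.

  To avoid differentiation under the integral, write \<open>\<gamma> = c + \<delta>\<close> with \<open>\<delta>\<close> and its
  \<open>t\<close>-derivative of size \<open>O(s)\<close>. Up to the total derivative of \<open>g = \<langle>\<delta>, I c\<rangle>\<close>, the difference
  \<open>\<eta> - r\<close> equals \<open>2 r \<langle>c, \<delta>\<rangle>\<close> plus terms quadratic in \<open>\<delta>\<close>; and \<open>2 \<langle>c, \<delta>\<rangle> = - |\<delta>|\<^sup>2\<close> because both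
  \<open>c\<close> and \<open>\<gamma>\<close> are unit vectors. So the length changes by \<open>O(s\<^sup>2)\<close> only.
\<close>

lemma first_variation_zero:
  fixes I :: "'a::euclidean_space \<Rightarrow>\<^sub>L 'a"
  assumes I: "\<And>x y. inner (I x) y = - inner x (I y)" "\<And>x. I (I x) = - x"
    and c: "\<And>t. (c has_vector_derivative r *\<^sub>R I (c t)) (at t)" "\<And>t. norm (c t) = 1" and r: "r \<noteq> 0"
    and bound: "\<And>x v. norm x = 1 \<Longrightarrow> inner x v = 0 \<Longrightarrow> inner v (I x) * r \<ge> r\<^sup>2 / 2 \<Longrightarrow>
        \<bar>F x v - D * inner v (I x)\<bar> \<le> K * (norm (v - inner v (I x) *\<^sub>R I x))\<^sup>2"
    and contF: "\<And>R. continuous_on {(x, v). norm x = 1 \<and> inner x v = 0 \<and> norm v \<le> R} (\<lambda>(x, v). F x v)"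
    and ab: "a < b" and \<gamma>: "proper_variation c a b \<gamma>"
  shows "((\<lambda>s. finsler_length F a b (\<lambda>t. \<gamma> (s, t))) has_real_derivative 0) (at 0)"
proof -
  have nI: "norm (I x) = norm x" for x unfolding norm_eq by (simp add: I)
  from \<gamma> obtain \<epsilon> where \<epsilon>: "\<epsilon> > 0"
    and smooth: "smooth_on ({-\<epsilon><..<\<epsilon>} \<times> {a-\<epsilon><..<b+\<epsilon>}) \<gamma>"
    and sph: "\<And>s t. s \<in> {-\<epsilon><..<\<epsilon>} \<Longrightarrow> t \<in> {a..b} \<Longrightarrow> norm (\<gamma> (s, t)) = 1"
    and \<gamma>0: "\<And>t. t \<in> {a-\<epsilon><..<b+\<epsilon>} \<Longrightarrow> \<gamma> (0, t) = c t"
    and \<gamma>ab: "\<And>s. s \<in> {-\<epsilon><..<\<epsilon>} \<Longrightarrow> \<gamma> (s, a) = c a \<and> \<gamma> (s, b) = c b"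
    unfolding proper_variation_def by (auto simp: dist_norm)
  define S where "S = {-\<epsilon><..<\<epsilon>} \<times> {a-\<epsilon><..<b+\<epsilon>}"
  have S: "open S" unfolding S_def by (intro open_Times) auto
  have Ck: "Ck_on k \<gamma> S" for k using smooth by (simp add: smooth_on_def S_def)
  define v where "v z = frechet_derivative \<gamma> (at z) (0, 1)" for z
  have Ckv: "Ck_on k v S" for k
    unfolding v_def[abs_def] by (rule Ck_on_SucD(2)[OF S Ck])
  have dv: "((\<lambda>t. \<gamma> (s, t)) has_vector_derivative v (s, t)) (at t)" if "(s, t) \<in> S" for s t
  proof -
    have "(\<gamma> has_derivative frechet_derivative \<gamma> (at (s, t))) (at (s, t))"
      by (rule Ck_on_SucD(1)[OF S Ck that])
    moreover have "((\<lambda>t. (s, t)) has_derivative (\<lambda>h. (0, h))) (at t)"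
      by (auto intro!: derivative_eq_intros)
    ultimately have der: "((\<lambda>t. \<gamma> (s, t)) has_derivative (\<lambda>h. frechet_derivative \<gamma> (at (s, t)) (0, h))) (at t)"
      using has_derivative_compose by blast
    have "frechet_derivative \<gamma> (at (s, t)) (0, h) = h *\<^sub>R v (s, t)" for h
      using linear_scale[OF has_derivative_linear[OF der], of h 1] by (simp add: v_def)
    with der show ?thesis by (simp add: has_vector_derivative_def)
  qed
  define e where "e = \<epsilon> / 2"
  have e: "e > 0" and sub: "{-e..e} \<times> {a..b} \<subseteq> S" using \<epsilon> by (auto simp: e_def S_def)
  obtain M1 where M1: "M1 \<ge> 0"
    "\<And>s t. s \<in> {-e..e} \<Longrightarrow> t \<in> {a..b} \<Longrightarrow> norm (\<gamma> (s, t) - \<gamma> (0, t)) \<le> M1 * \<bar>s\<bar>"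
    by (rule Ck1_Lipschitz[OF Ck S sub]) blast
  obtain M2 where M2: "M2 \<ge> 0"
    "\<And>s t. s \<in> {-e..e} \<Longrightarrow> t \<in> {a..b} \<Longrightarrow> norm (v (s, t) - v (0, t)) \<le> M2 * \<bar>s\<bar>"
    by (rule Ck1_Lipschitz[OF Ckv S sub]) blast
  have inS: "(s, t) \<in> S" if "s \<in> {-e..e}" "t \<in> {a..b}" for s t using sub that by auto
  have \<gamma>c: "\<gamma> (0, t) = c t" if "t \<in> {a..b}" for t using \<gamma>0 that \<epsilon> by auto
  have v0: "v (0, t) = r *\<^sub>R I (c t)" if t: "t \<in> {a..b}" for t
  proof -
    have "((\<lambda>t. \<gamma> (0, t)) has_vector_derivative r *\<^sub>R I (c t)) (at t)"
      by (rule has_vector_derivative_transform_within_open[OF c(1), of "{a-\<epsilon><..<b+\<epsilon>}"])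
        (use t \<epsilon> \<gamma>0 in auto)
    from vector_derivative_unique_at[OF this dv[OF inS]] show ?thesis using e t by simp
  qed
  have tang: "inner (\<gamma> (s, t)) (v (s, t)) = 0" if s: "s \<in> {-e..e}" and t: "t \<in> {a..b}" for s t
  proof -
    have d: "((\<lambda>t. \<gamma> (s, t)) has_vector_derivative v (s, t)) (at t within cbox a b)"
      using dv[OF inS[OF s t]] by (rule has_vector_derivative_at_within)
    have "((\<lambda>t. inner (\<gamma> (s, t)) (\<gamma> (s, t))) has_vector_derivative 2 * inner (\<gamma> (s, t)) (v (s, t))) (at t within cbox a b)"
      using bounded_bilinear.has_vector_derivative[OF bounded_bilinear_inner d d] by (simp add: inner_commute)
    moreover have "((\<lambda>t. inner (\<gamma> (s, t)) (\<gamma> (s, t))) has_vector_derivative 0) (at t within cbox a b)"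
      by (rule has_vector_derivative_transform[OF _ _ has_vector_derivative_const[of 1]])
        (use t s sph \<epsilon> in \<open>auto simp: norm_eq_1[symmetric] e_def\<close>)
    ultimately have "2 * inner (\<gamma> (s, t)) (v (s, t)) = 0"
      using t by (intro vector_derivative_unique_within_closed_interval[OF ab]) auto
    then show ?thesis by simp
  qed
  \<comment> \<open>\<open>N\<close> controls \<open>v - r I \<gamma>\<close>, and on \<open>|s| \<le> e'\<close> the value of \<open>\<eta>\<close> stays within \<open>|r|/2\<close> of \<open>r\<close>\<close>
  define N where "N = M2 + \<bar>r\<bar> * M1"
  have N: "N \<ge> 0" using M1(1) M2(1) by (simp add: N_def)
  define e' where "e' = min e (\<bar>r\<bar> / (2 * N + 1))"
  have e': "e' > 0" using e r N by (simp add: e'_def)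
  define \<eta> where "\<eta> s t = inner (v (s, t)) (I (\<gamma> (s, t)))" for s t
  define \<delta> where "\<delta> s t = \<gamma> (s, t) - c t" for s t
  define g where "g s t = inner (\<delta> s t) (I (c t))" for s t
  define g' where "g' s t = inner (v (s, t) - r *\<^sub>R I (c t)) (I (c t)) - r * inner (\<delta> s t) (c t)" for s t
  define P where "P = \<bar>K\<bar> * (2 * N)\<^sup>2 + \<bar>D\<bar> * (\<bar>r\<bar> * M1\<^sup>2 + M2 * M1)"
  have pointwise: "\<bar>F (\<gamma> (s, t)) (v (s, t)) - D * r - D * g' s t\<bar> \<le> P * s\<^sup>2"
    if s: "\<bar>s\<bar> \<le> e'" and t: "t \<in> {a..b}" for s t
  proof -
    have se: "s \<in> {-e..e}" using s by (auto simp: e'_def)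
    have n\<gamma>: "norm (\<gamma> (s, t)) = 1" using sph[of s t] se t e by (auto simp: e_def)
    have n\<delta>: "norm (\<delta> s t) \<le> M1 * \<bar>s\<bar>" using M1(2)[OF se t] by (simp add: \<delta>_def \<gamma>c[OF t])
    have nv: "norm (v (s, t) - r *\<^sub>R I (c t)) \<le> M2 * \<bar>s\<bar>" using M2(2)[OF se t] by (simp add: v0[OF t])
    let ?w = "v (s, t) - r *\<^sub>R I (c t)"
    have w: "v (s, t) - r *\<^sub>R I (\<gamma> (s, t)) = ?w - r *\<^sub>R I (\<delta> s t)"
      by (simp add: \<delta>_def blinfun.diff_right algebra_simps)
    have nw: "norm (v (s, t) - r *\<^sub>R I (\<gamma> (s, t))) \<le> N * \<bar>s\<bar>"
    proof -
      have "norm (?w - r *\<^sub>R I (\<delta> s t)) \<le> norm ?w + \<bar>r\<bar> * norm (\<delta> s t)"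
        using norm_triangle_ineq4[of ?w "r *\<^sub>R I (\<delta> s t)"] by (simp add: nI)
      also have "\<dots> \<le> M2 * \<bar>s\<bar> + \<bar>r\<bar> * (M1 * \<bar>s\<bar>)"
        by (intro add_mono nv mult_left_mono n\<delta>) simp
      finally show ?thesis unfolding w by (simp add: N_def algebra_simps)
    qed
    have II1: "inner (I (\<gamma> (s, t))) (I (\<gamma> (s, t))) = 1" using nI[of "\<gamma> (s, t)"] n\<gamma> by (simp add: norm_eq_1[symmetric])
    have "\<eta> s t - r = inner (v (s, t) - r *\<^sub>R I (\<gamma> (s, t))) (I (\<gamma> (s, t)))"
      by (simp add: \<eta>_def inner_diff_left II1)
    then have \<eta>r: "\<bar>\<eta> s t - r\<bar> \<le> N * \<bar>s\<bar>"
      using Cauchy_Schwarz_ineq2[of "v (s, t) - r *\<^sub>R I (\<gamma> (s, t))" "I (\<gamma> (s, t))"] nw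
      by (simp add: nI n\<gamma>)
    have "N * \<bar>s\<bar> \<le> N * (\<bar>r\<bar> / (2 * N + 1))" by (intro mult_left_mono N) (use s in \<open>simp add: e'_def\<close>)
    also have "\<dots> \<le> \<bar>r\<bar> / 2" using N by (simp add: divide_simps mult.commute) (simp add: algebra_simps)
    finally have \<eta>r2: "\<bar>\<eta> s t - r\<bar> \<le> \<bar>r\<bar> / 2" using \<eta>r by simp
    have pos: "\<eta> s t * r \<ge> r\<^sup>2 / 2"
    proof -
      have "\<bar>(\<eta> s t - r) * r\<bar> \<le> \<bar>r\<bar> / 2 * \<bar>r\<bar>" unfolding abs_mult by (intro mult_right_mono \<eta>r2) simp
      then have "\<bar>(\<eta> s t - r) * r\<bar> \<le> r\<^sup>2 / 2" by (simp add: power2_eq_square)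
      moreover have "(\<eta> s t - r) * r = \<eta> s t * r - r\<^sup>2" by (simp add: algebra_simps power2_eq_square)
      ultimately show ?thesis by linarith
    qed
    have "\<bar>F (\<gamma> (s, t)) (v (s, t)) - D * \<eta> s t\<bar> \<le> K * (norm (v (s, t) - \<eta> s t *\<^sub>R I (\<gamma> (s, t))))\<^sup>2"
      unfolding \<eta>_def by (rule bound[OF n\<gamma> tang[OF se t]]) (use pos in \<open>simp add: \<eta>_def\<close>)
    also have "\<dots> \<le> \<bar>K\<bar> * (2 * N * \<bar>s\<bar>)\<^sup>2"
    proof (intro mult_mono power_mono)
      have "v (s, t) - \<eta> s t *\<^sub>R I (\<gamma> (s, t)) = (v (s, t) - r *\<^sub>R I (\<gamma> (s, t))) - (\<eta> s t - r) *\<^sub>R I (\<gamma> (s, t))"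
        by (simp add: algebra_simps)
      also have "norm \<dots> \<le> norm (v (s, t) - r *\<^sub>R I (\<gamma> (s, t))) + \<bar>\<eta> s t - r\<bar>"
        using norm_triangle_ineq4[of "v (s, t) - r *\<^sub>R I (\<gamma> (s, t))" "(\<eta> s t - r) *\<^sub>R I (\<gamma> (s, t))"]
        by (simp add: nI n\<gamma>)
      finally show "norm (v (s, t) - \<eta> s t *\<^sub>R I (\<gamma> (s, t))) \<le> 2 * N * \<bar>s\<bar>" using nw \<eta>r by simp
    qed auto
    finally have 1: "\<bar>F (\<gamma> (s, t)) (v (s, t)) - D * \<eta> s t\<bar> \<le> \<bar>K\<bar> * (2 * N)\<^sup>2 * s\<^sup>2"
      by (simp add: power_mult_distrib)
    have \<gamma>\<delta>: "\<gamma> (s, t) = c t + \<delta> s t" by (simp add: \<delta>_def)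
    have cc: "inner (c t) (c t) = 1" using c(2) by (simp add: norm_eq_1[symmetric])
    have "inner (\<gamma> (s, t)) (\<gamma> (s, t)) = 1" using n\<gamma> by (simp add: norm_eq_1[symmetric])
    then have c\<delta>: "2 * inner (c t) (\<delta> s t) = - (norm (\<delta> s t))\<^sup>2"
      unfolding \<gamma>\<delta> by (simp add: inner_add_left inner_add_right cc inner_commute power2_norm_eq_inner)
    have vw: "v (s, t) = r *\<^sub>R I (c t) + ?w" by simp
    have "\<eta> s t - r - g' s t = inner (r *\<^sub>R I (c t) + ?w) (I (c t) + I (\<delta> s t)) - r - g' s t"
      unfolding \<eta>_def by (subst vw) (simp add: \<gamma>\<delta> blinfun.add_right)
    also have "\<dots> = r * (2 * inner (c t) (\<delta> s t)) + inner ?w (I (\<delta> s t))"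
      by (simp only: g'_def inner_add_left inner_add_right inner_scaleR_left I)
        (simp add: I cc inner_commute algebra_simps)
    finally have "\<eta> s t - r - g' s t = - r * (norm (\<delta> s t))\<^sup>2 + inner ?w (I (\<delta> s t))"
      by (simp add: c\<delta>)
    also have "\<bar>\<dots>\<bar> \<le> \<bar>r\<bar> * (norm (\<delta> s t))\<^sup>2 + norm ?w * norm (\<delta> s t)"
      using Cauchy_Schwarz_ineq2[of ?w "I (\<delta> s t)"] 
      by (intro order_trans[OF abs_triangle_ineq] add_mono) (simp_all add: abs_mult nI)
    also have "\<dots> \<le> \<bar>r\<bar> * (M1 * \<bar>s\<bar>)\<^sup>2 + (M2 * \<bar>s\<bar>) * (M1 * \<bar>s\<bar>)"
      using M1(1) M2(1) by (intro add_mono mult_left_mono mult_mono power_mono n\<delta> nv) auto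
    also have "\<dots> = (\<bar>r\<bar> * M1\<^sup>2 + M2 * M1) * s\<^sup>2"
      by (simp add: power_mult_distrib algebra_simps power2_eq_square) 
    finally have 2: "\<bar>\<eta> s t - r - g' s t\<bar> \<le> (\<bar>r\<bar> * M1\<^sup>2 + M2 * M1) * s\<^sup>2" .
    have "F (\<gamma> (s, t)) (v (s, t)) - D * r - D * g' s t
       = (F (\<gamma> (s, t)) (v (s, t)) - D * \<eta> s t) + D * (\<eta> s t - r - g' s t)"
      by (simp add: algebra_simps)
    also have "\<bar>\<dots>\<bar> \<le> \<bar>K\<bar> * (2 * N)\<^sup>2 * s\<^sup>2 + \<bar>D\<bar> * ((\<bar>r\<bar> * M1\<^sup>2 + M2 * M1) * s\<^sup>2)"
      using mult_left_mono[OF 2, of "\<bar>D\<bar>"] 1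
      by (intro order_trans[OF abs_triangle_ineq] add_mono) (simp_all add: abs_mult)
    finally show ?thesis by (simp add: P_def algebra_simps)
  qed
  have len: "\<bar>finsler_length F a b (\<lambda>t. \<gamma> (s, t)) - D * r * (b - a)\<bar> \<le> (P * (b - a)) * s\<^sup>2"
    if s: "\<bar>s\<bar> \<le> e'" for s
  proof -
    have se: "s \<in> {-e..e}" using s by (auto simp: e'_def)
    have pair: "continuous_on {a..b} (\<lambda>t. (s, t))" by (intro continuous_intros)
    have cont\<gamma>: "continuous_on {a..b} (\<lambda>t. \<gamma> (s, t))"
      by (rule continuous_on_compose2[OF _ pair, of S \<gamma>]) (use Ck[of 0] inS[OF se] in auto)
    have contv: "continuous_on {a..b} (\<lambda>t. v (s, t))"
      by (rule continuous_on_compose2[OF _ pair, of S v]) (use Ckv[of 0] inS[OF se] in auto)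
    have "bounded ((\<lambda>t. v (s, t)) ` {a..b})"
      by (intro compact_imp_bounded compact_continuous_image contv) auto
    then obtain R where R: "\<And>t. t \<in> {a..b} \<Longrightarrow> norm (v (s, t)) \<le> R" unfolding bounded_iff by blast
    have n\<gamma>: "norm (\<gamma> (s, t)) = 1" if "t \<in> {a..b}" for t using sph[of s t] se that e by (auto simp: e_def)
    have contFv: "continuous_on {a..b} (\<lambda>t. F (\<gamma> (s, t)) (v (s, t)))"
    proof -
      have "(\<lambda>t. (\<gamma> (s, t), v (s, t))) ` {a..b} \<subseteq> {(x, v). norm x = 1 \<and> inner x v = 0 \<and> norm v \<le> R}"
        using n\<gamma> R tang[OF se] by (auto simp del: atLeastAtMost_iff)
      from continuous_on_compose2[OF contF[of R] continuous_on_Pair[OF cont\<gamma> contv] this]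
      show ?thesis by simp
    qed
    have contc: "continuous_on {a..b} c"
      by (intro continuous_at_imp_continuous_on ballI has_vector_derivative_continuous[OF c(1)])
    have contg': "continuous_on {a..b} (g' s)"
      unfolding g'_def[abs_def] \<delta>_def
      by (intro continuous_intros contv cont\<gamma> contc bounded_linear.continuous_on[OF blinfun.bounded_linear_right])
    have dg: "(g s has_vector_derivative g' s t) (at t within {a..b})" if t: "t \<in> {a..b}" for t
    proof -
      have 1: "(\<delta> s has_vector_derivative v (s, t) - r *\<^sub>R I (c t)) (at t)"
        unfolding \<delta>_def[abs_def] by (intro has_vector_derivative_diff dv inS[OF se t] c(1))
      have 2: "((\<lambda>t. I (c t)) has_vector_derivative I (r *\<^sub>R I (c t))) (at t)"
        by (intro bounded_linear.has_vector_derivative[OF blinfun.bounded_linear_right] c(1))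
      have "g' s t = inner (\<delta> s t) (I (r *\<^sub>R I (c t)))
           + inner (v (s, t) - r *\<^sub>R I (c t)) (I (c t))"
        unfolding g'_def blinfun.scaleR_right I(2) by simp
      then show ?thesis
        unfolding g_def[abs_def]
        using has_vector_derivative_at_within[OF
            bounded_bilinear.has_vector_derivative[OF bounded_bilinear_inner 1 2]] by simp
    qed
    have "(g' s has_integral (g s b - g s a)) {a..b}"
      using ab by (intro fundamental_theorem_of_calculus dg) auto
    moreover have "g s b = 0" "g s a = 0" using \<gamma>ab[of s] se e by (auto simp: g_def \<delta>_def e_def)
    ultimately have intg': "integral {a..b} (g' s) = 0" by (simp add: integral_unique)
    have "integral {a..b} (\<lambda>t. F (\<gamma> (s, t)) (v (s, t)) - D * r - D * g' s t)
       = integral {a..b} (\<lambda>t. F (\<gamma> (s, t)) (v (s, t)) - D * r) - integral {a..b} (\<lambda>t. D * g' s t)"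
      by (intro integral_diff integrable_continuous_real continuous_intros contFv contg')
    also have "integral {a..b} (\<lambda>t. F (\<gamma> (s, t)) (v (s, t)) - D * r)
       = integral {a..b} (\<lambda>t. F (\<gamma> (s, t)) (v (s, t))) - integral {a..b} (\<lambda>t. D * r)"
      by (intro integral_diff integrable_continuous_real continuous_intros contFv)
    also have "integral {a..b} (\<lambda>t. F (\<gamma> (s, t)) (v (s, t))) = finsler_length F a b (\<lambda>t. \<gamma> (s, t))"
      unfolding finsler_length_def
      by (rule integral_cong) (use vector_derivative_at[OF dv[OF inS[OF se]]] in simp)
    finally have eq: "integral {a..b} (\<lambda>t. F (\<gamma> (s, t)) (v (s, t)) - D * r - D * g' s t)
       = finsler_length F a b (\<lambda>t. \<gamma> (s, t)) - D * r * (b - a)"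
      using ab by (simp add: intg' mult.commute)
    have "norm (integral {a..b} (\<lambda>t. F (\<gamma> (s, t)) (v (s, t)) - D * r - D * g' s t))
       \<le> integral {a..b} (\<lambda>t. P * s\<^sup>2)"
      by (rule integral_norm_bound_integral)
        (use pointwise[OF s] in \<open>auto intro!: integrable_continuous_real continuous_intros contFv contg'\<close>)
    then show ?thesis using ab unfolding eq by (simp add: algebra_simps)
  qed
  show ?thesis by (rule has_derivative_zero_of_square_bound[OF e' len])
qed

section \<open>Fixed vectors generate equigeodesics\<close>

lemma sqrt_second_order:
  fixes y k :: real
  assumes "y > 0" "k \<ge> 0"
  shows "\<bar>sqrt (y\<^sup>2 + k) - y\<bar> \<le> k / (2 * y)"
proof -
  have "sqrt (y\<^sup>2 + k) \<ge> y" using assms by (intro real_le_rsqrt) simp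
  moreover have "y\<^sup>2 + k \<le> (y + k / (2 * y))\<^sup>2"
    using assms by (simp add: power2_sum)
  then have "sqrt (y\<^sup>2 + k) \<le> y + k / (2 * y)" using assms by (intro real_le_lsqrt) auto
  ultimately show ?thesis by simp
qed

lemma (in isometry_group) compact_group: "compact G"
proof -
  have "norm g \<le> 1" if "g \<in> G" for g
    by (rule norm_blinfun_bound) (simp_all add: isometry[OF that])
  then have "bounded G" by (auto simp: bounded_iff)
  then show ?thesis using closed_group by (simp add: compact_eq_bounded_closed)
qed

context sphere_action
begin

text \<open>
  The tangent vectors of length at most \<open>R\<close> are the continuous image of a compact set under
  \<open>(g, w) \<mapsto> (g p, g w)\<close>, where \<open>w\<close> is tangent at \<open>p\<close>, and \<open>F\<close> becomes \<open>F p w\<close> there. So the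
  preimages of closed sets under \<open>F\<close> are images of compact sets. The length of a curve is an integral of
  \<open>F\<close>, and this lemma makes it meaningful.
\<close>

lemma continuous_on_invariant_function:
  assumes F: "invariant_function F" and cont: "continuous_on {v. inner p v = 0} (F p)"
  shows "continuous_on {(x, v). norm x = 1 \<and> inner x v = 0 \<and> norm v \<le> R} (\<lambda>(x, v). F x v)"
proof -
  let ?T = "{(x :: 'a, v). norm x = 1 \<and> inner x v = 0 \<and> norm v \<le> R}"
  let ?W = "{v. inner p v = 0} \<inter> cball 0 R"
  let ?\<Phi> = "\<lambda>(g, w). (blinfun_apply g p, blinfun_apply g w)"
  have cl: "closed {v. inner p v = 0}" by (simp add: closed_hyperplane)
  have img: "{z \<in> ?T. (\<lambda>(x, v). F x v) z \<in> C} = ?\<Phi> ` (G \<times> {w \<in> ?W. F p w \<in> C})" for C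
  proof (intro equalityI subsetI)
    fix z assume "z \<in> {z \<in> ?T. (\<lambda>(x, v). F x v) z \<in> C}"
    then obtain x v where z: "z = (x, v)" "norm x = 1" "inner x v = 0" "norm v \<le> R" "F x v \<in> C" by auto
    obtain g where g: "g \<in> G" "g p = x" using transitive[OF z(2)] by blast
    let ?w = "ginv g v"
    have gw: "g ?w = v" by (rule ginv_right[OF g(1)])
    have pw: "inner p ?w = 0" using inner_ginv[OF g(1), of p v] g(2) z(3) by simp
    have "norm ?w \<le> R" using isometry[OF g(1), of ?w] z(4) by (simp add: gw)
    moreover have "F p ?w \<in> C" using invariant_functionD[OF F g(1) pw] z(5) by (simp add: g gw)
    ultimately show "z \<in> ?\<Phi> ` (G \<times> {w \<in> ?W. F p w \<in> C})"
      using g gw pw z(1) by (intro image_eqI[of _ _ "(g, ?w)"]) auto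
  next
    fix z assume "z \<in> ?\<Phi> ` (G \<times> {w \<in> ?W. F p w \<in> C})"
    then obtain g w where gw: "g \<in> G" "inner p w = 0" "norm w \<le> R" "F p w \<in> C" "z = (g p, g w)" by auto
    then show "z \<in> {z \<in> ?T. (\<lambda>(x, v). F x v) z \<in> C}"
      using invariant_functionD[OF F gw(1,2)] isometry[OF gw(1)] inner_isometry[OF gw(1), of p w] norm_p
      by auto
  qed
  have cont\<Phi>: "continuous_on S ?\<Phi>" for S
    unfolding case_prod_beta
    by (intro continuous_on_Pair bounded_bilinear.continuous_on[OF bounded_bilinear_blinfun_apply]
        continuous_on_fst continuous_on_snd continuous_on_id continuous_on_const)
  have preim: "compact {z \<in> ?T. (\<lambda>(x, v). F x v) z \<in> C}" if C: "closed C" for C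
  proof -
    have "closed (F p -` C \<inter> {v. inner p v = 0})"
      using cont C continuous_on_closed_vimage[OF cl] by blast
    then have "compact ((F p -` C \<inter> {v. inner p v = 0}) \<inter> cball 0 R)"
      by (rule closed_Int_compact) simp
    also have "(F p -` C \<inter> {v. inner p v = 0}) \<inter> cball 0 R = {w \<in> ?W. F p w \<in> C}" by auto
    finally show ?thesis
      unfolding img by (intro compact_continuous_image cont\<Phi> compact_Times compact_group)
  qed
  have "closed ?T" using compact_imp_closed[OF preim[of UNIV]] by simp
  then show ?thesis
  proof (subst continuous_on_closed_vimage, assumption, intro allI impI)
    fix C :: "real set" assume "closed C"
    from compact_imp_closed[OF preim[OF this]]
    show "closed ((\<lambda>(x, v). F x v) -` C \<inter> ?T)" by (simp add: vimage_def Int_def conj_commute)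
  qed
qed

text \<open>
  As an \<open>H\<close>-invariant functional, \<open>Q (I p)\<close> is a multiple of \<open>\<eta>(v) = \<langle>v, I p\<rangle>\<close>; so for
  \<open>v = \<eta> I p + v'\<close> with \<open>v'\<close> orthogonal to \<open>I p\<close> one has
  \<open>F p v = sqrt (\<mu> \<eta>\<^sup>2 + Q v' v') + \<sigma> \<mu> \<eta>\<close>, which differs from a multiple of \<open>\<eta>\<close> by \<open>O(|v'|\<^sup>2)\<close>
  as long as \<open>\<eta>\<close> keeps its sign. The speed is positive because \<open>w = \<sigma> I p\<close> has \<open>Q\<close>-norm below \<open>1\<close>.
\<close>

lemma randers_orbit_geodesic:
  assumes I: "equivariant_structure I"
    and line: "\<And>v. inner p v = 0 \<Longrightarrow> \<forall>h\<in>isotropy G p. h v = v \<Longrightarrow> \<exists>r. v = r *\<^sub>R I p"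
    and X: "X \<in> lie_algebra G" "X p = r *\<^sub>R I p" "r \<noteq> 0"
    and F: "invariant_function F" and Q: "invariant_form Q"
    and w: "inner p w = 0" "Q w w < 1" "\<forall>h\<in>isotropy G p. h w = w"
    and Fp: "\<And>v. inner p v = 0 \<Longrightarrow> F p v = sqrt (Q v v) + Q v w"
  shows "finsler_geodesic F (\<lambda>t. one_param X t p)"
proof -
  have Ig: "I (g x) = g (I x)" if "g \<in> G" for g x using I that by (simp add: equivariant_structure_def)
  have skewI: "inner (I x) y = - inner x (I y)" and II: "I (I x) = - x" for x y
    using I by (auto simp: equivariant_structure_def)
  have nIp: "inner (I p) (I p) = 1" by (simp add: skewI II inner_pp)
  have pIp: "inner p (I p) = 0" by (rule structure_orth[OF I])
  have Qbil: "bilinear Q" and Qsym: "Q v v' = Q v' v"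
    and Qpos: "inner p v = 0 \<Longrightarrow> v \<noteq> 0 \<Longrightarrow> Q v v > 0"
    and Qinv: "h \<in> isotropy G p \<Longrightarrow> inner p v = 0 \<Longrightarrow> inner p v' = 0 \<Longrightarrow> Q (h v) (h v') = Q v v'" for h v v'
    using Q by (auto simp: invariant_form_def)
  have Qb: "bounded_bilinear Q" using Qbil by (simp add: bilinear_conv_bounded_bilinear)
  \<comment> \<open>\<open>I p\<close> and its orthogonal complement in the tangent space are \<open>Q\<close>-orthogonal\<close>
  have linQ: "linear (Q (I p))" using Qbil by (simp add: bilinear_def)
  have "Q (I p) (h v) = Q (I p) v" if "h \<in> isotropy G p" "inner p v = 0" for h v
    using Qinv[OF that(1) pIp that(2)] Ig[OF isotropyD(1)[OF that(1)], of p] isotropyD(2)[OF that(1)] by simp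
  from invariant_functional[OF linQ this] obtain \<zeta> where \<zeta>: "inner p \<zeta> = 0" "\<forall>h\<in>isotropy G p. h \<zeta> = \<zeta>"
    "\<forall>v. inner p v = 0 \<longrightarrow> Q (I p) v = inner v \<zeta>" by blast
  obtain \<mu> where \<mu>: "\<zeta> = \<mu> *\<^sub>R I p" using line[OF \<zeta>(1,2)] by blast
  have QIp: "Q (I p) v = \<mu> * inner v (I p)" if "inner p v = 0" for v using \<zeta>(3) that by (simp add: \<mu>)
  have "I p \<noteq> 0" using nIp by auto
  then have \<mu>0: "\<mu> > 0" using Qpos[OF pIp] QIp[OF pIp] by (simp add: nIp)
  obtain \<sigma> where \<sigma>: "w = \<sigma> *\<^sub>R I p" using line[OF w(1) w(3)] by blast
  have Qw: "Q v w = \<sigma> * \<mu> * inner v (I p)" if "inner p v = 0" for v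
    using QIp[OF that] bilinear_rmul[OF Qbil, of v \<sigma> "I p"] Qsym[of v "I p"] by (simp add: \<sigma>)
  define a where "a = sqrt \<mu>"
  have a: "a > 0" "a\<^sup>2 = \<mu>" using \<mu>0 by (simp_all add: a_def)
  have "Q w w = (\<sigma> * a)\<^sup>2" using Qw[OF w(1)] by (simp add: \<sigma> nIp power_mult_distrib a(2) power2_eq_square[of \<sigma>])
  then have \<sigma>a: "\<bar>\<sigma> * a\<bar> < 1" using w(2) by (simp add: abs_square_less_1)
  have Fform: "F p v = sqrt (Q v v) + \<sigma> * \<mu> * inner v (I p)" if "inner p v = 0" for v
    using Fp[OF that] Qw[OF that] by simp
  obtain C where C: "C > 0" "\<And>v v'. norm (Q v v') \<le> norm v * norm v' * C"
    using bounded_bilinear.pos_bounded[OF Qb] by blast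
  define K where "K = C / (a * \<bar>r\<bar>)"
  define D where "D = a * sgn r + \<sigma> * \<mu>"
  have bound_p: "\<bar>F p v - D * inner v (I p)\<bar> \<le> K * (norm (v - inner v (I p) *\<^sub>R I p))\<^sup>2"
    if v: "inner p v = 0" and pos: "inner v (I p) * r \<ge> r\<^sup>2 / 2" for v
  proof -
    define \<eta> where "\<eta> = inner v (I p)"
    define v' where "v' = v - \<eta> *\<^sub>R I p"
    have v'p: "inner p v' = 0" using v pIp by (simp add: v'_def inner_diff_right)
    have v'I: "inner v' (I p) = 0" by (simp add: v'_def inner_diff_left nIp \<eta>_def)
    have vv: "v = \<eta> *\<^sub>R I p + v'" by (simp add: v'_def)
    have Qv: "Q v v = (a * \<bar>\<eta>\<bar>)\<^sup>2 + Q v' v'"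
      unfolding vv
      using QIp[OF v'p] QIp[OF pIp] Qsym[of v' "I p"]
      by (simp add: bilinear_ladd[OF Qbil] bilinear_radd[OF Qbil] bilinear_lmul[OF Qbil] bilinear_rmul[OF Qbil]
          v'I nIp power_mult_distrib a(2) power2_eq_square[of \<eta>])
    have Qv': "0 \<le> Q v' v'" "Q v' v' \<le> C * (norm v')\<^sup>2"
      using Qpos[OF v'p] bilinear_lzero[OF Qbil, of 0] C(2)[of v' v']
      by (cases "v' = 0", auto simp: power2_eq_square mult.commute)
    have r2: "r\<^sup>2 = \<bar>r\<bar> * \<bar>r\<bar>" by (simp add: power2_eq_square)
    have "\<bar>\<eta>\<bar> * \<bar>r\<bar> \<ge> \<bar>r\<bar> / 2 * \<bar>r\<bar>"
      using pos unfolding abs_mult[symmetric] \<eta>_def[symmetric] r2 by simp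
    then have \<eta>2: "\<bar>\<eta>\<bar> \<ge> \<bar>r\<bar> / 2" by (rule mult_right_le_imp_le) (use X(3) in simp)
    have "\<eta> * r > 0" using pos X(3) unfolding \<eta>_def by (smt (verit) half_gt_zero zero_less_power2)
    then have \<eta>s: "\<bar>\<eta>\<bar> = sgn r * \<eta>" by (auto simp: zero_less_mult_iff)
    have y: "a * \<bar>\<eta>\<bar> > 0" using a \<eta>2 X(3) by (intro mult_pos_pos) auto
    have "\<bar>F p v - D * \<eta>\<bar> = \<bar>sqrt ((a * \<bar>\<eta>\<bar>)\<^sup>2 + Q v' v') - a * \<bar>\<eta>\<bar>\<bar>"
      using Fform[OF v] unfolding Qv \<eta>_def[symmetric] by (simp add: D_def \<eta>s algebra_simps)
    also have "\<dots> \<le> Q v' v' / (2 * (a * \<bar>\<eta>\<bar>))" by (rule sqrt_second_order[OF y Qv'(1)])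
    also have "\<dots> \<le> (C * (norm v')\<^sup>2) / (a * \<bar>r\<bar>)"
      using Qv' a X(3) \<eta>2 C(1) by (intro frac_le) auto
    finally show ?thesis by (simp add: K_def v'_def \<eta>_def)
  qed
  have bound: "\<bar>F x v - D * inner v (I x)\<bar> \<le> K * (norm (v - inner v (I x) *\<^sub>R I x))\<^sup>2"
    if x: "norm x = 1" and v: "inner x v = 0" and pos: "inner v (I x) * r \<ge> r\<^sup>2 / 2" for x v
  proof -
    obtain g where g: "g \<in> G" "g p = x" using transitive[OF x] by blast
    let ?v = "ginv g v"
    have gv: "g ?v = v" by (rule ginv_right[OF g(1)])
    have pv: "inner p ?v = 0" using inner_ginv[OF g(1), of p v] g(2) v by simp
    have \<eta>: "inner v (I x) = inner ?v (I p)"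
      using inner_isometry[OF g(1), of ?v "I p"] Ig[OF g(1), of p] by (simp add: gv g(2))
    have "v - inner v (I x) *\<^sub>R I x = g (?v - inner ?v (I p) *\<^sub>R I p)"
      unfolding \<eta> by (simp add: blinfun.diff_right blinfun.scaleR_right gv Ig[OF g(1), symmetric] g(2))
    then have n: "norm (v - inner v (I x) *\<^sub>R I x) = norm (?v - inner ?v (I p) *\<^sub>R I p)"
      by (simp add: isometry[OF g(1)])
    have "F x v = F p ?v" using invariant_functionD[OF F g(1) pv] by (simp add: g(2) gv)
    then show ?thesis using bound_p[OF pv] pos unfolding \<eta> n[unfolded \<eta>] by simp
  qed
  have contF: "continuous_on {(x, v). norm x = 1 \<and> inner x v = 0 \<and> norm v \<le> R} (\<lambda>(x, v). F x v)" for R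
  proof (rule continuous_on_invariant_function[OF F])
    have "continuous_on {v. inner p v = 0} (\<lambda>v. sqrt (Q v v) + Q v w)"
      by (intro continuous_intros bounded_bilinear.continuous_on[OF Qb])
    then show "continuous_on {v. inner p v = 0} (F p)"
      by (rule continuous_on_eq) (simp add: Fp)
  qed
  define c where "c t = one_param X t p" for t
  have XG: "one_param X t \<in> G" for t by (rule one_param_mem[OF X(1)])
  have Xc: "X (c t) = one_param X t (r *\<^sub>R I p)" for t
    using arg_cong[OF one_param_commute_self[of X t], of "\<lambda>f. blinfun_apply f p"] by (simp add: c_def X(2))
  have Ic: "X (c t) = r *\<^sub>R I (c t)" for t
    unfolding Xc by (simp add: c_def blinfun.scaleR_right Ig[OF XG])
  have dc: "(c has_vector_derivative r *\<^sub>R I (c t)) (at t)" for t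
    using one_param_apply_has_vector_derivative[of X p t UNIV]
    unfolding c_def[symmetric] Ic[symmetric] by (simp add: c_def[abs_def])
  have nc: "norm (c t) = 1" for t using isometry[OF XG] norm_p by (simp add: c_def)
  have "inner p (r *\<^sub>R I p) = 0" by (simp add: pIp)
  have speed: "F (c t) (vector_derivative c (at t)) = F p (r *\<^sub>R I p)" for t
    using invariant_functionD[OF F XG[of t], of "r *\<^sub>R I p"] pIp
    by (simp add: vector_derivative_at[OF dc] Ic[symmetric] Xc) (simp add: c_def)
  have "Q (r *\<^sub>R I p) (r *\<^sub>R I p) = (a * \<bar>r\<bar>)\<^sup>2"
    using QIp[OF pIp] by (simp add: bilinear_lmul[OF Qbil] bilinear_rmul[OF Qbil] nIp power_mult_distrib a(2)
        power2_eq_square[of r])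
  then have "F p (r *\<^sub>R I p) = a * \<bar>r\<bar> + (\<sigma> * a) * (a * r)"
    using Fform[of "r *\<^sub>R I p"] a(1) pIp by (simp add: nIp a(2)[symmetric] power2_eq_square)
  moreover have "\<bar>(\<sigma> * a) * (a * r)\<bar> < a * \<bar>r\<bar>"
    using mult_strict_right_mono[OF \<sigma>a, of "a * \<bar>r\<bar>"] a(1) X(3) by (simp add: abs_mult)
  ultimately have pos: "F p (r *\<^sub>R I p) > 0" by linarith
  have "finsler_geodesic F c"
    unfolding finsler_geodesic_def
  proof (intro conjI allI impI)
    show "smooth_on UNIV c" unfolding c_def[abs_def] by (rule smooth_on_one_param)
    show "c t \<in> sphere 0 1" for t using nc by simp
    show "\<exists>l>0. \<forall>t. F (c t) (vector_derivative c (at t)) = l" using speed pos by blast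
    show "((\<lambda>s. finsler_length F a b (\<lambda>t. \<gamma> (s, t))) has_real_derivative 0) (at 0)"
      if "a < b \<and> proper_variation c a b \<gamma>" for a b \<gamma>
      using that by (intro first_variation_zero[OF skewI II dc nc X(3) bound contF]) auto
  qed
  then show ?thesis by (simp add: c_def[abs_def])
qed

end

context reductive_sphere
begin

lemma fixed_vector_equigeodesic:
  assumes I: "equivariant_structure I"
    and line: "\<And>v. inner p v = 0 \<Longrightarrow> \<forall>h\<in>isotropy G p. h v = v \<Longrightarrow> \<exists>r. v = r *\<^sub>R I p"
    and X: "X \<in> \<mm>\<^sub>0" "X \<noteq> 0"
  shows "randers_equigeodesic_vector G p B X"
proof -
  have Xm: "X \<in> \<mm>" and Xg: "X \<in> \<gg>" using X(1) fixed_complD \<mm>_lie by auto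
  have Xp0: "X p \<noteq> 0"
    using \<mm>_inj[OF Xm subspace_0[OF \<mm>_subspace]] X(2) by auto
  obtain r where r: "X p = r *\<^sub>R I p"
    using line[OF orth_lie[OF Xg]] X(1) by (auto simp: fixed_compl_iff)
  then have r0: "r \<noteq> 0" using Xp0 by auto
  show ?thesis
    unfolding randers_equigeodesic_vector_def randers_equigeodesic_def homogeneous_geodesic_def
  proof (intro conjI allI impI)
    show "X \<in> \<gg>" by (rule Xg)
    show "X \<notin> \<hh>" using Xp0 by (simp add: lie_isotropy_iff)
    show "smooth_on UNIV (\<lambda>t. one_param X t p)" by (rule smooth_on_one_param)
    show "one_param X t p \<in> sphere 0 1" for t
      using isometry[OF one_param_mem[OF Xg], of t p] norm_p by simp
    show "\<exists>X'\<in>\<gg>. \<exists>q\<in>sphere 0 1. \<forall>t. one_param X t p = one_param X' t q"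
      using Xg norm_p by (intro bexI[of _ X] bexI[of _ p]) auto
    fix F assume "invariant_randers_metric G p B F"
    then obtain Q w where "invariant_function F" "invariant_form Q"
      "inner p w = 0" "Q w w < 1" "\<forall>h\<in>isotropy G p. h w = w"
      "\<And>v. inner p v = 0 \<Longrightarrow> F p v = sqrt (Q v v) + Q v w"
      by (rule invariant_randers_metricD) blast
    then show "finsler_geodesic F (\<lambda>t. one_param X t p)"
      by (intro randers_orbit_geodesic[OF I line Xg r r0])
  qed
qed

theorem equigeodesic_vectors_eq_fixed:
  assumes I: "equivariant_structure I"
    and line: "\<And>v. inner p v = 0 \<Longrightarrow> \<forall>h\<in>isotropy G p. h v = v \<Longrightarrow> \<exists>r. v = r *\<^sub>R I p"
    and ne: "\<mm>\<^sub>0 \<noteq> {0}"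
  shows "{X \<in> \<mm>. randers_equigeodesic_vector G p B X} = \<mm>\<^sub>0 - {0}"
proof (intro equalityI subsetI)
  have "0 \<in> \<mm>\<^sub>0" by (simp add: fixed_compl_iff subspace_0[OF \<mm>_subspace])
  then obtain u where u: "u \<in> \<mm>\<^sub>0" "u \<noteq> 0" using ne by auto
  fix X assume X: "X \<in> {X \<in> \<mm>. randers_equigeodesic_vector G p B X}"
  then have "X \<in> \<mm>\<^sub>0" using equigeodesic_vector_fixed[OF I line u, of X] by auto
  moreover have "X \<noteq> 0" using X H.zero_lie by (auto simp: randers_equigeodesic_vector_def)
  ultimately show "X \<in> \<mm>\<^sub>0 - {0}" by simp
next
  fix X assume "X \<in> \<mm>\<^sub>0 - {0}"
  then show "X \<in> {X \<in> \<mm>. randers_equigeodesic_vector G p B X}"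
    using fixed_vector_equigeodesic[OF I line, of X] fixed_complD(1) by auto
qed

end

section \<open>Moving fixed vectors by the normaliser of the isotropy group\<close>

context reductive_sphere
begin

text \<open>
  If \<open>g\<^sub>0 p = C p\<close> for an isometry \<open>C\<close> commuting with the group, then \<open>g\<^sub>0\<close> normalises the
  isotropy group of \<open>p\<close>, so that \<open>Ad g\<^sub>0\<close> permutes the fixed vectors. The action on covectors is
  \<open>C\<^sup>-\<^sup>1 g\<^sub>0\<close>, which for diagonal matrices over the quaternions is conjugation by a unit
  quaternion and produces new directions.
\<close>

lemma covector_Ad:
  fixes C C' :: "'a op"
  assumes C: "\<And>g x. g \<in> G \<Longrightarrow> C (g x) = g (C x)" and C': "\<And>g x. g \<in> G \<Longrightarrow> C' (g x) = g (C' x)"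
    and inv: "\<And>x. C' (C x) = x" and adj: "\<And>x y. inner (C x) y = inner x (C' y)"
    and g0: "g0 \<in> G" "g0 p = C p" and u: "u \<in> \<mm>\<^sub>0" "u \<noteq> 0" "covector u \<xi>"
  shows "Ad g0 u \<in> \<mm>\<^sub>0" "Ad g0 u \<noteq> 0" "covector (Ad g0 u) (C' (g0 \<xi>))"
proof -
  have um: "u \<in> \<mm>" "u \<in> \<gg>" using u fixed_complD \<mm>_lie by auto
  have g0': "ginv g0 \<in> G" using g0(1) by blast
  have Au: "Ad g0 u \<in> \<gg>" by (rule Ad_lie[OF g0(1) um(2)])
  have gp: "ginv g0 p = C' p"
    by (rule group_inj[OF g0(1)]) (simp add: ginv_right g0 C'[OF g0(1), symmetric] inv)
  \<comment> \<open>\<open>g\<^sub>0\<inverse> h g\<^sub>0\<close> is again in the isotropy group\<close>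
  have norm_fixed: "h (g0 v) = g0 v"
    if h: "h \<in> isotropy G p" and v: "\<forall>k\<in>isotropy G p. k v = v" for h v
  proof -
    let ?k = "ginv g0 o\<^sub>L (h o\<^sub>L g0)"
    have hG: "h \<in> G" "h p = p" using isotropyD[OF h] by auto
    have "h (g0 p) = g0 p" using C[OF hG(1), of p] by (simp add: g0(2) hG(2))
    then have "?k \<in> isotropy G p"
      using g0(1) hG by (auto simp: isotropy_def ginv_left intro!: compose_mem)
    then have "?k v = v" using v by blast
    then have "g0 (ginv g0 (h (g0 v))) = g0 v" by simp
    then show ?thesis by (simp add: ginv_right g0(1))
  qed
  have BZ: "B Z (Ad g0 u) = inner (blinfun_apply Z p) (C' (g0 \<xi>))" if Z: "Z \<in> \<gg>" for Z
  proof -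
    have Z': "Ad (ginv g0) Z \<in> \<gg>" by (rule Ad_lie[OF g0' Z])
    have gg: "ginv (ginv g0) x = g0 x" for x
      by (rule group_inj[OF g0']) (simp add: ginv_right g0' ginv_left g0)
    have "B Z (Ad g0 u) = B (Ad g0 (Ad (ginv g0) Z)) (Ad g0 u)" by (simp add: Ad_ginv g0(1))
    also have "\<dots> = B (Ad (ginv g0) Z) u" by (rule B_Ad[OF g0(1) Z' um(2)])
    also have "\<dots> = inner (Ad (ginv g0) Z p) \<xi>" using u(3) Z' by (simp add: covector_def)
    also have "Ad (ginv g0) Z p = ginv g0 (C (Z p))"
      by (simp add: Ad_apply g0' gg g0(2) commutant_lie[OF C Z])
    also have "inner (ginv g0 (C (Z p))) \<xi> = inner (C (Z p)) (g0 \<xi>)"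
      using inner_ginv[OF g0(1), of \<xi> "C (Z p)"] by (simp add: inner_commute)
    finally show ?thesis by (simp add: adj)
  qed
  have Am: "Ad g0 u \<in> \<mm>"
    using Au BZ B_rules(1)[OF Au] by (auto simp: reductive_compl_def lie_isotropy_iff)
  have Cfix: "h (C' (g0 v)) = C' (g0 v)"
    if h: "h \<in> isotropy G p" and v: "\<forall>k\<in>isotropy G p. k v = v" for h v
    using C'[OF isotropyD(1)[OF h], of "g0 v"] norm_fixed[OF h v] by simp
  have "Ad g0 u p = C' (g0 (u p))"
    by (simp add: Ad_apply g0(1) gp commutant_lie[OF C' um(2), symmetric] C'[OF g0(1)])
  then show "Ad g0 u \<in> \<mm>\<^sub>0"
    using Am Cfix[of _ "u p"] u(1) by (simp add: fixed_compl_iff)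
  show "Ad g0 u \<noteq> 0"
    using u(2) Ad_ginv(2)[OF g0(1), of u] by (auto simp: Ad_eq[OF g0'])
  have "inner p (C' (g0 \<xi>)) = inner (g0 p) (g0 \<xi>)" by (simp add: adj[symmetric] g0(2))
  also have "\<dots> = 0" using u(3) by (simp add: inner_isometry[OF g0(1)] covector_def)
  finally show "covector (Ad g0 u) (C' (g0 \<xi>))"
    using BZ Cfix[of _ \<xi>] u(3) by (simp add: covector_def)
qed

end

section \<open>Unitary groups over a normed star algebra\<close>

text \<open>
  Complex numbers and quaternions are treated together. Vectors form a right module, on which
  matrices act from the left; noncommutativity makes this the only choice of sides for which
  matrices are linear over the algebra.
\<close>

definition rmult :: "'q::times ^ 'n \<Rightarrow> 'q \<Rightarrow> 'q ^ 'n" where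
  "rmult x a = (\<chi> i. x $ i * a)"

lemma rmult_nth [simp]: "rmult x a $ i = x $ i * a"
  by (simp add: rmult_def)

lemma rmult_rmult: "rmult (rmult x a) b = rmult x (a * b :: 'q::semigroup_mult)"
  by (simp add: vec_eq_iff mult.assoc)

lemma rmult_one [simp]: "rmult x (1 :: 'q::monoid_mult) = x"
  by (simp add: vec_eq_iff)

lemma axis_rmult: "rmult (axis k 1) a = (axis k a :: 'q::ring_1 ^ 'n)"
  by (simp add: vec_eq_iff axis_def)

lemma vec_axis_expansion: "x = (\<Sum>j\<in>UNIV. rmult (axis j 1) (x $ j))"
  for x :: "'q::ring_1 ^ 'n"
  by (simp add: vec_eq_iff axis_rmult) (simp add: axis_def if_distrib cong: if_cong)

lemma bounded_linear_on_euclidean: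
  fixes f :: "'a::euclidean_space \<Rightarrow> 'b::real_normed_vector"
  shows "linear f \<Longrightarrow> bounded_linear f"
  by (simp add: linear_conv_bounded_linear)

lemma linear_rmult_left: "linear (\<lambda>x :: 'q::{real_algebra_1, euclidean_space} ^ 'n. rmult x a)"
  by (rule linearI) (simp_all add: vec_eq_iff distrib_right)

definition Rmult :: "'q::{real_algebra_1, euclidean_space} \<Rightarrow> ('q ^ 'n) op" where
  "Rmult a = Blinfun (\<lambda>x. rmult x a)"

lemma Rmult_apply [simp]: "Rmult a x = rmult x a"
  by (simp add: Rmult_def bounded_linear_Blinfun_apply[OF bounded_linear_on_euclidean[OF linear_rmult_left]])

text \<open>
  The unitary group without coordinates: in this form it is visibly a closed group.
\<close>

definition K_group :: "('q::{real_algebra_1, euclidean_space} ^ 'n) op set" where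
  "K_group = {g. (\<forall>x. norm (blinfun_apply g x) = norm x) \<and>
     (\<forall>x a. blinfun_apply g (rmult x a) = rmult (blinfun_apply g x) a)}"

lemma K_groupD:
  "g \<in> K_group \<Longrightarrow> norm (blinfun_apply g x) = norm x"
  "g \<in> K_group \<Longrightarrow> blinfun_apply g (rmult x a) = rmult (blinfun_apply g x) a"
  by (auto simp: K_group_def)

lemma K_group_isometry_group:
  "isometry_group (K_group :: ('q::{real_algebra_1, euclidean_space} ^ 'n) op set)"
proof
  let ?K = "K_group :: ('q ^ 'n) op set"
  show "id_blinfun \<in> ?K" by (simp add: K_group_def)
  show "g o\<^sub>L h \<in> ?K" if "g \<in> ?K" "h \<in> ?K" for g h
    using that by (simp add: K_group_def)
  show "norm (g x) = norm x" if "g \<in> ?K" for g x using K_groupD[OF that] by simp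
  show "\<exists>h\<in>?K. g o\<^sub>L h = id_blinfun" if g: "g \<in> ?K" for g
  proof -
    have lin: "linear (blinfun_apply g)" by (simp add: bounded_linear.linear blinfun.bounded_linear_right)
    have inj: "inj (blinfun_apply g)"
    proof (rule injI)
      fix x y assume "g x = g y"
      then have "norm (x - y) = 0" using K_groupD(1)[OF g, of "x - y"] by (simp add: blinfun.diff_right)
      then show "x = y" by simp
    qed
    have surj: "surj (blinfun_apply g)" by (rule linear_inj_imp_surj[OF lin inj])
    let ?f = "inv (blinfun_apply g)"
    have gf: "g (?f x) = x" for x by (rule surj_f_inv_f[OF surj])
    have fg: "?f (g x) = x" for x by (rule inv_f_f[OF inj])
    have linf: "linear ?f"
      by (rule linearI; rule injD[OF inj]) (simp_all add: gf blinfun.add_right blinfun.scaleR_right)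
    then have h: "Blinfun ?f x = ?f x" for x
      by (simp add: bounded_linear_Blinfun_apply bounded_linear_on_euclidean)
    have "norm (?f x) = norm x" for x using K_groupD(1)[OF g, of "?f x"] by (simp add: gf)
    moreover have "?f (rmult x a) = rmult (?f x) a" for x a
      by (rule injD[OF inj]) (simp add: gf K_groupD(2)[OF g])
    ultimately have "Blinfun ?f \<in> ?K" by (simp add: K_group_def h)
    moreover have "g o\<^sub>L Blinfun ?f = id_blinfun" by (rule blinfun_eqI) (simp add: h gf)
    ultimately show ?thesis by blast
  qed
  show "closed ?K"
  proof -
    have cont: "continuous_on UNIV (\<lambda>g. blinfun_apply g x)" for x :: "'q ^ 'n"
      by (intro linear_continuous_on blinfun.bounded_linear_left)
    have contR: "continuous_on UNIV (\<lambda>g :: ('q ^ 'n) op. rmult (blinfun_apply g x) a)" for x :: "'q ^ 'n" and a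
      by (rule bounded_linear.continuous_on[OF bounded_linear_on_euclidean[OF linear_rmult_left] cont])
    have "closed {g. norm (blinfun_apply g x) = norm x}" for x :: "'q ^ 'n"
      by (intro closed_Collect_eq continuous_on_norm cont continuous_on_const)
    moreover have "closed {g :: ('q ^ 'n) op. blinfun_apply g (rmult x a) = rmult (blinfun_apply g x) a}" for x :: "'q ^ 'n" and a
      by (intro closed_Collect_eq cont contR)
    ultimately have "closed ((\<Inter>x. {g. norm (blinfun_apply g x) = norm x})
       \<inter> (\<Inter>x. \<Inter>a. {g. blinfun_apply g (rmult x a) = rmult (blinfun_apply g x) a}) :: ('q ^ 'n) op set)"
      by (intro closed_Int closed_INT) auto
    moreover have "(\<Inter>x. {g. norm (blinfun_apply g x) = norm x})
       \<inter> (\<Inter>x. \<Inter>a. {g. blinfun_apply g (rmult x a) = rmult (blinfun_apply g x) a}) = ?K"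
      by (auto simp: K_group_def)
    ultimately show ?thesis by simp
  qed
qed

lemma K_group_one_param:
  fixes Z :: "('q::{real_algebra_1, euclidean_space} ^ 'n) \<Rightarrow>\<^sub>L ('q ^ 'n)"
  assumes lin: "\<And>x a. Z (rmult x a) = rmult (Z x) a" and skew: "\<And>x. inner (Z x) x = 0"
  shows "Z \<in> lie_algebra K_group"
proof -
  have "one_param Z t (rmult x a) = rmult (one_param Z t x) a" for t x a
  proof -
    have "Rmult a o\<^sub>L Z = Z o\<^sub>L Rmult a" by (rule blinfun_eqI) (simp add: lin)
    from arg_cong[OF one_param_commute[OF this, of t], of "\<lambda>f. blinfun_apply f x"]
    show ?thesis by simp
  qed
  then show ?thesis
    using one_param_isometry_iff_skew[of Z] skew by (simp add: lie_algebra_def K_group_def)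
qed

locale star_algebra =
  fixes cj :: "'q::{real_algebra_1, euclidean_space} \<Rightarrow> 'q"
  assumes cj_linear: "linear cj"
    and inner_mult_left: "inner (a * b) c = inner b (cj a * c)"
    and inner_mult_right: "inner (a * b) c = inner a (c * cj b)"
    and cj_mult_self: "cj a * a = inner a a *\<^sub>R 1"
    and add_cj: "a + cj a = (2 * inner 1 a) *\<^sub>R 1"
    and norm_1: "inner (1 :: 'q) 1 = 1"
begin

lemma cj_zero [simp]: "cj 0 = 0" by (rule linear_0[OF cj_linear])

lemma cj_one [simp]: "cj 1 = 1"
  using cj_mult_self[of 1] by (simp add: norm_1)

lemma inner_mult_self: "inner (a * b) (a * b) = inner a a * inner b b" for a b :: 'q
proof -
  have "inner (a * b) (a * b) = inner b (cj a * (a * b))" by (rule inner_mult_left)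
  also have "cj a * (a * b) = (cj a * a) * b" by (simp add: mult.assoc)
  finally show ?thesis by (simp add: cj_mult_self)
qed

definition hform :: "'q ^ 'n \<Rightarrow> 'q ^ 'n \<Rightarrow> 'q" where
  "hform u z = (\<Sum>i\<in>UNIV. cj (u $ i) * z $ i)"

lemma hform_rmult: "hform u (rmult z a) = hform u z * a"
  by (simp add: hform_def sum_distrib_right mult.assoc)

lemma inner_rmult: "inner (rmult u a) z = inner a (hform u z)"
  by (simp add: hform_def inner_vec_def inner_mult_left inner_sum_right)

lemma hform_add: "hform u (z + w) = hform u z + hform u w"
  and hform_scaleR: "hform u (r *\<^sub>R z) = r *\<^sub>R hform u z"
  by (simp_all add: hform_def algebra_simps sum.distrib scaleR_sum_right)

lemma inner_one_hform: "inner 1 (hform u z) = inner u z"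
  using inner_rmult[of u 1 z] by simp

lemma hform_axis: "hform (axis k 1) z = z $ k"
  unfolding hform_def axis_def by (simp add: if_distrib[of cj] if_distrib[of "\<lambda>a. a * _"] cong: if_cong)

lemma hform_axis_right: "hform u (axis k 1) = cj (u $ k)"
  unfolding hform_def axis_def by (simp add: if_distrib[of "\<lambda>a. _ * a"] cong: if_cong)

lemma norm_rmult: "inner a a = 1 \<Longrightarrow> norm (rmult x a) = norm x" for x :: "'q ^ 'n"
  unfolding norm_eq by (simp add: inner_vec_def inner_mult_self)

lemma inner_rmult_self: "inner (rmult x a) (rmult x a) = inner x x * inner a a" for x :: "'q ^ 'n"
  by (simp add: inner_vec_def inner_mult_self sum_distrib_right)

lemma inner_rmult_adjoint: "inner (rmult x a) y = inner x (rmult y (cj a))" for x :: "'q ^ 'n"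
  by (simp add: inner_vec_def inner_mult_right)

lemma norm_axis: "norm (axis k (1 :: 'q) :: 'q ^ 'n) = 1"
  by (simp add: norm_eq_1 inner_axis_axis norm_1)

lemma K_group_hform:
  assumes "g \<in> K_group"
  shows "hform (blinfun_apply g x) (blinfun_apply g y) = hform x y"
proof -
  interpret K: isometry_group K_group by (rule K_group_isometry_group)
  have "inner a (hform (g x) (g y)) = inner a (hform x y)" for a
    using K.inner_isometry[OF assms, of "rmult x a" y]
    by (simp add: inner_rmult[symmetric] K_groupD(2)[OF assms])
  then show ?thesis by (metis inner_commute vector_eq_rdot)
qed

lemma matrix_apply_expansion:
  "(A :: 'q ^ 'n ^ 'n) *v x = (\<Sum>j\<in>UNIV. rmult (\<chi> i. A $ i $ j) (x $ j))"
  by (simp add: vec_eq_iff matrix_vector_mult_def)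

lemma matrix_apply_axis: "(A :: 'q ^ 'n ^ 'n) *v axis j 1 = (\<chi> i. A $ i $ j)"
  by (simp add: vec_eq_iff matrix_vector_mult_def axis_def if_distrib[of "\<lambda>a. _ * a"] cong: if_cong)

lemma adjoint_matrix_eq_one_iff:
  "(\<chi> i j. cj (A $ j $ i)) ** A = mat 1 \<longleftrightarrow>
     (\<forall>i j. hform (A *v axis i 1) (A *v axis j 1) = (if i = j then 1 else 0))"
  for A :: "'q ^ 'n ^ 'n"
  by (simp add: vec_eq_iff matrix_matrix_mult_def mat_def matrix_apply_axis hform_def)

text \<open>
  The entries of \<open>A\<^sup>* A\<close> are the products of the columns of \<open>A\<close>, the images of the standard basis;
  and the form \<open>hform\<close> is determined by the norm and the module structure.
\<close>

lemma K_group_matrix_iff: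
  "g \<in> K_group \<longleftrightarrow> (\<exists>A :: 'q ^ 'n ^ 'n. (\<chi> i j. cj (A $ j $ i)) ** A = mat 1 \<and> (\<forall>x. blinfun_apply g x = A *v x))"
proof
  assume g: "g \<in> K_group"
  define A where "A = (\<chi> i j. g (axis j 1) $ i)"
  have Ax: "g x = A *v x" for x
  proof -
    have "g x = (\<Sum>j\<in>UNIV. g (rmult (axis j 1) (x $ j)))"
      by (subst vec_axis_expansion[of x]) (simp add: blinfun.sum_right)
    also have "\<dots> = A *v x"
      unfolding matrix_apply_expansion K_groupD(2)[OF g] by (simp add: A_def)
    finally show ?thesis .
  qed
  have "hform (A *v axis i 1) (A *v axis j 1) = (if i = j then 1 else 0)" for i j
    unfolding Ax[symmetric] K_group_hform[OF g] hform_axis by (simp add: axis_def)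
  then have "(\<chi> i j. cj (A $ j $ i)) ** A = mat 1" unfolding adjoint_matrix_eq_one_iff by blast
  with Ax show "\<exists>A :: 'q ^ 'n ^ 'n. (\<chi> i j. cj (A $ j $ i)) ** A = mat 1 \<and> (\<forall>x. g x = A *v x)"
    by blast
next
  assume "\<exists>A :: 'q ^ 'n ^ 'n. (\<chi> i j. cj (A $ j $ i)) ** A = mat 1 \<and> (\<forall>x. g x = A *v x)"
  then obtain A :: "'q ^ 'n ^ 'n" where A: "(\<chi> i j. cj (A $ j $ i)) ** A = mat 1" and g: "\<And>x. g x = A *v x" by blast
  let ?c = "\<lambda>j. (\<chi> i. A $ i $ j)"
  have col: "hform (?c i) (?c j) = (if i = j then 1 else 0)" for i j
    using A by (simp add: adjoint_matrix_eq_one_iff matrix_apply_axis)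
  have "inner (A *v x) (A *v x) = inner x x" for x
  proof -
    have "inner (A *v x) (A *v x) = (\<Sum>i\<in>UNIV. \<Sum>j\<in>UNIV. inner (rmult (?c i) (x $ i)) (rmult (?c j) (x $ j)))"
      unfolding matrix_apply_expansion by (simp add: inner_sum_left inner_sum_right) (rule sum.swap)
    also have "\<dots> = (\<Sum>i\<in>UNIV. \<Sum>j\<in>UNIV. if i = j then inner (x $ i) (x $ j) else 0)"
      unfolding inner_rmult hform_rmult col by (intro sum.cong refl) simp
    also have "\<dots> = inner x x" by (simp add: inner_vec_def)
    finally show ?thesis .
  qed
  then have "norm (g x) = norm x" for x unfolding norm_eq g .
  moreover have "g (rmult x a) = rmult (g x) a" for x a
    by (simp add: g vec_eq_iff matrix_vector_mult_def sum_distrib_right mult.assoc)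
  ultimately show "g \<in> K_group" by (simp add: K_group_def)
qed

text \<open>
  The quasi-reflection \<open>z \<mapsto> z - d i \<langle>d, z\<rangle>\<close> with \<open>d = p - x\<close>, \<open>c = \<langle>d, p\<rangle>\<close> and \<open>i\<close> the inverse of
  \<open>c\<close> maps \<open>p\<close> to \<open>x\<close>. It is an isometry because twice the real part of \<open>c\<close> is \<open>|d|\<^sup>2\<close>, which uses
  that \<open>p\<close> and \<open>x\<close> have the same norm. An ordinary reflection would do only for real \<open>\<langle>x, p\<rangle>\<close>.
\<close>

lemma K_group_transitive:
  fixes p x :: "'q ^ 'n"
  assumes p: "norm p = 1" and x: "norm x = 1"
  shows "\<exists>g\<in>K_group. g p = x"
proof (cases "x = p")
  case True
  interpret K: isometry_group K_group by (rule K_group_isometry_group)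
  show ?thesis using K.id_mem True by (intro bexI[of _ id_blinfun]) auto
next
  case False
  define d where "d = p - x"
  define c where "c = hform d p"
  define i where "i = (1 / inner c c) *\<^sub>R cj c"
  have pp: "inner p p = 1" "inner x x = 1" using p x by (simp_all add: norm_eq_1)
  have Re: "2 * inner 1 c = inner d d"
    by (simp add: c_def inner_one_hform) (simp add: d_def inner_diff_left inner_diff_right pp inner_commute)
  have "inner d d > 0" using False by (simp add: d_def)
  then have c0: "c \<noteq> 0"
  proof (rule contrapos_pn)
    assume "c = 0"
    then show "\<not> inner d d > 0" using Re by simp
  qed
  then have cc: "inner c c \<noteq> 0" by simp
  have ic: "i * c = 1" by (simp add: i_def cj_mult_self c0)
  have ii: "inner (i * w) w = inner 1 c * inner w w / inner c c" for w
  proof -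
    have "inner (cj c * w) w = inner w (c * w)" by (metis inner_mult_left[of c w w] inner_commute)
    also have "\<dots> = inner 1 c * inner w w"
    proof -
      have "2 * inner w (c * w) = inner (c * w) w + inner (cj c * w) w"
        using inner_mult_left[of c w w] by (simp add: inner_commute)
      also have "\<dots> = inner ((c + cj c) * w) w" by (simp add: distrib_right inner_add_left)
      finally show ?thesis by (simp add: add_cj)
    qed
    finally show ?thesis by (simp add: i_def)
  qed
  have icj: "inner (cj c) (cj c) = inner c c"
  proof -
    have "cj c = (2 * inner 1 c) *\<^sub>R 1 - c" using add_cj[of c] by (simp add: algebra_simps)
    then show ?thesis by (simp add: inner_diff_left inner_diff_right norm_1 inner_commute)
  qed
  have iin: "inner (i * w) (i * w) = inner w w / inner c c" for w
    by (simp add: inner_mult_self) (simp add: i_def icj c0)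
  let ?f = "\<lambda>z. z - rmult d (i * hform d z)"
  have lin: "linear ?f"
    by (rule linearI) (simp_all add: vec_eq_iff hform_add hform_scaleR algebra_simps)
  define g where "g = Blinfun ?f"
  have g: "g z = ?f z" for z
    by (simp add: g_def bounded_linear_Blinfun_apply[OF bounded_linear_on_euclidean[OF lin]])
  have "inner (g z) (g z) = inner z z" for z
  proof -
    let ?a = "i * hform d z"
    have "inner (g z) (g z) = inner z z - 2 * inner (rmult d ?a) z + inner (rmult d ?a) (rmult d ?a)"
      by (simp add: g inner_diff_left inner_diff_right inner_commute)
    also have "inner (rmult d ?a) z = inner 1 c * inner (hform d z) (hform d z) / inner c c"
      by (simp add: inner_rmult ii)
    also have "inner (rmult d ?a) (rmult d ?a) = inner d d * (inner (hform d z) (hform d z) / inner c c)"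
      by (simp add: inner_rmult_self iin)
    finally show ?thesis by (simp add: Re[symmetric])
  qed
  then have "norm (g z) = norm z" for z unfolding norm_eq .
  moreover have "g (rmult z a) = rmult (g z) a" for z a
    by (simp add: g hform_rmult vec_eq_iff mult.assoc left_diff_distrib)
  ultimately have "g \<in> K_group" by (simp add: K_group_def)
  moreover have "g p = x" by (simp add: g c_def[symmetric] ic) (simp add: d_def)
  ultimately show ?thesis by blast
qed

text \<open>
  Infinitesimal rotations with a prescribed velocity at \<open>p\<close>: \<open>rot\<close> in the plane of \<open>p\<close> and \<open>w\<close>, and
  \<open>phase\<close> within the line spanned by \<open>p\<close> over the algebra. Together they show that the whole tangent
  space is reached.
\<close>

definition rot :: "'q ^ 'n \<Rightarrow> 'q ^ 'n \<Rightarrow> ('q ^ 'n) op" where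
  "rot p w = Blinfun (\<lambda>x. rmult w (hform p x) - rmult p (hform w x))"

definition phase :: "'q ^ 'n \<Rightarrow> 'q \<Rightarrow> ('q ^ 'n) op" where
  "phase p \<theta> = Blinfun (\<lambda>x. rmult p (\<theta> * hform p x))"

lemma rot_apply: "rot p w x = rmult w (hform p x) - rmult p (hform w x)"
  unfolding rot_def
  by (subst bounded_linear_Blinfun_apply, rule bounded_linear_on_euclidean, rule linearI)
    (simp_all add: vec_eq_iff hform_add hform_scaleR algebra_simps)

lemma phase_apply: "phase p \<theta> x = rmult p (\<theta> * hform p x)"
  unfolding phase_def
  by (subst bounded_linear_Blinfun_apply, rule bounded_linear_on_euclidean, rule linearI)
    (simp_all add: vec_eq_iff hform_add hform_scaleR algebra_simps)

lemma rot_lie: "rot p w \<in> lie_algebra K_group"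
proof (rule K_group_one_param)
  show "rot p w (rmult x a) = rmult (rot p w x) a" for x a
    by (simp add: rot_apply hform_rmult vec_eq_iff mult.assoc left_diff_distrib)
  show "inner (rot p w x) x = 0" for x
    unfolding rot_apply inner_diff_left inner_rmult by (simp add: inner_commute)
qed

lemma phase_lie:
  assumes "cj \<theta> = - \<theta>"
  shows "phase p \<theta> \<in> lie_algebra K_group"
proof (rule K_group_one_param)
  show "phase p \<theta> (rmult x a) = rmult (phase p \<theta> x) a" for x a
    by (simp add: phase_apply hform_rmult vec_eq_iff mult.assoc)
  show "inner (phase p \<theta> x) x = 0" for x
    using inner_mult_left[of \<theta> "hform p x" "hform p x"] inner_commute[of "\<theta> * hform p x" "hform p x"]
    unfolding phase_apply inner_rmult assms by simp
qed

lemma imaginary_iff: "inner 1 \<theta> = 0 \<longleftrightarrow> cj \<theta> = - \<theta>"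
proof
  assume "inner 1 \<theta> = 0"
  then have "\<theta> + cj \<theta> = 0" using add_cj[of \<theta>] by simp
  then show "cj \<theta> = - \<theta>" by (simp add: eq_neg_iff_add_eq_0 add.commute)
next
  assume "cj \<theta> = - \<theta>"
  then have "(2 * inner 1 \<theta>) *\<^sub>R (1 :: 'q) = 0" using add_cj[of \<theta>] by simp
  then show "inner 1 \<theta> = 0" by simp
qed

lemma tangent_decomposition:
  fixes y :: "'q ^ 'n"
  assumes "inner (axis k 1) y = 0"
  obtains w \<theta> where "w $ k = 0" "cj \<theta> = - \<theta>" "y = w + axis k \<theta>"
proof
  let ?w = "y - axis k (y $ k)"
  show "?w $ k = 0" by (simp add: axis_def)
  show "cj (y $ k) = - y $ k" using assms by (simp add: inner_axis_axis inner_axis' imaginary_iff[symmetric])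
  show "y = ?w + axis k (y $ k)" by simp
qed

lemma rot_axis: "w $ k = 0 \<Longrightarrow> rot (axis k 1) w (axis k 1) = w"
  unfolding rot_apply hform_axis hform_axis_right by (auto simp: vec_eq_iff axis_def)

lemma phase_axis: "phase (axis k 1) \<theta> (axis k 1) = axis k \<theta>"
  unfolding phase_apply hform_axis by (auto simp: vec_eq_iff axis_def)

lemma K_group_sphere_action: "sphere_action K_group (axis k (1 :: 'q) :: 'q ^ 'n)"
proof (intro sphere_action.intro sphere_action_axioms.intro K_group_isometry_group norm_axis)
  fix x :: "'q ^ 'n" assume "norm x = 1"
  then show "\<exists>g\<in>K_group. g (axis k 1) = x" by (intro K_group_transitive norm_axis)
next
  interpret K: isometry_group K_group by (rule K_group_isometry_group)
  fix y :: "'q ^ 'n" assume "inner (axis k 1) y = 0"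
  then obtain w \<theta> where y: "w $ k = 0" "cj \<theta> = - \<theta>" "y = w + axis k \<theta>"
    by (rule tangent_decomposition)
  show "\<exists>Y\<in>lie_algebra K_group. Y (axis k 1) = y"
    by (intro bexI[of _ "rot (axis k 1) w + phase (axis k 1) \<theta>"] K.add_lie rot_lie phase_lie y)
      (simp add: blinfun.add_left rot_axis phase_axis y)
qed

definition diag :: "('n \<Rightarrow> 'q) \<Rightarrow> ('q ^ 'n) op" where
  "diag d = Blinfun (\<lambda>x. \<chi> i. d i * x $ i)"

lemma diag_nth: "diag d x $ i = d i * x $ i"
  unfolding diag_def
  by (subst bounded_linear_Blinfun_apply, rule bounded_linear_on_euclidean, rule linearI)
    (simp_all add: vec_eq_iff algebra_simps)

lemma diag_K: "(\<And>i. inner (d i) (d i) = 1) \<Longrightarrow> diag d \<in> K_group"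
  by (simp add: K_group_def norm_eq inner_vec_def diag_nth inner_mult_self vec_eq_iff mult.assoc)

lemma diag_axis: "diag d (axis k 1) = axis k (d k)"
  by (simp add: vec_eq_iff diag_nth axis_def)

lemma fixed_imp_axis:
  fixes v :: "'q ^ 'n"
  assumes "diag (\<lambda>i. if i = k then 1 else - 1) v = v"
  shows "v = axis k (v $ k)"
proof -
  have "v $ j = 0" if "j \<noteq> k" for j
  proof -
    have "- (v $ j) = v $ j" using arg_cong[OF assms, of "\<lambda>x. x $ j"] that by (simp add: diag_nth)
    then have "2 *\<^sub>R v $ j = 0" unfolding scaleR_2 by (metis add.left_inverse)
    then show ?thesis by simp
  qed
  then show ?thesis by (auto simp: vec_eq_iff axis_def)
qed

lemma reflection_isotropy: "diag (\<lambda>i. if i = k then 1 else - 1) \<in> isotropy K_group (axis k 1)"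
  by (auto simp: isotropy_def diag_axis intro!: diag_K norm_1)

end

section \<open>The homogeneous spheres\<close>

interpretation complex: star_algebra cnj
proof (rule star_algebra.intro)
  show "linear cnj" by (rule linearI) simp_all
qed (auto simp: inner_complex_def complex_eq_iff algebra_simps power2_eq_square)

interpretation quat: star_algebra qcnj
proof (rule star_algebra.intro)
  show "linear qcnj" by (rule linearI) (simp_all add: qcnj_def quat_eq_iff)
qed (auto simp: inner_quat_def quat_eq_iff qcnj_def times_quat_def algebra_simps power2_eq_square)

lemma U_group_eq: "U_group = (K_group :: (complex ^ 'n) op set)"
  by (auto simp: U_group_def unitary_mat_def complex.K_group_matrix_iff)

lemma Sp_group_eq: "Sp_group = (K_group :: (quat ^ 'n) op set)"
  by (auto simp: Sp_group_def quat_unitary_mat_def quat.K_group_matrix_iff)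

text \<open>
  Right multiplication by an imaginary unit, the source of all complex structures used below.
\<close>

lemma (in star_algebra) Rmult_structure:
  fixes p :: "'q ^ 'n"
  assumes G: "sphere_action G p"
    and \<theta>: "cj \<theta> = - \<theta>" "\<theta> * \<theta> = - 1"
    and comm: "\<And>g x. g \<in> G \<Longrightarrow> blinfun_apply g (rmult x \<theta>) = rmult (blinfun_apply g x) \<theta>"
  shows "sphere_action.equivariant_structure G (Rmult \<theta>)"
  unfolding sphere_action.equivariant_structure_def[OF G]
proof (intro conjI ballI allI)
  show "Rmult \<theta> (g x) = g (Rmult \<theta> x)" if "g \<in> G" for g x using comm[OF that] by simp
  have "rmult y (- \<theta>) = - rmult y \<theta>" for y :: "'q ^ 'n" by (simp add: vec_eq_iff)
  then show "inner (Rmult \<theta> x) y = - inner x (Rmult \<theta> y)" for x y :: "'q ^ 'n"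
    by (simp add: inner_rmult_adjoint \<theta>(1))
  show "Rmult \<theta> (Rmult \<theta> x) = - x" for x :: "'q ^ 'n"
    by (simp add: rmult_rmult \<theta>(2)) (simp add: vec_eq_iff)
qed

lemma (in star_algebra) tangent_axis:
  assumes "inner (axis k (1 :: 'q)) v = 0"
  shows "inner 1 (v $ k) = 0"
  using assms by (simp add: inner_axis')

subsection \<open>The groups \<open>U(n+1)\<close>\<close>

lemma complex_fixed_line:
  fixes v :: "complex ^ 'n"
  assumes "inner (axis k 1) v = 0" "v = axis k (v $ k)"
  shows "\<exists>r. v = r *\<^sub>R Rmult \<i> (axis k 1)"
proof -
  have "Re (v $ k) = 0" using complex.tangent_axis[OF assms(1)] by (simp add: inner_complex_def)
  then have "v $ k = Im (v $ k) *\<^sub>R \<i>" by (simp add: complex_eq_iff)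
  then have "axis k (v $ k) = Im (v $ k) *\<^sub>R rmult (axis k 1) \<i>"
    by (auto simp: vec_eq_iff axis_def)
  then show ?thesis using assms(2) by auto
qed

text \<open>
  A diagonal reflection in \<open>H\<close> kills all components of a fixed vector other than the \<open>k\<close>-th, and
  tangency makes the \<open>k\<close>-th one imaginary.
\<close>

theorem U_equigeodesic_vectors:
  assumes "bi_invariant_inner_product U_group B" "fixed_compl U_group (axis k (1 :: complex)) B \<noteq> {0}"
  shows "{X \<in> reductive_compl U_group (axis k 1) B.
            randers_equigeodesic_vector U_group (axis k 1) B X}
         = fixed_compl U_group (axis k (1 :: complex) :: complex ^ 'n) B - {0}"
proof -
  interpret reductive_sphere K_group "axis k (1 :: complex) :: complex ^ 'n" B
    using assms(1) complex.K_group_sphere_action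
    by (simp add: reductive_sphere_def reductive_sphere_axioms_def U_group_eq)
  show ?thesis
    unfolding U_group_eq
  proof (rule equigeodesic_vectors_eq_fixed)
    show "equivariant_structure (Rmult \<i>)"
      by (rule complex.Rmult_structure[OF sphere_action_axioms]) (auto simp: K_groupD)
    show "\<exists>r. v = r *\<^sub>R Rmult \<i> (axis k 1)"
      if "inner (axis k 1) v = 0" "\<forall>h\<in>isotropy K_group (axis k 1). h v = v" for v
      using that complex.fixed_imp_axis complex.reflection_isotropy by (intro complex_fixed_line) blast+
  qed (use assms(2) in \<open>simp add: U_group_eq\<close>)
qed

subsection \<open>The groups \<open>SU(n+1)\<close>\<close>

definition Det :: "(complex ^ 'n) op \<Rightarrow> complex" where
  "Det g = det (\<chi> i j. blinfun_apply g (axis j 1) $ i)"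

lemma Det_matrix: "(\<And>x. blinfun_apply g x = A *v x) \<Longrightarrow> Det g = det A"
  unfolding Det_def by (simp add: complex.matrix_apply_axis) 

lemma SU_group_eq: "SU_group = {g \<in> K_group. Det g = 1}"
  using Det_matrix by (fastforce simp: SU_group_def unitary_mat_def complex.K_group_matrix_iff)

lemma Det_id: "Det (id_blinfun :: (complex ^ 'n) op) = 1"
proof -
  have "Det (id_blinfun :: (complex ^ 'n) op) = det (mat 1 :: complex ^ 'n ^ 'n)" by (rule Det_matrix) simp
  then show ?thesis by simp
qed

lemma Det_compose:
  assumes "g \<in> K_group" "h \<in> K_group"
  shows "Det (g o\<^sub>L h) = Det g * Det h"
proof -
  obtain A where A: "\<And>x. blinfun_apply g x = A *v x"
    using assms(1) by (auto simp: complex.K_group_matrix_iff)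
  obtain A' where A': "\<And>x. blinfun_apply h x = A' *v x"
    using assms(2) by (auto simp: complex.K_group_matrix_iff)
  have "Det (g o\<^sub>L h) = det (A ** A')"
    by (rule Det_matrix) (simp add: A A' matrix_vector_mul_assoc)
  then show ?thesis by (simp add: det_mul Det_matrix[OF A] Det_matrix[OF A'])
qed

lemma norm_Det:
  assumes "g \<in> K_group"
  shows "norm (Det g) = 1"
proof -
  obtain A where A: "(\<chi> i j. cnj (A $ j $ i)) ** A = mat 1" "\<And>x. blinfun_apply g x = A *v x"
    using assms by (auto simp: complex.K_group_matrix_iff)
  have "det (\<chi> i j. cnj (A $ j $ i)) = det (transpose (\<chi> i j. cnj (A $ i $ j)))"
    by (simp add: transpose_def)
  also have "\<dots> = det (\<chi> i j. cnj (A $ i $ j))" by (rule det_transpose)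
  also have "\<dots> = cnj (det A)" by (simp add: det_def)
  finally have "cnj (det A) * det A = 1" using arg_cong[OF A(1), of det] by (simp add: det_mul)
  then have "(norm (det A))\<^sup>2 = 1"
    by (metis complex_norm_square mult.commute of_real_eq_1_iff)
  then show ?thesis by (simp add: Det_matrix[OF A(2)] power2_eq_1_iff) (metis norm_ge_zero not_one_le_zero neg_0_le_iff_le)
qed

lemma continuous_on_Det: "continuous_on UNIV (Det :: (complex ^ 'n) op \<Rightarrow> complex)"
proof -
  have "continuous_on UNIV (\<lambda>g :: (complex ^ 'n) op. blinfun_apply g x $ i)" for x i
    by (intro bounded_linear.continuous_on[OF bounded_linear_vec_nth] linear_continuous_on
        blinfun.bounded_linear_left)
  then show ?thesis
    unfolding Det_def[abs_def] det_def vec_lambda_beta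
    by (intro continuous_on_sum continuous_on_mult continuous_on_const continuous_on_prod)
qed

lemma Det_diag: "Det (complex.diag d) = (\<Prod>i\<in>UNIV. d i)"
proof -
  have entry: "complex.diag d (axis j 1) $ i = (if i = j then d j else 0)" for i j
    unfolding complex.diag_axis by (simp add: axis_def)
  show ?thesis
    unfolding Det_def entry by (subst det_diagonal) simp_all
qed

lemma SU_isometry_group:
  "isometry_group (SU_group :: (complex ^ 'n) op set)"
proof -
  interpret K: isometry_group "K_group :: (complex ^ 'n) op set"
    by (rule K_group_isometry_group)
  show ?thesis
    unfolding SU_group_eq
  proof
    show "closed {g \<in> K_group :: (complex ^ 'n) op set. Det g = 1}"
    proof -
      have "closed {g :: (complex ^ 'n) op. Det g = 1}"
        by (intro closed_Collect_eq continuous_on_Det continuous_on_const)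
      from closed_Int[OF K.closed_group this] show ?thesis by (simp add: Int_def)
    qed
    show "\<exists>h\<in>{g \<in> K_group. Det g = 1}. g o\<^sub>L h = id_blinfun"
      if g: "g \<in> {g \<in> K_group. Det g = 1}" for g :: "(complex ^ 'n) op"
    proof -
      obtain h where h: "h \<in> K_group" "g o\<^sub>L h = id_blinfun" using g K.inverse_ex by blast
      have "Det g * Det h = 1" using Det_compose[of g h] g h by (simp add: Det_id)
      then show ?thesis using g h by auto
    qed
  qed (auto simp: K.id_mem Det_id K.compose_mem Det_compose K.isometry)
qed

text \<open>
  Conjugation to the negative makes \<open>Z\<close> traceless, but the determinant can also be found without
  its derivative: the determinants of \<open>exp (t Z)\<close> and of its inverse agree, so they are \<open>\<plusminus>1\<close>;
  and as \<open>exp (t Z)\<close> is the square of \<open>exp (t/2 Z)\<close>, they are \<open>1\<close>.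
\<close>

lemma SU_lie:
  assumes Z: "Z \<in> lie_algebra K_group" and g: "g \<in> K_group" "\<And>x. blinfun_apply g (Z x) = - Z (g x)"
  shows "Z \<in> lie_algebra SU_group"
proof -
  interpret K: isometry_group "K_group :: (complex ^ 'n) op set"
    by (rule K_group_isometry_group)
  have ZG: "one_param Z t \<in> K_group" for t using Z by (simp add: lie_algebra_def)
  have "g o\<^sub>L Z = (- Z) o\<^sub>L g" by (rule blinfun_eqI) (simp add: g(2) blinfun.minus_left)
  from one_param_commute[OF this] have "g o\<^sub>L one_param Z t = one_param Z (- t) o\<^sub>L g" for t by simp
  then have "Det g * Det (one_param Z t) = Det (one_param Z (- t)) * Det g" for t
    using Det_compose[OF g(1) ZG, of t] Det_compose[OF ZG g(1), of "- t"] by simp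
  moreover have "Det g \<noteq> 0" using norm_Det[OF g(1)] by auto
  ultimately have eq: "Det (one_param Z t) = Det (one_param Z (- t))" for t
    by (metis mult.commute mult_cancel_left)
  have "Det (one_param Z (t / 2)) * Det (one_param Z (- (t / 2))) = 1" for t
    unfolding Det_compose[OF ZG ZG, symmetric] one_param_add[symmetric] by (simp add: Det_id)
  then have "Det (one_param Z (t / 2)) * Det (one_param Z (t / 2)) = 1" for t
    by (metis eq)
  then have "Det (one_param Z (t / 2 + t / 2)) = 1" for t
    unfolding one_param_add Det_compose[OF ZG ZG] .
  then have "Det (one_param Z t) = 1" for t by (metis field_sum_of_halves)
  then show ?thesis using ZG by (simp add: lie_algebra_def SU_group_eq)
qed

lemma third_index:
  assumes "CARD('n::finite) \<ge> 3"
  shows "\<exists>i :: 'n. i \<noteq> j \<and> i \<noteq> k"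
proof (rule ccontr)
  assume "\<nexists>i :: 'n. i \<noteq> j \<and> i \<noteq> k"
  then have "UNIV \<subseteq> {j, k}" by auto
  then have "CARD('n) \<le> card {j, k}" by (intro card_mono) auto
  also have "\<dots> \<le> 2" by (simp add: card_insert_if)
  finally show False using assms by simp
qed

text \<open>
  Conjugation by this permutation matrix reverses the traceless combination of two phases.
\<close>

definition coord_swap :: "'n \<Rightarrow> 'n \<Rightarrow> (complex ^ 'n) op" where
  "coord_swap j k = Blinfun (\<lambda>x. \<chi> i. x $ (Transposition.transpose j k i))"

lemma coord_swap_nth: "coord_swap j k x $ i = x $ (Transposition.transpose j k i)"
  for x :: "complex ^ 'n"
  unfolding coord_swap_def
  by (subst bounded_linear_Blinfun_apply, rule bounded_linear_on_euclidean, rule linearI)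
    (simp_all add: vec_eq_iff)

lemma coord_swap_K:
  fixes j k :: "'n::finite"
  shows "coord_swap j k \<in> K_group"
proof -
  have "inner (coord_swap j k x) (coord_swap j k x) = inner x x" for x :: "complex ^ 'n"
    unfolding inner_vec_def coord_swap_nth
    by (rule sum.reindex_bij_betw[of "Transposition.transpose j k" UNIV UNIV "\<lambda>i. inner (x $ i) (x $ i)"]) simp
  then show ?thesis by (simp add: K_group_def norm_eq vec_eq_iff coord_swap_nth)
qed

text \<open>
  Transitivity is inherited from the unitary group after a correction of the determinant in a
  coordinate that does not affect \<open>p\<close>; for the Lie algebra the phase at \<open>p\<close> is balanced by the opposite
  phase in another coordinate.
\<close>

lemma SU_sphere_action:
  assumes card: "CARD('n::finite) \<ge> 3"
  shows "sphere_action SU_group (axis k (1 :: complex) :: complex ^ 'n)"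
proof (intro sphere_action.intro sphere_action_axioms.intro SU_isometry_group complex.norm_axis)
  interpret SU: isometry_group "SU_group :: (complex ^ 'n) op set"
    by (rule SU_isometry_group)
  interpret K: isometry_group "K_group :: (complex ^ 'n) op set"
    by (rule K_group_isometry_group)
  obtain j where j: "j \<noteq> k" using third_index[OF card, of k k] by blast
  fix x :: "complex ^ 'n" assume "norm x = 1"
  then obtain g where g: "g \<in> K_group" "g (axis k 1) = x"
    using complex.K_group_transitive[OF complex.norm_axis] by blast
  let ?z = "inverse (Det g)"
  have z: "norm ?z = 1" "Det g * ?z = 1" proof -
    have "Det g \<noteq> 0" using norm_Det[OF g(1)] by auto
    then show "norm ?z = 1" "Det g * ?z = 1" using norm_Det[OF g(1)] by (simp_all add: norm_inverse)
  qed
  let ?d = "complex.diag (\<lambda>i. if i = j then ?z else 1)"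
  have d: "?d \<in> K_group"
    using z(1) by (intro complex.diag_K) (auto simp: dot_square_norm complex.norm_1)
  have "Det ?d = ?z" by (simp add: Det_diag)
  then have "g o\<^sub>L ?d \<in> SU_group" using g d z by (simp add: SU_group_eq K.compose_mem Det_compose)
  moreover have "(g o\<^sub>L ?d) (axis k 1) = x" using j g(2) by (simp add: complex.diag_axis)
  ultimately show "\<exists>g\<in>SU_group. g (axis k 1) = x" by blast
next
  interpret SU: isometry_group "SU_group :: (complex ^ 'n) op set"
    by (rule SU_isometry_group)
  interpret K: isometry_group "K_group :: (complex ^ 'n) op set"
    by (rule K_group_isometry_group)
  obtain j where j: "j \<noteq> k" using third_index[OF card, of k k] by blast
  fix y :: "complex ^ 'n" assume "inner (axis k 1) y = 0"
  then obtain w \<theta> where y: "w $ k = 0" "cnj \<theta> = - \<theta>" "y = w + axis k \<theta>"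
    by (rule complex.tangent_decomposition)
  let ?p = "axis k 1 :: complex ^ 'n" and ?q = "axis j 1 :: complex ^ 'n"
  have "complex.rot ?p w \<in> lie_algebra SU_group"
  proof (rule SU_lie[OF complex.rot_lie])
    let ?g = "complex.diag (\<lambda>i. if i = k then 1 else - 1)"
    show "?g \<in> K_group" by (rule complex.diag_K) (simp add: complex.norm_1)
    have "complex.hform w (?g x) = - complex.hform w x" for x
      using y(1) by (auto simp: complex.hform_def complex.diag_nth sum_negf[symmetric] intro!: sum.cong)
    then show "?g (complex.rot ?p w x) = - complex.rot ?p w (?g x)" for x
      unfolding complex.rot_apply complex.hform_axis
      using y(1) by (auto simp: vec_eq_iff complex.diag_nth axis_def)
  qed
  moreover have "complex.phase ?p \<theta> - complex.phase ?q \<theta> \<in> lie_algebra SU_group"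
  proof (rule SU_lie)
    show "complex.phase ?p \<theta> - complex.phase ?q \<theta> \<in> lie_algebra K_group"
      by (intro subspace_diff[OF K.subspace_lie] complex.phase_lie y)
    show "coord_swap j k \<in> K_group" by (rule coord_swap_K)
    show "coord_swap j k ((complex.phase ?p \<theta> - complex.phase ?q \<theta>) x)
        = - (complex.phase ?p \<theta> - complex.phase ?q \<theta>) (coord_swap j k x)" for x
      unfolding blinfun.diff_left complex.phase_apply complex.hform_axis
      using j by (auto simp: vec_eq_iff coord_swap_nth axis_def Transposition.transpose_def)
  qed
  ultimately have "complex.rot ?p w + (complex.phase ?p \<theta> - complex.phase ?q \<theta>) \<in> lie_algebra SU_group"
    by (rule SU.add_lie)
  moreover have "complex.phase ?q \<theta> ?p = 0"
    unfolding complex.phase_apply complex.hform_axis using j by (simp add: vec_eq_iff axis_def)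
  then have "(complex.rot ?p w + (complex.phase ?p \<theta> - complex.phase ?q \<theta>)) ?p = y"
    by (simp add: blinfun.add_left blinfun.diff_left complex.rot_axis complex.phase_axis y)
  ultimately show "\<exists>Y\<in>lie_algebra SU_group. Y ?p = y" by blast
qed

text \<open>
  A third index is needed to find, for each \<open>j \<noteq> k\<close>, an element of \<open>H\<close> that changes the sign of the
  \<open>j\<close>-th component: its determinant is restored by a second sign.
\<close>

theorem SU_equigeodesic_vectors:
  assumes card: "CARD('n::finite) \<ge> 3"
    and "bi_invariant_inner_product SU_group B" "fixed_compl SU_group (axis k (1 :: complex)) B \<noteq> {0}"
  shows "{X \<in> reductive_compl SU_group (axis k 1) B.
            randers_equigeodesic_vector SU_group (axis k 1) B X}
         = fixed_compl SU_group (axis k (1 :: complex) :: complex ^ 'n) B - {0}"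
proof -
  interpret reductive_sphere SU_group "axis k (1 :: complex) :: complex ^ 'n" B
    using assms(2) SU_sphere_action[OF card]
    by (simp add: reductive_sphere_def reductive_sphere_axioms_def)
  show ?thesis
  proof (rule equigeodesic_vectors_eq_fixed)
    show "equivariant_structure (Rmult \<i>)"
      by (rule complex.Rmult_structure[OF sphere_action_axioms]) (auto simp: K_groupD SU_group_eq)
    show "\<exists>r. v = r *\<^sub>R Rmult \<i> (axis k 1)"
      if v: "inner (axis k 1) v = 0" "\<forall>h\<in>isotropy SU_group (axis k 1). h v = v" for v
    proof (rule complex_fixed_line[OF v(1)])
      have "v $ j = 0" if "j \<noteq> k" for j
      proof -
        obtain i where i: "i \<noteq> j" "i \<noteq> k" using third_index[OF card] by blast
        let ?d = "\<lambda>l. (if l = i then - 1 else 1) * (if l = j then - 1 else 1 :: complex)"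
        have "Det (complex.diag ?d) = 1" unfolding Det_diag prod.distrib by simp
        moreover have "complex.diag ?d \<in> K_group" by (rule complex.diag_K) (simp add: complex.norm_1)
        ultimately have "complex.diag ?d \<in> isotropy SU_group (axis k 1)"
          using i that by (simp add: isotropy_def SU_group_eq complex.diag_axis)
        with v(2) have "complex.diag ?d v $ j = v $ j" by simp
        then show ?thesis using i by (simp add: complex.diag_nth)
      qed
      then show "v = axis k (v $ k)" by (auto simp: vec_eq_iff axis_def)
    qed
  qed (use assms(3) in simp)
qed

subsection \<open>The groups \<open>Sp(n+1)U(1)\<close>\<close>

lemma quat_of_complex_simps:
  "quat_of_complex (z * w) = quat_of_complex z * quat_of_complex w"
  "quat_of_complex 1 = 1"
  "inner (quat_of_complex z) (quat_of_complex z) = (cmod z)\<^sup>2"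
  by (simp_all add: quat_of_complex_def quat_eq_iff times_quat_def inner_quat_def cmod_power2)
    (simp_all add: power2_eq_square)

text \<open>
  In this form the group is a continuous image of a compact set, which is how closedness is obtained.
\<close>

lemma SpU1_group_eq:
  "SpU1_group = (\<lambda>(z, h). Rmult (quat_of_complex z) o\<^sub>L h) ` (sphere 0 1 \<times> K_group)"
proof (intro equalityI subsetI)
  fix g :: "(quat ^ 'n) op"
  assume "g \<in> SpU1_group"
  then obtain A z where A: "quat_unitary_mat A" "cmod z = 1"
    "\<And>x. g x = (\<chi> i. (A *v x) $ i * quat_of_complex (inverse z))"
    by (auto simp: SpU1_group_def)
  have lin: "linear (\<lambda>x. A *v x)"
    by (rule linearI) (simp_all add: vec_eq_iff matrix_vector_mult_def distrib_left sum.distrib scaleR_sum_right)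
  define h where "h = Blinfun (\<lambda>x. A *v x)"
  have h: "h x = A *v x" for x
    by (simp add: h_def bounded_linear_Blinfun_apply bounded_linear_on_euclidean lin)
  have "h \<in> K_group" using A(1) h by (auto simp: quat.K_group_matrix_iff quat_unitary_mat_def)
  moreover have "g = Rmult (quat_of_complex (inverse z)) o\<^sub>L h"
    by (rule blinfun_eqI) (simp add: A(3) h rmult_def)
  moreover have "inverse z \<in> sphere 0 1" using A(2) by (simp add: norm_inverse)
  ultimately show "g \<in> (\<lambda>(z, h). Rmult (quat_of_complex z) o\<^sub>L h) ` (sphere 0 1 \<times> K_group)" by force
next
  fix g :: "(quat ^ 'n) op"
  assume "g \<in> (\<lambda>(z, h). Rmult (quat_of_complex z) o\<^sub>L h) ` (sphere 0 1 \<times> K_group)"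
  then obtain z h where zh: "cmod z = 1" "h \<in> K_group" "g = Rmult (quat_of_complex z) o\<^sub>L h" by auto
  then obtain A where A: "quat_unitary_mat A" "\<And>x. h x = A *v x"
    by (auto simp: quat.K_group_matrix_iff quat_unitary_mat_def)
  show "g \<in> SpU1_group"
    unfolding SpU1_group_def
    using zh A by (intro CollectI exI[of _ A] exI[of _ "inverse z"]) (auto simp: norm_inverse rmult_def)
qed

lemma SpU1_memI: "cmod z = 1 \<Longrightarrow> h \<in> K_group \<Longrightarrow> Rmult (quat_of_complex z) o\<^sub>L h \<in> SpU1_group"
  by (auto simp: SpU1_group_eq)

lemma SpU1_memE:
  assumes "g \<in> SpU1_group"
  obtains z h where "cmod z = 1" "h \<in> K_group" "\<And>x. blinfun_apply g x = rmult (h x) (quat_of_complex z)"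
  using assms by (auto simp: SpU1_group_eq)

lemma K_subset_SpU1: "K_group \<subseteq> SpU1_group"
proof
  fix h :: "(quat ^ 'n) op" assume h: "h \<in> K_group"
  have "Rmult (quat_of_complex 1) o\<^sub>L h = h"
    by (rule blinfun_eqI) (simp add: quat_of_complex_simps)
  then show "h \<in> SpU1_group" using SpU1_memI[of 1 h] h by simp
qed

lemma SpU1_isometry_group:
  "isometry_group (SpU1_group :: (quat ^ 'n) op set)"
proof -
  interpret K: isometry_group "K_group :: (quat ^ 'n) op set"
    by (rule K_group_isometry_group)
  show ?thesis
  proof
    show "id_blinfun \<in> (SpU1_group :: (quat ^ 'n) op set)"
      using K_subset_SpU1 K.id_mem by blast
    fix g :: "(quat ^ 'n) op"
    assume g: "g \<in> SpU1_group"
    obtain z h where zh: "cmod z = 1" "h \<in> K_group" "\<And>x. g x = rmult (h x) (quat_of_complex z)"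
      by (rule SpU1_memE[OF g]) blast
    have qz: "inner (quat_of_complex z) (quat_of_complex z) = 1" using zh(1) by (simp add: quat_of_complex_simps)
    show "norm (g x) = norm x" for x
      by (simp add: zh(3) quat.norm_rmult[OF qz] K.isometry[OF zh(2)])
    show "g o\<^sub>L g' \<in> SpU1_group" if g': "g' \<in> SpU1_group" for g'
    proof -
      obtain z' h' where zh': "cmod z' = 1" "h' \<in> K_group" "\<And>x. g' x = rmult (h' x) (quat_of_complex z')"
        by (rule SpU1_memE[OF g']) blast
      have "g o\<^sub>L g' = Rmult (quat_of_complex (z' * z)) o\<^sub>L (h o\<^sub>L h')"
        by (rule blinfun_eqI) (simp add: zh(3) zh'(3) K_groupD(2)[OF zh(2)] rmult_rmult quat_of_complex_simps)
      then show ?thesis using zh zh' by (auto intro!: SpU1_memI K.compose_mem simp: norm_mult)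
    qed
    show "\<exists>g'\<in>SpU1_group. g o\<^sub>L g' = id_blinfun"
    proof -
      have z0: "z \<noteq> 0" using zh(1) by auto
      obtain h' where h': "h' \<in> K_group" "h o\<^sub>L h' = id_blinfun" using K.inverse_ex[OF zh(2)] by blast
      have hh: "h (h' x) = x" for x using arg_cong[OF h'(2), of "\<lambda>f. blinfun_apply f x"] by simp
      let ?g = "Rmult (quat_of_complex (inverse z)) o\<^sub>L h'"
      have "g o\<^sub>L ?g = id_blinfun"
        by (rule blinfun_eqI)
          (simp add: zh(3) K_groupD(2)[OF zh(2)] rmult_rmult hh quat_of_complex_simps(1)[symmetric] z0
            quat_of_complex_simps(2))
      moreover have "?g \<in> SpU1_group" using zh(1) h'(1) by (intro SpU1_memI) (simp add: norm_inverse)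
      ultimately show ?thesis by blast
    qed
  next
    have "linear (\<lambda>z. Rmult (quat_of_complex z) :: (quat ^ 'n) op)"
    proof (rule linearI; rule blinfun_eqI)
      fix z w and x :: "quat ^ 'n"
      show "Rmult (quat_of_complex (z + w)) x = (Rmult (quat_of_complex z) + Rmult (quat_of_complex w)) x"
        by (simp add: blinfun.add_left) (simp add: vec_eq_iff quat_of_complex_def quat_eq_iff times_quat_def algebra_simps)
      show "Rmult (quat_of_complex (r *\<^sub>R z)) x = (r *\<^sub>R Rmult (quat_of_complex z)) x" for r
        by (simp add: blinfun.scaleR_left) (simp add: vec_eq_iff quat_of_complex_def quat_eq_iff times_quat_def algebra_simps)
    qed
    then have 1: "continuous_on S (\<lambda>z. Rmult (quat_of_complex z) :: (quat ^ 'n) op)" for S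
      by (intro linear_continuous_on bounded_linear_on_euclidean)
    have 2: "continuous_on S (\<lambda>x. Rmult (quat_of_complex (fst x)) :: (quat ^ 'n) op)"
      for S :: "(complex \<times> (quat ^ 'n) op) set"
      by (rule continuous_on_compose2[OF 1[of UNIV] continuous_on_fst[OF continuous_on_id]]) simp
    have "continuous_on S (\<lambda>(z, h). Rmult (quat_of_complex z) o\<^sub>L (h :: (quat ^ 'n) op))" for S
      unfolding case_prod_beta
      by (intro bounded_bilinear.continuous_on[OF bounded_bilinear_blinfun_compose]
          2 continuous_on_snd continuous_on_id)
    then have "compact (SpU1_group :: (quat ^ 'n) op set)"
      unfolding SpU1_group_eq by (intro compact_continuous_image compact_Times compact_sphere K.compact_group)
    then show "closed (SpU1_group :: (quat ^ 'n) op set)" by (rule compact_imp_closed)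
  qed
qed

lemma SpU1_sphere_action: "sphere_action SpU1_group (axis k (1 :: quat) :: quat ^ 'n)"
proof (intro sphere_action.intro sphere_action_axioms.intro SpU1_isometry_group quat.norm_axis)
  interpret Sp: sphere_action K_group "axis k (1 :: quat) :: quat ^ 'n"
    by (rule quat.K_group_sphere_action)
  show "\<exists>g\<in>SpU1_group. g (axis k 1) = x" if "norm x = 1" for x :: "quat ^ 'n"
    using Sp.transitive[OF that] K_subset_SpU1 by blast
  show "\<exists>Y\<in>lie_algebra SpU1_group. Y (axis k 1) = y" if "inner (axis k 1) y = 0" for y :: "quat ^ 'n"
    using Sp.inf_transitive[OF that] K_subset_SpU1 by (fastforce simp: lie_algebra_def)
qed

text \<open>
  Besides the reflections, \<open>H\<close> contains conjugation by \<open>i\<close>, which singles out \<open>\<real> i\<close> among the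
  imaginary quaternions in the \<open>k\<close>-th component.
\<close>

theorem SpU1_equigeodesic_vectors:
  assumes "bi_invariant_inner_product SpU1_group B" "fixed_compl SpU1_group (axis k (1 :: quat)) B \<noteq> {0}"
  shows "{X \<in> reductive_compl SpU1_group (axis k 1) B.
            randers_equigeodesic_vector SpU1_group (axis k 1) B X}
         = fixed_compl SpU1_group (axis k (1 :: quat) :: quat ^ 'n) B - {0}"
proof -
  interpret reductive_sphere SpU1_group "axis k (1 :: quat) :: quat ^ 'n" B
    using assms(1) SpU1_sphere_action
    by (simp add: reductive_sphere_def reductive_sphere_axioms_def)
  let ?i = "quat_of_complex \<i>"
  show ?thesis
  proof (rule equigeodesic_vectors_eq_fixed)
    show "equivariant_structure (Rmult ?i)"
    proof (rule quat.Rmult_structure[OF sphere_action_axioms])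
      show "qcnj ?i = - ?i" "?i * ?i = - 1"
        by (simp_all add: quat_of_complex_def qcnj_def quat_eq_iff times_quat_def)
      fix g :: "(quat ^ 'n) op" and x assume "g \<in> SpU1_group"
      then obtain z h where zh: "cmod z = 1" "h \<in> K_group" "\<And>x. g x = rmult (h x) (quat_of_complex z)"
        by (rule SpU1_memE) blast
      show "g (rmult x ?i) = rmult (g x) ?i"
        by (simp add: zh(3) K_groupD(2)[OF zh(2)] rmult_rmult quat_of_complex_simps(1)[symmetric] mult.commute)
    qed
    show "\<exists>r. v = r *\<^sub>R Rmult ?i (axis k 1)"
      if v: "inner (axis k 1) v = 0" "\<forall>h\<in>isotropy SpU1_group (axis k 1). h v = v" for v
    proof -
      have "quat.diag (\<lambda>i. if i = k then 1 else - 1) \<in> isotropy SpU1_group (axis k 1)"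
        using quat.reflection_isotropy K_subset_SpU1 by (fastforce simp: isotropy_def)
      then have v1: "v = axis k (v $ k)" using quat.fixed_imp_axis[of k v] v(2) by blast
      let ?g = "Rmult (quat_of_complex (- \<i>)) o\<^sub>L quat.diag (\<lambda>_. ?i)"
      have "?g \<in> SpU1_group"
        by (intro SpU1_memI quat.diag_K) (simp_all add: quat_of_complex_simps)
      moreover have "?g (axis k 1) = axis k 1"
        by (simp add: vec_eq_iff quat.diag_nth axis_def quat_of_complex_def quat_eq_iff times_quat_def)
      ultimately have "?g \<in> isotropy SpU1_group (axis k 1)" by (simp add: isotropy_def)
      then have "?g v = v" using v(2) by blast
      then have "?g v $ k = v $ k" by (rule arg_cong)
      then have "?i * v $ k * quat_of_complex (- \<i>) = v $ k" by (simp add: quat.diag_nth)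
      moreover have "qRe (v $ k) = 0" using quat.tangent_axis[OF v(1)] by (simp add: inner_quat_def)
      ultimately have "v $ k = qI (v $ k) *\<^sub>R ?i"
        by (simp add: quat_of_complex_def quat_eq_iff times_quat_def)
      then have "axis k (v $ k) = qI (v $ k) *\<^sub>R rmult (axis k 1) ?i"
        by (auto simp: vec_eq_iff axis_def)
      then show ?thesis using v1 by auto
    qed
  qed (use assms(2) in simp)
qed

subsection \<open>The groups \<open>Sp(n+1)\<close>\<close>

lemma imaginary_square:
  assumes "qRe \<theta> = 0"
  shows "qcnj \<theta> = - \<theta>" "\<theta> * \<theta> = - (inner \<theta> \<theta> *\<^sub>R 1)"
  using assms by (simp_all add: qcnj_def quat_eq_iff times_quat_def inner_quat_def)

text \<open>
  A rotation that changes the direction of a given imaginary quaternion: about \<open>i\<close>, or about \<open>j\<close>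
  for the multiples of \<open>i\<close>. The rational point \<open>(3/5, 4/5)\<close> of the circle serves as half angle.
\<close>

lemma rotate_imaginary:
  assumes \<theta>: "qRe \<theta> = 0" "\<theta> \<noteq> 0"
  obtains a where "inner a a = 1" "qRe (a * \<theta> * qcnj a) = 0"
    "\<And>s s'. s *\<^sub>R \<theta> = s' *\<^sub>R (a * \<theta> * qcnj a) \<Longrightarrow> s = 0"
proof -
  obtain b c d where bcd: "\<theta> = Quat 0 b c d" using \<theta>(1) by (cases \<theta>) auto
  have plane: "s = 0" if nz: "x \<noteq> 0 \<or> y \<noteq> 0"
    and "25 * (s * x) = s' * (- 7 * x - 24 * y)" "25 * (s * y) = s' * (24 * x - 7 * y)" for s s' x y :: real
  proof -
    have "0 = x * (25 * (s * y)) - y * (25 * (s * x))" by simp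
    also have "\<dots> = 24 * s' * (x\<^sup>2 + y\<^sup>2)"
      unfolding that(2,3) by (simp add: algebra_simps power2_eq_square)
    finally have "s' = 0" using nz by (auto simp: sum_power2_eq_zero_iff)
    then show ?thesis using that by auto
  qed
  show thesis
  proof (cases "c = 0 \<and> d = 0")
    case False
    let ?a = "Quat (3/5) (4/5) 0 0"
    have rot: "?a * \<theta> * qcnj ?a = Quat 0 b ((- 7 * c - 24 * d) / 25) ((24 * c - 7 * d) / 25)"
      by (simp add: bcd quat_eq_iff times_quat_def qcnj_def field_simps)
    show thesis
    proof (rule that[of ?a])
      show "inner ?a ?a = 1" by (simp add: inner_quat_def)
      show "qRe (?a * \<theta> * qcnj ?a) = 0" by (simp add: rot)
      fix s s' assume "s *\<^sub>R \<theta> = s' *\<^sub>R (?a * \<theta> * qcnj ?a)"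
      then have "25 * (s * c) = s' * (- 7 * c - 24 * d)" "25 * (s * d) = s' * (24 * c - 7 * d)"
        unfolding rot by (simp_all add: bcd quat_eq_iff)
      then show "s = 0" using plane[of c d s s'] False by blast
    qed
  next
    case True
    then have b: "b \<noteq> 0" using \<theta>(2) by (auto simp: bcd quat_eq_iff)
    let ?a = "Quat (3/5) 0 (4/5) 0"
    have rot: "?a * \<theta> * qcnj ?a = Quat 0 (- 7 * b / 25) 0 (- 24 * b / 25)"
      using True by (simp add: bcd quat_eq_iff times_quat_def qcnj_def field_simps)
    show thesis
    proof (rule that[of ?a])
      show "inner ?a ?a = 1" by (simp add: inner_quat_def)
      show "qRe (?a * \<theta> * qcnj ?a) = 0" by (simp add: rot)
      fix s s' assume "s *\<^sub>R \<theta> = s' *\<^sub>R (?a * \<theta> * qcnj ?a)"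
      then have "s * b = s' * (- 7 * b / 25)" "0 = s' * (- 24 * b / 25)"
        unfolding rot using True by (simp_all add: bcd quat_eq_iff)
      then show "s = 0" using b by auto
    qed
  qed
qed

text \<open>
  A fixed vector gives a covector \<open>p \<theta>\<close> with \<open>\<theta>\<close> imaginary, and the diagonal matrices with one entry
  \<open>a\<close> at \<open>k\<close> replace \<open>\<theta>\<close> by \<open>a \<theta> a\<^sup>*\<close>. Two independent directions contradict each other.
\<close>

theorem Sp_no_equigeodesic:
  assumes "bi_invariant_inner_product Sp_group B" "fixed_compl Sp_group (axis k (1 :: quat) :: quat ^ 'n) B \<noteq> {0}"
  shows "\<not> randers_equigeodesic Sp_group (axis k (1 :: quat) :: quat ^ 'n) B c"
proof -
  interpret reductive_sphere K_group "axis k (1 :: quat) :: quat ^ 'n" B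
    using assms(1) quat.K_group_sphere_action
    by (simp add: reductive_sphere_def reductive_sphere_axioms_def Sp_group_eq)
  let ?p = "axis k (1 :: quat) :: quat ^ 'n"
  have "0 \<in> \<mm>\<^sub>0" by (simp add: fixed_compl_iff subspace_0[OF \<mm>_subspace])
  then obtain u where u: "u \<in> \<mm>\<^sub>0" "u \<noteq> 0" using assms(2) by (auto simp: Sp_group_eq)
  obtain \<xi> where \<xi>: "covector u \<xi>" using fixed_compl_covector[OF u(1)] by blast
  define \<theta> where "\<theta> = \<xi> $ k"
  have \<xi>\<theta>: "\<xi> = axis k \<theta>"
    using quat.fixed_imp_axis[of k \<xi>] quat.reflection_isotropy[of k] \<xi> by (auto simp: covector_def \<theta>_def)
  have \<theta>: "qRe \<theta> = 0" "\<theta> \<noteq> 0"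
  proof -
    show "qRe \<theta> = 0"
      using quat.tangent_axis[of k \<xi>] \<xi> by (simp add: \<theta>_def covector_def inner_quat_def)
    have "(axis k 0 :: quat ^ 'n) = 0" by (simp add: vec_eq_iff axis_def)
    then show "\<theta> \<noteq> 0" using covector_nonzero[OF u \<xi>] \<xi>\<theta> by auto
  qed
  obtain a where a: "inner a a = 1" "qRe (a * \<theta> * qcnj a) = 0"
    "\<And>s s'. s *\<^sub>R \<theta> = s' *\<^sub>R (a * \<theta> * qcnj a) \<Longrightarrow> s = 0"
    by (rule rotate_imaginary[OF \<theta>]) blast
  have aa: "qcnj a * a = 1" "a * qcnj a = 1" "inner (qcnj a) (qcnj a) = 1"
    using a(1) quat.cj_mult_self[of a]
    by (simp_all add: qcnj_def quat_eq_iff times_quat_def inner_quat_def)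
  define \<theta>' where "\<theta>' = a * \<theta> * qcnj a"
  define N where "N = sqrt (inner \<theta> \<theta>)"
  have N: "N > 0" "N * N = inner \<theta> \<theta>" using \<theta>(2) by (simp_all add: N_def)
  have N': "N * N = inner \<theta>' \<theta>'" by (simp add: \<theta>'_def quat.inner_mult_self a(1) aa(3) N(2))
  let ?g = "quat.diag (\<lambda>i. if i = k then a else 1) :: (quat ^ 'n) op"
  have g: "?g \<in> K_group" by (rule quat.diag_K) (simp add: a(1) quat.norm_1)
  have gp: "?g ?p = Rmult a ?p" by (simp add: quat.diag_axis axis_rmult)
  have comm: "Rmult b (h x) = h (Rmult b x)" if "h \<in> K_group" for b h and x :: "quat ^ 'n"
    by (simp add: K_groupD(2)[OF that])
  have "Rmult (qcnj a) (?g \<xi>) = axis k \<theta>'"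
    by (auto simp: \<xi>\<theta> \<theta>'_def vec_eq_iff quat.diag_nth axis_def)
  then have u': "Ad ?g u \<in> \<mm>\<^sub>0" "Ad ?g u \<noteq> 0" "covector (Ad ?g u) (axis k \<theta>')"
    using covector_Ad[of "Rmult a" "Rmult (qcnj a)", OF comm comm _ _ g gp u \<xi>]
    by (simp_all add: rmult_rmult aa quat.inner_rmult_adjoint)
  have struct: "equivariant_structure (Rmult ((1 / N) *\<^sub>R \<phi>))"
    if "qRe \<phi> = 0" "N * N = inner \<phi> \<phi>" for \<phi>
  proof (rule quat.Rmult_structure[OF sphere_action_axioms])
    show "qcnj ((1 / N) *\<^sub>R \<phi>) = - ((1 / N) *\<^sub>R \<phi>)"
      using imaginary_square(1)[OF that(1)] linear_scale[OF quat.cj_linear] by simp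
    show "(1 / N) *\<^sub>R \<phi> * (1 / N) *\<^sub>R \<phi> = - 1"
      using N(1) by (simp add: imaginary_square(2)[OF that(1)] that(2)[symmetric])
  qed (simp add: K_groupD)
  have ax: "axis k \<phi> = N *\<^sub>R Rmult ((1 / N) *\<^sub>R \<phi>) ?p" for \<phi>
    using N(1) by (auto simp: vec_eq_iff axis_def)
  have "\<not> randers_equigeodesic K_group ?p B c"
  proof (rule no_equigeodesic_of_independent_structures[OF struct[OF \<theta>(1) N(2)]
        struct[OF a(2)[folded \<theta>'_def] N'] u _ u'(1,2)])
    show "covector u (N *\<^sub>R Rmult ((1 / N) *\<^sub>R \<theta>) ?p)" using \<xi> ax[of \<theta>] \<xi>\<theta> by simp
    show "covector (Ad ?g u) (N *\<^sub>R Rmult ((1 / N) *\<^sub>R \<theta>') ?p)" using u'(3) ax[of \<theta>'] by simp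
    fix q :: "quat ^ 'n" and s s'
    assume q: "norm q = 1" and eq: "s *\<^sub>R Rmult ((1 / N) *\<^sub>R \<theta>) q = s' *\<^sub>R Rmult ((1 / N) *\<^sub>R \<theta>') q"
    let ?b = "(s / N) *\<^sub>R \<theta> - (s' / N) *\<^sub>R \<theta>'"
    have "rmult q ?b = 0" using eq by (simp add: vec_eq_iff right_diff_distrib)
    moreover have "q \<noteq> 0" using q by auto
    ultimately have "inner ?b ?b = 0"
      using quat.inner_rmult_self[of q ?b] by simp
    then have "(s / N) *\<^sub>R \<theta> = (s' / N) *\<^sub>R \<theta>'" by simp
    then show "s = 0" using a(3)[of "s / N" "s' / N"] N(1) by (simp add: \<theta>'_def)
  qed
  then show ?thesis by (simp add: Sp_group_eq)
qed

section \<open>Randers equigeodesics on the homogeneous spheres\<close>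

theorem theorem1p3:
  fixes n :: nat and k :: "'n::finite"
  assumes dim: "CARD('n) = n + 1"
  shows
   "(n \<ge> 2 \<longrightarrow>
      (\<forall>B. bi_invariant_inner_product SU_group B \<and>
           fixed_compl SU_group (axis k (1::complex)) B \<noteq> {0} \<longrightarrow>
         {X \<in> reductive_compl SU_group (axis k 1) B.
            randers_equigeodesic_vector SU_group (axis k 1) B X}
         = fixed_compl SU_group (axis k 1) B - {0})) \<and>
    (n \<ge> 1 \<longrightarrow>
      (\<forall>B. bi_invariant_inner_product U_group B \<and>
           fixed_compl U_group (axis k (1::complex)) B \<noteq> {0} \<longrightarrow>
         {X \<in> reductive_compl U_group (axis k 1) B.
            randers_equigeodesic_vector U_group (axis k 1) B X}
         = fixed_compl U_group (axis k 1) B - {0})) \<and>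
    (n \<ge> 1 \<longrightarrow>
      (\<forall>B. bi_invariant_inner_product SpU1_group B \<and>
           fixed_compl SpU1_group (axis k (1::quat)) B \<noteq> {0} \<longrightarrow>
         {X \<in> reductive_compl SpU1_group (axis k 1) B.
            randers_equigeodesic_vector SpU1_group (axis k 1) B X}
         = fixed_compl SpU1_group (axis k 1) B - {0})) \<and>
    (n \<ge> 1 \<longrightarrow>
      (\<forall>B. bi_invariant_inner_product Sp_group B \<and>
           fixed_compl Sp_group (axis k (1::quat)) B \<noteq> {0} \<longrightarrow>
         (\<nexists>c. randers_equigeodesic Sp_group (axis k 1) B c) \<and>
         (\<nexists>X. randers_equigeodesic_vector Sp_group (axis k 1) B X)))"
proof (intro conjI impI allI)
  fix B assume "n \<ge> 2" "bi_invariant_inner_product SU_group B \<and> fixed_compl SU_group (axis k (1::complex)) B \<noteq> {0}"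
  then show "{X \<in> reductive_compl SU_group (axis k 1) B.
            randers_equigeodesic_vector SU_group (axis k 1) B X}
         = fixed_compl SU_group (axis k 1) B - {0}"
    using SU_equigeodesic_vectors[of B k] dim by auto
next
  fix B assume "bi_invariant_inner_product U_group B \<and> fixed_compl U_group (axis k (1::complex)) B \<noteq> {0}"
  then show "{X \<in> reductive_compl U_group (axis k 1) B.
            randers_equigeodesic_vector U_group (axis k 1) B X}
         = fixed_compl U_group (axis k 1) B - {0}"
    using U_equigeodesic_vectors[of B k] by blast
next
  fix B assume "bi_invariant_inner_product SpU1_group B \<and> fixed_compl SpU1_group (axis k (1::quat)) B \<noteq> {0}"
  then show "{X \<in> reductive_compl SpU1_group (axis k 1) B.
            randers_equigeodesic_vector SpU1_group (axis k 1) B X}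
         = fixed_compl SpU1_group (axis k 1) B - {0}"
    using SpU1_equigeodesic_vectors[of B k] by blast
next
  fix B assume "bi_invariant_inner_product Sp_group B \<and> fixed_compl Sp_group (axis k (1::quat)) B \<noteq> {0}"
  then show no: "\<nexists>c. randers_equigeodesic Sp_group (axis k 1) B c"
    using Sp_no_equigeodesic[of B k] by blast
  then show "\<nexists>X. randers_equigeodesic_vector Sp_group (axis k 1) B X"
    by (auto simp: randers_equigeodesic_vector_def)
qed

end
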